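(* Let $J\in\mathbb{R}^{n\times n}$ be a (symmetric) nonnegative definite matrix with largest eigenvalue $\lambda(J)<1/2$, and let $\overline{J}=\max_{i\in[n]}\sum_{j\in[n]}|J_{i,j}|$. Then, for any partition $\mathcal{A}$ of $[n]$, for any $N\ge2$ and any $\rho\in D_{\mathcal{A},N}$, the Dirichlet form $\mathcal{E}_{N,J,\rho}$ defined by $J$ and $\mathcal{K}=\mathcal{K}_{\mathcal{A}}$ satisfies $$\mathcal{E}_{N,J,\rho}(F,\log F)\ge\alpha\,\mathrm{Ent}_{\mu_{N,J,\rho}}F$$ for all functions $F:\Omega_{N,\rho}\to[0,\infty)$, with a constant $\alpha$ such that $$\alpha\ge\tfrac1{4n}(1-2\lambda(J))^2e^{-16\overline{J}}.$$
   Context: Let $n\ge1$, $[n]=\{1,\dots,n\}$, $\Omega=\{-1,+1\}^n$. For symmetric $J\in\mathbb{R}^{n\times n}$, $\mu_J(\sigma)\propto\exp\big(\frac12\sum_{i,j\in[n]}J_{i,j}\sigma_i\sigma_j\big)$ is the associated Ising probability measure on $\Omega$. An element of $\Omega^N$ is written $\sigma=(\sigma(1),\dots,\sigma(N))$ with $\sigma(i)=(\sigma_1(i),\dots,\sigma_n(i))\in\Omega$. For $\ell\in[n]$, $\eta\in\Omega$, $a\in\{-1,1\}$, $S_\ell(\eta,a)$ is the configuration equal to $a$ at $\ell$ and to $\eta$ elsewhere; $\eta^{\ell,k}$ is $\eta$ with the spins at $\ell$ and $k$ exchanged. For $i,j\in[N]$, $\ell,k\in[n]$, $\sigma^{i,\ell;j,k}\in\Omega^N$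 is obtained from $\sigma$ by exchanging the spins $\sigma_\ell(i)$ and $\sigma_k(j)$ (all other spins unchanged), and $\nabla^{i,\ell;j,k}F(\sigma)=F(\sigma^{i,\ell;j,k})-F(\sigma)$. Set $$\hat p_J(\ell,k\,|\,\sigma(i),\sigma(j))=\frac{\mu_J(S_\ell(\sigma(i),\sigma_k(j)))\,\mu_J(S_k(\sigma(j),\sigma_\ell(i)))}{\mu_J(\sigma(i))\mu_J(\sigma(j))+\mu_J(S_\ell(\sigma(i),\sigma_k(j)))\,\mu_J(S_k(\sigma(j),\sigma_\ell(i)))}\quad(i\ne j),$$ $$\hat p_J(\ell,k\,|\,\sigma(i),\sigma(i))=\frac{\mu_J(\sigma(i)^{\ell,k})}{\mu_J(\sigma(i))+\mu_J(\sigma(i)^{\ell,k})}\quad(i=j).$$ Given a partition $\mathcal{A}$ of $[n]$: $\mathcal{K}_{\mathcal{A}}(\ell,k)=\frac1{|A|}$ if $\ell,k\in A$ for some $A\in\mathcal{A}$ and $0$ otherwise. $D_{\mathcal{A},N}$ is the set of vectors $\rho=(\rho(A),A\in\mathcal{A})\in[0,1]^{\mathcal{A}}$ such that $N|A|\rho(A)$ is a nonnegative integer for every $A\in\mathcal A$. For $\rho\in D_{\mathcal{A},N}$, $$\Omega_{N,\rho}=\Big\{\sigma\in\Omega^N:\ \sum_{i\in[N]}\sum_{\ell\in A}\sigma_\ell(i)=(2\rho(A)-1)N|A|\ \ \forall A\in\mathcal{A}\Big\},\qquad \mu_{N,J,\rho}=\mu_J^{\otimes N}(\cdot\,|\,\Omega_{N,\rho}).$$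 The Dirichlet form is, for $F,G$ on $\Omega_{N,\rho}$, $$\mathcal{E}_{N,J,\rho}(F,G)=\frac1{2Nn}\sum_{i,j=1}^N\sum_{\ell,k=1}^n\mathcal{K}(\ell,k)\,\mu_{N,J,\rho}\big[\hat p_J(\ell,k\,|\,\sigma(i),\sigma(j))\,\nabla^{i,\ell;j,k}F\,\nabla^{i,\ell;j,k}G\big],$$ where $\mu[\cdot]$ denotes expectation. The entropy is $\mathrm{Ent}_\mu F=\mu[F\log F]-\mu[F]\log\mu[F]$, $0\log0=0$. In $\mathcal{E}(F,\log F)$, the terms $(a-b)(\log a-\log b)$ are understood in $[0,+\infty]$, with value $0$ if $a=b=0$ and $+\infty$ if exactly one of $a,b$ vanishes. *)

theory Defs
  imports "HOL-Probability.Probability"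
begin

section \<open>Matrices\<close>

text \<open>The index set \<open>[n]\<close> is rendered by a finite type \<open>'n\<close> with \<open>n = CARD('n)\<close>.\<close>

definition nonneg_definite :: "real^'n^'n \<Rightarrow> bool" where
  "nonneg_definite J \<longleftrightarrow> transpose J = J \<and> (\<forall>x. 0 \<le> x \<bullet> (J *v x))"

definition eigenvalue :: "real^'n^'n \<Rightarrow> real \<Rightarrow> bool" where
  "eigenvalue J c \<longleftrightarrow> (\<exists>v. v \<noteq> 0 \<and> J *v v = c *s v)"

definition largest_eigenvalue :: "real^'n^'n \<Rightarrow> real" where
  "largest_eigenvalue J = Max {c. eigenvalue J c}"

definition max_abs_row_sum :: "real^'n^'n \<Rightarrow> real" where
  "max_abs_row_sum J = Max (range (\<lambda>i. \<Sum>j\<in>UNIV. \<bar>J $ i $ j\<bar>))"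


section \<open>The Ising measure\<close>

type_synonym 'n spins = "'n \<Rightarrow> real"

definition Omega :: "'n spins set" where
  "Omega = UNIV \<rightarrow> {-1, 1}"

definition ising_weight :: "real^'n^'n \<Rightarrow> 'n::finite spins \<Rightarrow> real" where
  "ising_weight J \<eta> = exp (1/2 * (\<Sum>i\<in>UNIV. \<Sum>j\<in>UNIV. J $ i $ j * \<eta> i * \<eta> j))"

definition ising :: "real^'n^'n \<Rightarrow> 'n::finite spins pmf" where
  "ising J = embed_pmf (\<lambda>\<eta>. if \<eta> \<in> Omega
     then ising_weight J \<eta> / (\<Sum>\<xi>\<in>Omega. ising_weight J \<xi>) else 0)"

lemma finite_Omega: "finite (Omega :: 'n::finite spins set)"
proof -
  have "(Omega :: 'n spins set) = Pi\<^sub>E UNIV (\<lambda>_. {-1, 1})"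
    by (auto simp: Omega_def PiE_def)
  moreover have "finite (Pi\<^sub>E (UNIV :: 'n set) (\<lambda>_. {-1, 1 :: real}))"
    by (rule finite_PiE) auto
  ultimately show ?thesis by simp
qed

lemma pmf_ising:
  "pmf (ising J) \<eta> = (if \<eta> \<in> Omega
     then ising_weight J \<eta> / (\<Sum>\<xi>\<in>Omega. ising_weight J \<xi>) else 0)"
proof -
  define Z where "Z = (\<Sum>\<xi>\<in>Omega. ising_weight J \<xi>)"
  have pos: "ising_weight J \<xi> > 0" for \<xi>
    by (simp add: ising_weight_def)
  have "(\<lambda>_. 1) \<in> (Omega :: 'a spins set)"
    by (simp add: Omega_def)
  then have Z: "Z > 0"
    unfolding Z_def using finite_Omega pos by (intro sum_pos) auto
  let ?f = "\<lambda>\<eta>. if \<eta> \<in> Omega then ising_weight J \<eta> / Z else 0"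
  have nn: "0 \<le> ?f \<xi>" for \<xi>
    using Z less_imp_le[OF pos] by simp
  have "(\<integral>\<^sup>+\<xi>. ennreal (?f \<xi>) \<partial>count_space UNIV)
      = (\<integral>\<^sup>+\<xi>. ennreal (?f \<xi>) \<partial>count_space Omega)"
    by (rule nn_integral_count_space_eq) auto
  also have "\<dots> = (\<Sum>\<xi>\<in>Omega. ennreal (?f \<xi>))"
    by (rule nn_integral_count_space_finite[OF finite_Omega])
  also have "\<dots> = ennreal (\<Sum>\<xi>\<in>Omega. ?f \<xi>)"
    by (rule sum_ennreal) (rule nn)
  also have "(\<Sum>\<xi>\<in>Omega. ?f \<xi>) = (\<Sum>\<xi>\<in>Omega. ising_weight J \<xi>) / Z"
    by (simp add: sum_divide_distrib)
  also have "\<dots> = 1"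
    using Z by (simp add: Z_def)
  finally have "(\<integral>\<^sup>+\<xi>. ennreal (?f \<xi>) \<partial>count_space UNIV) = 1"
    by simp
  from pmf_embed_pmf[of ?f, OF nn this] show ?thesis
    unfolding ising_def Z_def .
qed


section \<open>Replicated configurations with prescribed block magnetizations\<close>

text \<open>An element \<open>\<sigma>\<close> of \<open>\<Omega>\<^sup>N\<close> is an extensional function on
  \<open>{1..N}\<close>; \<open>\<sigma> i l\<close> is the spin of replica \<open>i\<close> at site \<open>l\<close>.\<close>

type_synonym 'n replicas = "nat \<Rightarrow> 'n spins"

definition density_profiles :: "'n set set \<Rightarrow> nat \<Rightarrow> ('n set \<Rightarrow> real) set" where
  "density_profiles \<A> N =
     {\<rho>. \<forall>A\<in>\<A>. \<rho> A \<in> {0..1} \<and> real N * real (card A) * \<rho> A \<in> \<nat>}"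

definition Omega_N :: "'n set set \<Rightarrow> nat \<Rightarrow> ('n set \<Rightarrow> real) \<Rightarrow> 'n replicas set" where
  "Omega_N \<A> N \<rho> = {\<sigma> \<in> {1..N} \<rightarrow>\<^sub>E Omega.
     \<forall>A\<in>\<A>. (\<Sum>i\<in>{1..N}. \<Sum>l\<in>A. \<sigma> i l) = (2 * \<rho> A - 1) * real N * real (card A)}"

definition mu_N :: "real^'n^'n \<Rightarrow> 'n::finite set set \<Rightarrow> nat \<Rightarrow> ('n set \<Rightarrow> real) \<Rightarrow> 'n replicas pmf" where
  "mu_N J \<A> N \<rho> = cond_pmf (Pi_pmf {1..N} undefined (\<lambda>_. ising J)) (Omega_N \<A> N \<rho>)"


section \<open>Exchange dynamics\<close>

definition set_spin :: "'n \<Rightarrow> 'n spins \<Rightarrow> real \<Rightarrow> 'n spins" where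
  "set_spin l \<eta> a = \<eta>(l := a)"

definition swap_sites :: "'n \<Rightarrow> 'n \<Rightarrow> 'n spins \<Rightarrow> 'n spins" where
  "swap_sites l k \<eta> = \<eta>(l := \<eta> k, k := \<eta> l)"

definition exchange :: "nat \<Rightarrow> 'n \<Rightarrow> nat \<Rightarrow> 'n \<Rightarrow> 'n replicas \<Rightarrow> 'n replicas" where
  "exchange i l j k \<sigma> = (\<lambda>i' l'. if i' = i \<and> l' = l then \<sigma> j k
                                else if i' = j \<and> l' = k then \<sigma> i l
                                else \<sigma> i' l')"

definition exchange_prob ::
    "real^'n^'n \<Rightarrow> nat \<Rightarrow> 'n::finite \<Rightarrow> nat \<Rightarrow> 'n \<Rightarrow> 'n replicas \<Rightarrow> real" where
  "exchange_prob J i l j k \<sigma> =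
    (let \<mu> = pmf (ising J) in
     if i \<noteq> j then
       \<mu> (set_spin l (\<sigma> i) (\<sigma> j k)) * \<mu> (set_spin k (\<sigma> j) (\<sigma> i l)) /
       (\<mu> (\<sigma> i) * \<mu> (\<sigma> j) + \<mu> (set_spin l (\<sigma> i) (\<sigma> j k)) * \<mu> (set_spin k (\<sigma> j) (\<sigma> i l)))
     else
       \<mu> (swap_sites l k (\<sigma> i)) / (\<mu> (\<sigma> i) + \<mu> (swap_sites l k (\<sigma> i))))"

definition block_kernel :: "'n set set \<Rightarrow> 'n \<Rightarrow> 'n \<Rightarrow> real" where
  "block_kernel \<A> l k =
     (if \<exists>A\<in>\<A>. l \<in> A \<and> k \<in> A then 1 / real (card (THE A. A \<in> \<A> \<and> l \<in> A \<and> k \<in> A)) else 0)"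


section \<open>Dirichlet form and entropy\<close>

text \<open>Observables take extended real values, so that \<open>log F\<close> is admissible also when
  \<open>F\<close> vanishes somewhere. The expectation is meant for measures of finite support;
  for real-valued observables it is the usual one (lemma below).\<close>

definition ext_expectation :: "'a pmf \<Rightarrow> ('a \<Rightarrow> ereal) \<Rightarrow> ereal" where
  "ext_expectation p f = (\<Sum>x\<in>set_pmf p. ereal (pmf p x) * f x)"

lemma ext_expectation_ereal:
  assumes "finite (set_pmf p)"
  shows "ext_expectation p (\<lambda>x. ereal (f x)) = ereal (measure_pmf.expectation p f)"
  by (simp add: ext_expectation_def integral_measure_pmf_real[OF assms] mult.commute)

definition exchange_gradient ::
    "nat \<Rightarrow> 'n \<Rightarrow> nat \<Rightarrow> 'n \<Rightarrow> ('n replicas \<Rightarrow> ereal) \<Rightarrow> 'n replicas \<Rightarrow> ereal" where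
  "exchange_gradient i l j k F \<sigma> = F (exchange i l j k \<sigma>) - F \<sigma>"

text \<open>If \<open>K l k = 0\<close> the exchanged configuration may leave \<open>Omega_N\<close>; the
  corresponding summand is 0 since \<open>0 * x = 0\<close> for every extended real \<open>x\<close>.\<close>

definition dirichlet_form ::
    "real^'n^'n \<Rightarrow> ('n \<Rightarrow> 'n \<Rightarrow> real) \<Rightarrow> 'n::finite set set \<Rightarrow> nat \<Rightarrow> ('n set \<Rightarrow> real) \<Rightarrow>
     ('n replicas \<Rightarrow> ereal) \<Rightarrow> ('n replicas \<Rightarrow> ereal) \<Rightarrow> ereal" where
  "dirichlet_form J K \<A> N \<rho> F G =
     ereal (1 / (2 * real N * real CARD('n))) *
     (\<Sum>i\<in>{1..N}. \<Sum>j\<in>{1..N}. \<Sum>l\<in>UNIV. \<Sum>k\<in>UNIV. ereal (K l k) *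
        ext_expectation (mu_N J \<A> N \<rho>) (\<lambda>\<sigma>.
          ereal (exchange_prob J i l j k \<sigma>) *
          (exchange_gradient i l j k F \<sigma> * exchange_gradient i l j k G \<sigma>)))"

definition ext_ln :: "real \<Rightarrow> ereal" where
  "ext_ln x = (if x = 0 then -\<infinity> else ereal (ln x))"

text \<open>With extended real arithmetic (where \<open>-\<infinity> - -\<infinity> = \<infinity>\<close> and
  \<open>0 * \<infinity> = 0\<close>), the products \<open>(a - b) (log a - log b)\<close> appearing in
  \<open>\<E>(F, log F)\<close> have the conventional values in \<open>[0, \<infinity>]\<close>.\<close>

lemma ext_ln_product:
  assumes "a \<ge> 0" "b \<ge> 0"
  shows "(ereal a - ereal b) * (ext_ln a - ext_ln b) =
    (if a = 0 \<and> b = 0 then 0 else if a = 0 \<or> b = 0 then \<infinity>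
     else ereal ((a - b) * (ln a - ln b)))"
  using assms by (auto simp: ext_ln_def zero_ereal_def[symmetric])

text \<open>The convention \<open>0 log 0 = 0\<close> holds because \<open>ln 0 = 0\<close> for the library's
  \<open>ln\<close>.\<close>

definition Ent :: "'a pmf \<Rightarrow> ('a \<Rightarrow> real) \<Rightarrow> real" where
  "Ent p F = measure_pmf.expectation p (\<lambda>x. F x * ln (F x))
     - measure_pmf.expectation p F * ln (measure_pmf.expectation p F)"

end

theory Submission
  imports Defs "HOL-Real_Asymp.Real_Asymp"
begin

text \<open>
  The proof has three parts: the interaction is removed by a Gaussian linearization, entropy
  is factorized for the product measures that remain, and the resulting local entropies are
  compared with single exchanges.

  Linearization. A nonnegative definite \<open>J\<close> has the form \<open>J\<^sub>l\<^sub>m = \<Sum>a. w\<^sub>a\<^sub>l w\<^sub>a\<^sub>m\<close>, and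
  \<open>exp (1/2 \<langle>\<eta>, J \<eta>\<rangle>)\<close> is the average of \<open>exp \<langle>\<theta>, w \<eta>\<rangle>\<close> over a standard Gaussian \<open>\<theta>\<close>. For a
  given field \<open>\<theta>\<close> the spins are independent up to the constraint on the block
  magnetizations. The average over \<open>\<theta>\<close> is performed in \<open>m\<close> small steps of a centred random
  walk, and two bounds are carried along, uniformly over all external fields: a variance
  bound \<open>Var (\<langle>u, w \<eta>\<rangle>) \<le> c |u|\<^sup>2\<close>, and a bound of the entropy by a sum of local entropies. A
  step of length \<open>\<epsilon>\<close> replaces \<open>c\<close> by \<open>c + \<epsilon>\<^sup>2 c\<^sup>2\<close> (\<open>variance_step\<close>) and loses a fraction
  \<open>2 c \<epsilon>\<^sup>2\<close> of the entropy (\<open>entropy_step\<close>), to leading order. So \<open>c\<close> solves the Riccati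
  equation \<open>c' = c\<^sup>2\<close>, that is \<open>c(t) = c\<^sub>0 / (1 - c\<^sub>0 t)\<close>, and up to time 1 the loss is the
  factor \<open>exp (- 2 \<integral>c) = (1 - c\<^sub>0)\<^sup>2\<close> (\<open>gaussian_mixture_entropy\<close>).

  Product measures. A configuration is encoded by the set \<open>X\<close> of the pairs (replica, site)
  that carry the minority spin of their block; the constraint prescribes how many elements
  of each block belong to \<open>X\<close>. The partition function is a product of elementary symmetric
  polynomials, and the theorem of Marcus and Lopes, that consecutive elementary symmetric
  polynomials have a concave quotient, bounds its logarithm by its derivative
  (\<open>log_block_poly_le\<close>). The dual form of this bound is entropic independence: revealing one
  of \<open>r\<close> elements reveals at most a fraction \<open>1/r\<close> of the entropy. By induction the entropy
  of \<open>F\<close> is at most the sum, over the sets \<open>S\<close> that lack one element, of the entropies of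
  \<open>F\<close> on the supersets of \<open>S\<close> (\<open>block_entropy_factorization\<close>). Applied to \<open>X\<close> and to its
  complement together, the same bound yields \<open>Var (\<Sum>x\<in>X. u\<^sub>x) \<le> 1/2 \<Sum>u\<^sub>x\<^sup>2\<close>
  (\<open>block_variance_bound\<close>), hence \<open>c\<^sub>0 = 2 \<lambda>(J)\<close> as the initial value of the Riccati
  equation.

  Local comparison. On the supersets of \<open>S\<close> only one minority spin moves, among the free
  sites of one block, and these are at least half of the block. One exchange changes the
  weight at most by the factor \<open>exp (4 Jbar)\<close>, with \<open>Jbar\<close> the largest absolute row sum.
  Hence the local entropy, which is at most the covariance of \<open>F\<close> and \<open>ln F\<close>, is bounded by
  a sum over exchanges that the Dirichlet form contains (\<open>star_entropy_le_exchange_form\<close>).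
\<close>

section \<open>Weighted means, variances and entropies\<close>

definition wmean :: "'x set \<Rightarrow> ('x \<Rightarrow> real) \<Rightarrow> ('x \<Rightarrow> real) \<Rightarrow> real" where
  "wmean X w f = (\<Sum>x\<in>X. w x * f x) / (\<Sum>x\<in>X. w x)"

definition wvar :: "'x set \<Rightarrow> ('x \<Rightarrow> real) \<Rightarrow> ('x \<Rightarrow> real) \<Rightarrow> real" where
  "wvar X w f = wmean X w (\<lambda>x. (f x - wmean X w f)\<^sup>2)"

text \<open>
  The total mass of \<open>w\<close> times the entropy of \<open>F\<close> under the probability measure proportional
  to \<open>w\<close>. Without normalization it is homogeneous in \<open>w\<close>, and restrictions to subsets and
  mixtures of weights need no conditional probabilities.
\<close>

definition went :: "'x set \<Rightarrow> ('x \<Rightarrow> real) \<Rightarrow> ('x \<Rightarrow> real) \<Rightarrow> real" where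
  "went X w F = (\<Sum>x\<in>X. w x * (F x * ln (F x)))
     - (\<Sum>x\<in>X. w x * F x) * ln ((\<Sum>x\<in>X. w x * F x) / (\<Sum>x\<in>X. w x))"

lemma mult_ln_div_ge:
  fixes x y :: real
  assumes "0 \<le> x" "0 < y"
  shows "x - y \<le> x * ln (x / y)"
proof (cases "x = 0")
  case False
  then have x: "x > 0" using assms by simp
  have "ln (y / x) \<le> y / x - 1" using x assms by (intro ln_le_minus_one) simp
  then have "x * ln (y / x) \<le> x * (y / x - 1)" using x by (intro mult_left_mono) auto
  also have "\<dots> = y - x" using x by (simp add: field_simps)
  finally show ?thesis using x assms by (simp add: ln_div field_simps)
qed (use assms in simp)

text \<open>
  With \<open>U / V\<close> the quotient of the two sums, add up \<open>x ln (x / y) \<ge> x - y\<close> for \<open>x = u t\<close> and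
  \<open>y = v t U / V\<close>: the linear terms cancel.
\<close>

lemma log_sum_inequality:
  fixes u v :: "'t \<Rightarrow> real"
  assumes "finite T" "\<And>t. t \<in> T \<Longrightarrow> 0 \<le> u t" "\<And>t. t \<in> T \<Longrightarrow> 0 < v t"
  shows "(\<Sum>t\<in>T. u t) * ln ((\<Sum>t\<in>T. u t) / (\<Sum>t\<in>T. v t)) \<le> (\<Sum>t\<in>T. u t * ln (u t / v t))"
proof (cases "(\<Sum>t\<in>T. u t) = 0")
  case True
  then have "\<forall>t\<in>T. u t = 0" using assms by (simp add: sum_nonneg_eq_0_iff)
  then show ?thesis by simp
next
  case False
  define U V where "U = (\<Sum>t\<in>T. u t)" and "V = (\<Sum>t\<in>T. v t)"
  have U: "U > 0" using False assms unfolding U_def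
    by (metis order_less_le sum_nonneg)
  have "T \<noteq> {}" using False by auto
  then have V: "V > 0" using assms unfolding V_def by (intro sum_pos) auto
  have "u t - v t * (U / V) + u t * ln (U / V) \<le> u t * ln (u t / v t)" if "t \<in> T" for t
  proof (cases "u t = 0")
    case False
    then have ut: "u t > 0" using assms(2)[OF that] by simp
    have "u t - v t * (U / V) \<le> u t * ln (u t / (v t * (U / V)))"
      using assms that U V by (intro mult_ln_div_ge) auto
    also have "ln (u t / (v t * (U / V))) = ln (u t / v t) - ln (U / V)"
      using ut assms(3)[OF that] U V by (simp add: ln_div ln_mult)
    finally show ?thesis by (simp add: algebra_simps)
  qed (use assms(3)[OF that] U V in simp)
  then have "(\<Sum>t\<in>T. u t - v t * (U / V) + u t * ln (U / V)) \<le> (\<Sum>t\<in>T. u t * ln (u t / v t))"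
    by (rule sum_mono)
  also have "(\<Sum>t\<in>T. u t - v t * (U / V) + u t * ln (U / V)) = U - V * (U / V) + U * ln (U / V)"
    unfolding sum.distrib sum_subtractf by (simp only: sum_distrib_right[symmetric] U_def V_def)
  also have "\<dots> = U * ln (U / V)" using V by simp
  finally show ?thesis by (simp add: U_def V_def)
qed

text \<open>
  The terms \<open>F ln F\<close> are linear in the weight and cancel, and the rest is the log-sum
  inequality. This puts local entropies together after a step of the random walk.
\<close>

lemma went_superadditive:
  fixes w :: "'t \<Rightarrow> 'x \<Rightarrow> real"
  assumes "finite T" "finite X" "\<And>t x. t \<in> T \<Longrightarrow> x \<in> X \<Longrightarrow> 0 < w t x" "\<And>x. x \<in> X \<Longrightarrow> 0 \<le> F x"
  shows "(\<Sum>t\<in>T. went X (w t) F) \<le> went X (\<lambda>x. \<Sum>t\<in>T. w t x) F"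
proof (cases "X = {}")
  case False
  have A: "(\<Sum>x\<in>X. (\<Sum>t\<in>T. w t x) * H x) = (\<Sum>t\<in>T. \<Sum>x\<in>X. w t x * H x)" for H :: "'x \<Rightarrow> real"
    by (simp add: sum_distrib_right sum.swap[of _ T X])
  have B: "(\<Sum>x\<in>X. (\<Sum>t\<in>T. w t x)) = (\<Sum>t\<in>T. \<Sum>x\<in>X. w t x)"
    by (rule sum.swap)
  have "(\<Sum>t\<in>T. \<Sum>x\<in>X. w t x * F x) * ln ((\<Sum>t\<in>T. \<Sum>x\<in>X. w t x * F x) / (\<Sum>t\<in>T. \<Sum>x\<in>X. w t x))
     \<le> (\<Sum>t\<in>T. (\<Sum>x\<in>X. w t x * F x) * ln ((\<Sum>x\<in>X. w t x * F x) / (\<Sum>x\<in>X. w t x)))"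
    using assms False
    by (intro log_sum_inequality) (auto intro!: sum_nonneg sum_pos mult_nonneg_nonneg simp: less_imp_le)
  then show ?thesis
    unfolding went_def A B by (simp add: sum_subtractf)
qed (simp add: went_def)

lemma went_scale:
  assumes "c > 0"
  shows "went X (\<lambda>x. c * w x) F = c * went X w F"
proof -
  have A: "(\<Sum>x\<in>X. c * w x * H x) = c * (\<Sum>x\<in>X. w x * H x)" for H :: "'a \<Rightarrow> real"
    by (simp add: sum_distrib_left mult.assoc)
  have B: "(\<Sum>x\<in>X. c * w x) = c * (\<Sum>x\<in>X. w x)"
    by (simp add: sum_distrib_left)
  show ?thesis unfolding went_def A B using assms by (simp add: algebra_simps)
qed

lemma went_cong:
  assumes "\<And>x. x \<in> X \<Longrightarrow> w x = w' x" "\<And>x. x \<in> X \<Longrightarrow> F x = F' x"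
  shows "went X w F = went X w' F'"
  unfolding went_def by (simp add: assms cong: sum.cong)

lemma went_nonneg:
  assumes "finite X" "\<And>x. x \<in> X \<Longrightarrow> 0 < w x" "\<And>x. x \<in> X \<Longrightarrow> 0 \<le> F x"
  shows "0 \<le> went X w F"
proof -
  have "(\<Sum>x\<in>X. w x * F x) * ln ((\<Sum>x\<in>X. w x * F x) / (\<Sum>x\<in>X. w x))
      \<le> (\<Sum>x\<in>X. w x * F x * ln (w x * F x / w x))"
    using assms by (intro log_sum_inequality) (auto simp: less_imp_le)
  also have "\<dots> = (\<Sum>x\<in>X. w x * (F x * ln (F x)))"
    using assms(2) by (intro sum.cong) (auto simp: less_le)
  finally show ?thesis by (simp add: went_def)
qed

text \<open>
  The variational characterization of entropy by exponential moments, with \<open>ln G\<close> as test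
  function. Zeros of \<open>G\<close> outside the support of \<open>F\<close> are harmless: the log-sum inequality is
  only used on the support.
\<close>

lemma gibbs_variational:
  assumes X: "finite X" and w: "\<And>x. x \<in> X \<Longrightarrow> 0 < w x" and F: "\<And>x. x \<in> X \<Longrightarrow> 0 \<le> F x"
    and G: "\<And>x. x \<in> X \<Longrightarrow> 0 \<le> G x" and FG: "\<And>x. x \<in> X \<Longrightarrow> 0 < F x \<Longrightarrow> 0 < G x"
  shows "(\<Sum>x\<in>X. w x * F x * ln (G x))
      \<le> went X w F + (\<Sum>x\<in>X. w x * F x) * ln ((\<Sum>x\<in>X. w x * G x) / (\<Sum>x\<in>X. w x))"
proof -
  define Y where "Y = {x\<in>X. 0 < F x}"
  define U where "U = (\<Sum>x\<in>X. w x * F x)"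
  have Yfin: "finite Y" and YX: "Y \<subseteq> X" using X by (auto simp: Y_def)
  have F0: "F x = 0" if "x \<in> X - Y" for x using that F[of x] by (force simp: Y_def)
  have red: "(\<Sum>x\<in>X. w x * (F x * H x)) = (\<Sum>x\<in>Y. w x * (F x * H x))" for H :: "'a \<Rightarrow> real"
    using YX X F0 by (intro sum.mono_neutral_right) auto
  show ?thesis
  proof (cases "Y = {}")
    case True
    then have "U = 0" using F0 by (simp add: U_def)
    then show ?thesis
      using True F0 by (simp add: went_def U_def)
  next
    case False
    have GY: "0 < w x * G x" if "x \<in> Y" for x
      using that FG[of x] w[of x] by (auto simp: Y_def)
    have UY: "U = (\<Sum>x\<in>Y. w x * F x)" using red[of "\<lambda>_. 1"] by (simp add: U_def)
    have U: "0 < U" unfolding UY using False Yfin w by (intro sum_pos) (auto simp: Y_def)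
    have GYs: "0 < (\<Sum>x\<in>Y. w x * G x)" using GY False Yfin by (intro sum_pos) auto
    have wX: "0 < (\<Sum>x\<in>X. w x)" using False YX X w by (intro sum_pos) auto
    have le: "(\<Sum>x\<in>Y. w x * G x) \<le> (\<Sum>x\<in>X. w x * G x)"
      using X YX w G by (intro sum_mono2) (auto simp: less_imp_le)
    have "U * ln (U / (\<Sum>x\<in>Y. w x * G x)) \<le> (\<Sum>x\<in>Y. w x * F x * ln (w x * F x / (w x * G x)))"
      unfolding UY using Yfin GY w F YX by (intro log_sum_inequality) (auto simp: Y_def less_imp_le)
    also have "\<dots> = (\<Sum>x\<in>Y. w x * (F x * ln (F x)) - w x * (F x * ln (G x)))"
    proof (intro sum.cong refl)
      fix x assume x: "x \<in> Y"
      then have "w x > 0" "F x > 0" "G x > 0" using w FG by (auto simp: Y_def)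
      then show "w x * F x * ln (w x * F x / (w x * G x)) = w x * (F x * ln (F x)) - w x * (F x * ln (G x))"
        by (simp add: ln_div algebra_simps)
    qed
    also have "\<dots> = (\<Sum>x\<in>X. w x * (F x * ln (F x))) - (\<Sum>x\<in>X. w x * (F x * ln (G x)))"
      by (simp add: red sum_subtractf)
    finally have 1: "(\<Sum>x\<in>X. w x * (F x * ln (G x))) \<le>
        (\<Sum>x\<in>X. w x * (F x * ln (F x))) - U * ln (U / (\<Sum>x\<in>Y. w x * G x))" by simp
    have "ln (\<Sum>x\<in>Y. w x * G x) \<le> ln (\<Sum>x\<in>X. w x * G x)"
      using le GYs by simp
    then have 2: "U * ln (\<Sum>x\<in>Y. w x * G x) \<le> U * ln (\<Sum>x\<in>X. w x * G x)"
      using U by simp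
    have "went X w F + U * ln ((\<Sum>x\<in>X. w x * G x) / (\<Sum>x\<in>X. w x))
       = (\<Sum>x\<in>X. w x * (F x * ln (F x))) - U * ln U + U * ln (\<Sum>x\<in>X. w x * G x)"
      unfolding went_def U_def[symmetric] using U wX GYs le by (simp add: ln_div algebra_simps)
    moreover have "U * ln (U / (\<Sum>x\<in>Y. w x * G x)) = U * ln U - U * ln (\<Sum>x\<in>Y. w x * G x)"
      using U GYs by (simp add: ln_div algebra_simps)
    ultimately show ?thesis using 1 2 unfolding U_def[symmetric] mult.assoc by linarith
  qed
qed

section \<open>Generating polynomials of sets with prescribed block counts\<close>

definition block_sets :: "('v \<Rightarrow> 'b) \<Rightarrow> 'v set \<Rightarrow> ('b \<Rightarrow> nat) \<Rightarrow> 'v set set" where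
  "block_sets \<beta> V \<kappa> = {X. X \<subseteq> V \<and> (\<forall>b. card {x\<in>X. \<beta> x = b} = \<kappa> b)}"

text \<open>
  If \<open>\<kappa>\<close> vanishes outside \<open>\<beta> ` V\<close>, this is the product over the blocks (the fibres of \<open>\<beta>\<close>)
  of the elementary symmetric polynomials of degree \<open>\<kappa> b\<close> in the weights of block \<open>b\<close>.
\<close>

definition block_poly :: "('v \<Rightarrow> 'b) \<Rightarrow> 'v set \<Rightarrow> ('b \<Rightarrow> nat) \<Rightarrow> ('v \<Rightarrow> real) \<Rightarrow> real" where
  "block_poly \<beta> V \<kappa> w = (\<Sum>X\<in>block_sets \<beta> V \<kappa>. \<Prod>x\<in>X. w x)"

definition block_poly_deriv ::
    "('v \<Rightarrow> 'b) \<Rightarrow> 'v set \<Rightarrow> ('b \<Rightarrow> nat) \<Rightarrow> ('v \<Rightarrow> real) \<Rightarrow> ('v \<Rightarrow> real) \<Rightarrow> real" where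
  "block_poly_deriv \<beta> V \<kappa> w v = (\<Sum>X\<in>block_sets \<beta> V \<kappa>. \<Sum>x\<in>X. v x * (\<Prod>y\<in>X - {x}. w y))"

definition lower :: "('b \<Rightarrow> nat) \<Rightarrow> 'b \<Rightarrow> 'b \<Rightarrow> nat" where
  "lower \<kappa> b = \<kappa>(b := \<kappa> b - 1)"

lemma finite_block_sets: "finite V \<Longrightarrow> finite (block_sets \<beta> V \<kappa>)"
  by (rule finite_subset[of _ "Pow V"]) (auto simp: block_sets_def)

lemma block_setsD: "X \<in> block_sets \<beta> V \<kappa> \<Longrightarrow> X \<subseteq> V"
  by (auto simp: block_sets_def)

lemma block_sets_finite_elem: "finite V \<Longrightarrow> X \<in> block_sets \<beta> V \<kappa> \<Longrightarrow> finite X"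
  by (rule finite_subset[OF block_setsD])

lemma card_block_insert:
  assumes "finite Y" "x \<notin> Y"
  shows "card {y\<in>insert x Y. \<beta> y = b} = (if \<beta> x = b then Suc (card {y\<in>Y. \<beta> y = b}) else card {y\<in>Y. \<beta> y = b})"
proof -
  have "{y\<in>insert x Y. \<beta> y = b} = (if \<beta> x = b then insert x {y\<in>Y. \<beta> y = b} else {y\<in>Y. \<beta> y = b})"
    by auto
  then show ?thesis using assms by simp
qed

lemma insert_block_sets_iff:
  assumes "finite V" "x \<in> V" "x \<notin> Y"
  shows "insert x Y \<in> block_sets \<beta> V \<kappa> \<longleftrightarrow> \<kappa> (\<beta> x) > 0 \<and> Y \<in> block_sets \<beta> (V - {x}) (lower \<kappa> (\<beta> x))"
proof (cases "Y \<subseteq> V")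
  case True
  then have fY: "finite Y" using assms finite_subset by blast
  have *: "card {y\<in>insert x Y. \<beta> y = b} = (if \<beta> x = b then Suc (card {y\<in>Y. \<beta> y = b}) else card {y\<in>Y. \<beta> y = b})" for b
    by (rule card_block_insert[OF fY assms(3)])
  have "(\<forall>b. card {y\<in>insert x Y. \<beta> y = b} = \<kappa> b) \<longleftrightarrow>
      \<kappa> (\<beta> x) > 0 \<and> (\<forall>b. card {y\<in>Y. \<beta> y = b} = lower \<kappa> (\<beta> x) b)"
    unfolding * lower_def
    by (auto simp: fun_upd_def)
  then show ?thesis using True assms by (auto simp: block_sets_def)
qed (auto simp: block_sets_def)

lemma block_sets_containing:
  assumes "finite V" "x \<in> V"
  shows "{X \<in> block_sets \<beta> V \<kappa>. x \<in> X} =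
    (if \<kappa> (\<beta> x) > 0 then insert x ` block_sets \<beta> (V - {x}) (lower \<kappa> (\<beta> x)) else {})"
proof (intro set_eqI iffI)
  fix X assume "X \<in> {X \<in> block_sets \<beta> V \<kappa>. x \<in> X}"
  then have X: "X \<in> block_sets \<beta> V \<kappa>" "x \<in> X" by auto
  then have "X = insert x (X - {x})" by auto
  moreover have "x \<notin> X - {x}" by simp
  ultimately have "\<kappa> (\<beta> x) > 0 \<and> X - {x} \<in> block_sets \<beta> (V - {x}) (lower \<kappa> (\<beta> x))"
    using X insert_block_sets_iff[OF assms, of "X - {x}"] by metis
  then show "X \<in> (if \<kappa> (\<beta> x) > 0 then insert x ` block_sets \<beta> (V - {x}) (lower \<kappa> (\<beta> x)) else {})"
    using X(2) by (auto intro!: image_eqI[of _ _ "X - {x}"])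
next
  fix X assume "X \<in> (if \<kappa> (\<beta> x) > 0 then insert x ` block_sets \<beta> (V - {x}) (lower \<kappa> (\<beta> x)) else {})"
  then obtain Y where "\<kappa> (\<beta> x) > 0" "Y \<in> block_sets \<beta> (V - {x}) (lower \<kappa> (\<beta> x))" "X = insert x Y"
    by (auto split: if_splits)
  moreover have "x \<notin> Y" using block_setsD[OF calculation(2)] by auto
  ultimately show "X \<in> {X \<in> block_sets \<beta> V \<kappa>. x \<in> X}"
    using insert_block_sets_iff[OF assms, of Y] by auto
qed

lemma sum_block_sets_containing:
  assumes "finite V" "x \<in> V"
  shows "(\<Sum>X\<in>{X \<in> block_sets \<beta> V \<kappa>. x \<in> X}. f X) =
    (if \<kappa> (\<beta> x) > 0 then \<Sum>Y\<in>block_sets \<beta> (V - {x}) (lower \<kappa> (\<beta> x)). f (insert x Y) else 0)"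
proof -
  have "inj_on (insert x) (block_sets \<beta> (V - {x}) (lower \<kappa> (\<beta> x)))"
  proof (rule inj_onI)
    fix Y Y' assume a: "Y \<in> block_sets \<beta> (V - {x}) (lower \<kappa> (\<beta> x))"
      "Y' \<in> block_sets \<beta> (V - {x}) (lower \<kappa> (\<beta> x))" "insert x Y = insert x Y'"
    have "x \<notin> Y" "x \<notin> Y'" using block_setsD[OF a(1)] block_setsD[OF a(2)] by auto
    then show "Y = Y'" using a(3) by (simp add: insert_ident)
  qed
  then show ?thesis
    unfolding block_sets_containing[OF assms] by (simp add: sum.reindex)
qed

lemma block_sets_avoiding:
  "{X \<in> block_sets \<beta> V \<kappa>. x \<notin> X} = block_sets \<beta> (V - {x}) \<kappa>"
proof (intro set_eqI)
  fix X
  show "X \<in> {X \<in> block_sets \<beta> V \<kappa>. x \<notin> X} \<longleftrightarrow> X \<in> block_sets \<beta> (V - {x}) \<kappa>"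
    unfolding block_sets_def mem_Collect_eq by blast
qed

lemma prod_insert_block:
  assumes "finite V" "Y \<in> block_sets \<beta> (V - {x}) \<kappa>'"
  shows "(\<Prod>y\<in>insert x Y. w y) = w x * (\<Prod>y\<in>Y. (w y :: real))"
proof -
  have "finite Y" "x \<notin> Y"
    using block_sets_finite_elem[OF _ assms(2)] block_setsD[OF assms(2)] assms(1) by auto
  then show ?thesis by simp
qed

lemma block_poly_containing:
  assumes "finite V" "x \<in> V"
  shows "(\<Sum>X\<in>{X \<in> block_sets \<beta> V \<kappa>. x \<in> X}. \<Prod>y\<in>X. w y) =
    (if \<kappa> (\<beta> x) > 0 then w x * block_poly \<beta> (V - {x}) (lower \<kappa> (\<beta> x)) w else 0)"
  unfolding sum_block_sets_containing[OF assms] block_poly_def sum_distrib_left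
  by (intro if_cong refl sum.cong prod_insert_block[OF assms(1)])

lemma block_poly_split:
  assumes "finite V" "x \<in> V" "\<kappa> (\<beta> x) > 0"
  shows "block_poly \<beta> V \<kappa> w =
     block_poly \<beta> (V - {x}) \<kappa> w + w x * block_poly \<beta> (V - {x}) (lower \<kappa> (\<beta> x)) w"
proof -
  have "block_poly \<beta> V \<kappa> w = (\<Sum>X\<in>{X \<in> block_sets \<beta> V \<kappa>. x \<notin> X}. \<Prod>y\<in>X. w y)
      + (\<Sum>X\<in>{X \<in> block_sets \<beta> V \<kappa>. x \<in> X}. \<Prod>y\<in>X. w y)"
    unfolding block_poly_def using finite_block_sets[OF assms(1), of \<beta> \<kappa>]
    by (subst sum.union_disjoint[symmetric]) (auto intro!: sum.cong)
  then show ?thesis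
    using assms by (simp only: block_sets_avoiding block_poly_containing if_True flip: block_poly_def)
qed

lemma sum_swap_members:
  assumes "finite V" "\<And>X. X \<in> \<B> \<Longrightarrow> X \<subseteq> V" "finite \<B>"
  shows "(\<Sum>X\<in>\<B>. \<Sum>x\<in>X. f x X) = (\<Sum>x\<in>V. \<Sum>X\<in>{X\<in>\<B>. x \<in> X}. (f x X :: real))"
proof -
  have "(\<Sum>X\<in>\<B>. \<Sum>x\<in>X. f x X) = (\<Sum>X\<in>\<B>. \<Sum>x\<in>V. if x \<in> X then f x X else 0)"
    using assms by (intro sum.cong refl sum.mono_neutral_cong_left) auto
  also have "\<dots> = (\<Sum>x\<in>V. \<Sum>X\<in>\<B>. if x \<in> X then f x X else 0)" by (rule sum.swap)
  also have "\<dots> = (\<Sum>x\<in>V. \<Sum>X\<in>{X\<in>\<B>. x \<in> X}. f x X)"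
    by (rule sum.cong[OF refl]) (simp add: sum.inter_filter assms(3))
  finally show ?thesis .
qed

text \<open>
  Euler's identity for a polynomial that is homogeneous of degree \<open>\<kappa> b\<close> in the weights of
  block \<open>b\<close>: the partial derivative in the weight of \<open>x\<close> is the polynomial on \<open>V - {x}\<close> with
  one element fewer.
\<close>

lemma block_poly_euler:
  assumes V: "finite V" and \<kappa>: "\<kappa> b > 0"
  shows "real (\<kappa> b) * block_poly \<beta> V \<kappa> w =
    (\<Sum>x\<in>{x\<in>V. \<beta> x = b}. w x * block_poly \<beta> (V - {x}) (lower \<kappa> b) w)"
proof -
  let ?f = "\<lambda>x X. if \<beta> x = b then \<Prod>y\<in>X. w y else 0"
  have "real (\<kappa> b) * block_poly \<beta> V \<kappa> w = (\<Sum>X\<in>block_sets \<beta> V \<kappa>. \<Sum>x\<in>X. ?f x X)"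
    unfolding block_poly_def sum_distrib_left
  proof (intro sum.cong refl)
    fix X assume X: "X \<in> block_sets \<beta> V \<kappa>"
    then have "finite X" by (rule block_sets_finite_elem[OF V])
    then have "(\<Sum>x\<in>X. ?f x X) = (\<Sum>x\<in>{x\<in>X. \<beta> x = b}. \<Prod>y\<in>X. w y)"
      by (subst sum.inter_filter) auto
    then show "real (\<kappa> b) * (\<Prod>y\<in>X. w y) = (\<Sum>x\<in>X. ?f x X)"
      using X by (simp add: block_sets_def)
  qed
  also have "\<dots> = (\<Sum>x\<in>V. \<Sum>X\<in>{X\<in>block_sets \<beta> V \<kappa>. x \<in> X}. ?f x X)"
    using V block_setsD[of _ \<beta> V \<kappa>] finite_block_sets[OF V, of \<beta> \<kappa>] by (intro sum_swap_members) auto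
  also have "\<dots> = (\<Sum>x\<in>V. if \<beta> x = b then w x * block_poly \<beta> (V - {x}) (lower \<kappa> b) w else 0)"
    using block_poly_containing[OF V, where \<kappa>=\<kappa> and \<beta>=\<beta> and w=w] \<kappa> by (intro sum.cong refl) auto
  finally show ?thesis using V by (simp add: sum.inter_filter)
qed

lemma block_poly_has_derivative:
  assumes "finite V"
  shows "((\<lambda>t. block_poly \<beta> V \<kappa> (\<lambda>x. w x + t * v x)) has_real_derivative block_poly_deriv \<beta> V \<kappa> w v) (at 0)"
proof -
  have "((\<lambda>t. \<Prod>x\<in>X. w x + t * v x) has_real_derivative (\<Sum>x\<in>X. v x * (\<Prod>y\<in>X - {x}. w y))) (at 0)"
    if "X \<in> block_sets \<beta> V \<kappa>" for X
  proof -
    have "((\<lambda>t. \<Prod>x\<in>X. w x + t * v x) has_real_derivative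
        (\<Sum>x\<in>X. v x * (\<Prod>y\<in>X - {x}. w y + 0 * v y))) (at 0)"
      by (rule has_field_derivative_prod) (auto intro!: derivative_eq_intros)
    then show ?thesis by simp
  qed
  then show ?thesis
    unfolding block_poly_def block_poly_deriv_def by (intro DERIV_sum) auto
qed

text \<open>
  This and the next identity arise by differentiating \<open>block_poly_split\<close> and
  \<open>block_poly_euler\<close> in the direction \<open>v\<close>.
\<close>

lemma block_poly_deriv_split:
  assumes "finite V" "x \<in> V" "\<kappa> (\<beta> x) > 0"
  shows "block_poly_deriv \<beta> V \<kappa> w v = block_poly_deriv \<beta> (V - {x}) \<kappa> w v
     + (v x * block_poly \<beta> (V - {x}) (lower \<kappa> (\<beta> x)) w
        + w x * block_poly_deriv \<beta> (V - {x}) (lower \<kappa> (\<beta> x)) w v)"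
proof -
  have "((\<lambda>t. block_poly \<beta> V \<kappa> (\<lambda>x. w x + t * v x)) has_real_derivative
     block_poly_deriv \<beta> (V - {x}) \<kappa> w v
     + (v x * block_poly \<beta> (V - {x}) (lower \<kappa> (\<beta> x)) (\<lambda>x. w x + 0 * v x)
        + block_poly_deriv \<beta> (V - {x}) (lower \<kappa> (\<beta> x)) w v * (w x + 0 * v x))) (at 0)"
    unfolding block_poly_split[of V x \<kappa> \<beta>, OF assms]
    by (intro DERIV_add DERIV_mult block_poly_has_derivative) (auto intro!: derivative_eq_intros simp: assms)
  from DERIV_unique[OF this block_poly_has_derivative[OF assms(1)]] show ?thesis
    by (simp add: mult.commute)
qed

lemma block_poly_deriv_euler:
  assumes "finite V" "\<kappa> b > 0"
  shows "real (\<kappa> b) * block_poly_deriv \<beta> V \<kappa> w v =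
    (\<Sum>x\<in>{x\<in>V. \<beta> x = b}. v x * block_poly \<beta> (V - {x}) (lower \<kappa> b) w
        + w x * block_poly_deriv \<beta> (V - {x}) (lower \<kappa> b) w v)"
proof -
  have "((\<lambda>t. real (\<kappa> b) * block_poly \<beta> V \<kappa> (\<lambda>x. w x + t * v x)) has_real_derivative
    (\<Sum>x\<in>{x\<in>V. \<beta> x = b}. v x * block_poly \<beta> (V - {x}) (lower \<kappa> b) (\<lambda>x. w x + 0 * v x)
        + block_poly_deriv \<beta> (V - {x}) (lower \<kappa> b) w v * (w x + 0 * v x))) (at 0)"
    unfolding block_poly_euler[of V \<kappa> b \<beta>, OF assms]
    by (intro DERIV_sum DERIV_mult block_poly_has_derivative) (auto intro!: derivative_eq_intros simp: assms)
  moreover have "((\<lambda>t. real (\<kappa> b) * block_poly \<beta> V \<kappa> (\<lambda>x. w x + t * v x)) has_real_derivative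
     real (\<kappa> b) * block_poly_deriv \<beta> V \<kappa> w v) (at 0)"
    by (intro DERIV_cmult block_poly_has_derivative assms)
  ultimately show ?thesis by (auto dest: DERIV_unique simp: mult.commute)
qed

lemma block_poly_pos_iff:
  assumes "finite V" "\<And>x. x \<in> V \<Longrightarrow> 0 \<le> v x"
  shows "0 < block_poly \<beta> V \<kappa> v \<longleftrightarrow> (\<exists>X\<in>block_sets \<beta> V \<kappa>. \<forall>x\<in>X. 0 < v x)"
proof
  assume "0 < block_poly \<beta> V \<kappa> v"
  then obtain X where X: "X \<in> block_sets \<beta> V \<kappa>" "0 < (\<Prod>x\<in>X. v x)"
    unfolding block_poly_def by (metis linorder_not_le sum_nonpos)
  have "0 < v x" if "x \<in> X" for x
  proof (rule ccontr)
    assume "\<not> 0 < v x"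
    then have "v x = 0" using assms(2)[of x] that block_setsD[OF X(1)] by force
    then have "(\<Prod>x\<in>X. v x) = 0" using that block_sets_finite_elem[OF assms(1) X(1)] by (intro prod_zero) auto
    then show False using X(2) by simp
  qed
  then show "\<exists>X\<in>block_sets \<beta> V \<kappa>. \<forall>x\<in>X. 0 < v x" using X by blast
next
  assume "\<exists>X\<in>block_sets \<beta> V \<kappa>. \<forall>x\<in>X. 0 < v x"
  then obtain X where X: "X \<in> block_sets \<beta> V \<kappa>" "\<forall>x\<in>X. 0 < v x" by blast
  have "0 < (\<Prod>x\<in>X. v x)" using X by (intro prod_pos) auto
  also have "\<dots> \<le> block_poly \<beta> V \<kappa> v" unfolding block_poly_def
    using X(1) assms(2) block_setsD[of _ \<beta> V \<kappa>] finite_block_sets[OF assms(1), of \<beta> \<kappa>]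
    by (intro member_le_sum) (auto intro!: prod_nonneg)
  finally show "0 < block_poly \<beta> V \<kappa> v" .
qed

lemma block_sets_remove:
  assumes "finite V" "X \<in> block_sets \<beta> V \<kappa>" "x \<in> X"
  shows "X - {x} \<in> block_sets \<beta> (V - {x}) (lower \<kappa> (\<beta> x))" "\<kappa> (\<beta> x) > 0"
proof -
  have "insert x (X - {x}) \<in> block_sets \<beta> V \<kappa>" using assms by (simp add: insert_absorb)
  moreover have "x \<in> V" using block_setsD[OF assms(2)] assms(3) by auto
  ultimately show "X - {x} \<in> block_sets \<beta> (V - {x}) (lower \<kappa> (\<beta> x))" "\<kappa> (\<beta> x) > 0"
    using insert_block_sets_iff[OF assms(1), of x "X - {x}"] by auto
qed

lemma block_sets_mono: "V \<subseteq> V' \<Longrightarrow> block_sets \<beta> V \<kappa> \<subseteq> block_sets \<beta> V' \<kappa>"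
  by (auto simp: block_sets_def)

lemma block_poly_lower_pos:
  assumes V: "finite V" and v: "\<And>x. x \<in> V \<Longrightarrow> 0 \<le> v x" and b: "\<kappa> b > 0" and pos: "0 < block_poly \<beta> V \<kappa> v"
  shows "0 < block_poly \<beta> V (lower \<kappa> b) v"
    and "\<And>x. x \<in> V \<Longrightarrow> \<beta> x = b \<Longrightarrow> 0 < block_poly \<beta> (V - {x}) (lower \<kappa> b) v"
proof -
  obtain X where X: "X \<in> block_sets \<beta> V \<kappa>" "\<forall>x\<in>X. 0 < v x"
    using pos block_poly_pos_iff[of V v \<beta> \<kappa>, OF V v] by auto
  have "card {x\<in>X. \<beta> x = b} > 0" using X b by (simp add: block_sets_def)
  then obtain y where y: "y \<in> X" "\<beta> y = b" by (auto simp: card_gt_0_iff)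
  have *: "X - {y} \<in> block_sets \<beta> (V - {y}) (lower \<kappa> b)" using block_sets_remove[OF V X(1) y(1)] y by simp
  then have "X - {y} \<in> block_sets \<beta> V (lower \<kappa> b)" using block_sets_mono[of "V - {y}" V] by auto
  then show "0 < block_poly \<beta> V (lower \<kappa> b) v"
    using block_poly_pos_iff[of V v \<beta> "lower \<kappa> b", OF V v] X by blast
  fix x assume x: "x \<in> V" "\<beta> x = b"
  have "\<exists>Y\<in>block_sets \<beta> (V - {x}) (lower \<kappa> b). \<forall>z\<in>Y. 0 < v z"
  proof (cases "x \<in> X")
    case True
    then show ?thesis using block_sets_remove[OF V X(1) True] x X by (intro bexI[of _ "X - {x}"]) auto
  next
    case False
    then have "X - {y} \<in> block_sets \<beta> (V - {x}) (lower \<kappa> b)"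
      using * X y by (auto simp: block_sets_def)
    then show ?thesis using X by blast
  qed
  then show "0 < block_poly \<beta> (V - {x}) (lower \<kappa> b) v"
    using block_poly_pos_iff[of "V - {x}" v \<beta> "lower \<kappa> b"] V v by auto
qed

text \<open>
  The function \<open>a b / (a + b)\<close> is concave and homogeneous of degree one, so it lies below
  its derivative at \<open>(p, q)\<close> applied to \<open>(a, b)\<close>.
\<close>

lemma harmonic_tangent:
  fixes a b p q :: real
  assumes "0 \<le> a" "0 < b" "0 < p" "0 < q"
  shows "a * b / (a + b) \<le> (q / (p + q))\<^sup>2 * a + (p / (p + q))\<^sup>2 * b"
proof -
  have "0 \<le> (q * a - p * b)\<^sup>2" by simp
  then have "a * b * (p + q)\<^sup>2 \<le> (q\<^sup>2 * a + p\<^sup>2 * b) * (a + b)"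
    by (simp add: power2_eq_square algebra_simps)
  then have "a * b / (a + b) \<le> (q\<^sup>2 * a + p\<^sup>2 * b) / (p + q)\<^sup>2"
    using assms by (simp add: field_simps)
  then show ?thesis by (simp add: power_divide add_divide_distrib)
qed

text \<open>
  The theorem of Marcus and Lopes: \<open>block_poly \<beta> V \<kappa> / block_poly \<beta> V (lower \<kappa> b)\<close> is a
  concave function of positive weights. As the quotient is homogeneous of degree one,
  concavity says that its value at \<open>v\<close> is at most its derivative at \<open>w\<close> in the direction
  \<open>v\<close>.

  Induction on \<open>\<kappa> b\<close>. By \<open>block_poly_euler\<close> and \<open>block_poly_split\<close>, \<open>\<kappa> b\<close> times the quotient
  is the sum over \<open>x\<close> in the block of \<open>a c / (a + c)\<close>, where \<open>a\<close> is the weight of \<open>x\<close> and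
  \<open>c\<close> is the quotient of degree one less on \<open>V - {x}\<close>. The function \<open>a c / (a + c)\<close> is
  monotone and concave, so concavity of \<open>c\<close> is inherited.
\<close>

lemma block_poly_quotient_tangent:
  assumes "finite V" "\<And>x. x \<in> V \<Longrightarrow> 0 < w x" "\<And>x. x \<in> V \<Longrightarrow> 0 \<le> v x"
    and "0 < block_poly \<beta> V \<kappa> v" "\<kappa> b = Suc r"
  shows "block_poly \<beta> V \<kappa> v / block_poly \<beta> V (lower \<kappa> b) v \<le>
    (block_poly_deriv \<beta> V \<kappa> w v * block_poly \<beta> V (lower \<kappa> b) w
       - block_poly \<beta> V \<kappa> w * block_poly_deriv \<beta> V (lower \<kappa> b) w v) / (block_poly \<beta> V (lower \<kappa> b) w)\<^sup>2"
  using assms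
proof (induction r arbitrary: V \<kappa>)
  case 0
  let ?\<kappa>' = "lower \<kappa> b" and ?S = "{x\<in>V. \<beta> x = b}"
  have eq: "block_sets \<beta> (V - {x}) ?\<kappa>' = block_sets \<beta> V ?\<kappa>'" if "x \<in> ?S" for x
  proof -
    have "x \<notin> X" if "X \<in> block_sets \<beta> V ?\<kappa>'" for X
    proof
      assume "x \<in> X"
      then have "card {y \<in> X. \<beta> y = b} > 0"
        using \<open>x \<in> ?S\<close> block_sets_finite_elem[OF "0.prems"(1) that] by (auto simp: card_gt_0_iff)
      then show False using that 0 by (simp add: block_sets_def lower_def)
    qed
    then show ?thesis by (auto simp: block_sets_def)
  qed
  have P: "block_poly \<beta> (V - {x}) ?\<kappa>' u = block_poly \<beta> V ?\<kappa>' u"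
    "block_poly_deriv \<beta> (V - {x}) ?\<kappa>' u u' = block_poly_deriv \<beta> V ?\<kappa>' u u'" if "x \<in> ?S" for x u u'
    using eq[OF that] by (simp_all add: block_poly_def block_poly_deriv_def)
  have E: "block_poly \<beta> V \<kappa> u = (\<Sum>x\<in>?S. u x) * block_poly \<beta> V ?\<kappa>' u" for u
    using block_poly_euler[of V \<kappa> b \<beta> u] 0 P by (simp add: sum_distrib_right)
  have D: "block_poly_deriv \<beta> V \<kappa> w v = (\<Sum>x\<in>?S. v x) * block_poly \<beta> V ?\<kappa>' w
      + (\<Sum>x\<in>?S. w x) * block_poly_deriv \<beta> V ?\<kappa>' w v"
    using block_poly_deriv_euler[of V \<kappa> b \<beta> w v] 0 P by (simp add: sum_distrib_right sum.distrib)
  have pv: "0 < block_poly \<beta> V ?\<kappa>' v" using 0 by (intro block_poly_lower_pos) auto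
  have "0 < block_poly \<beta> V \<kappa> w"
    using 0 block_poly_pos_iff[of V v \<beta> \<kappa>] block_poly_pos_iff[of V w \<beta> \<kappa>]
    by (metis block_setsD less_imp_le subsetD)
  then have pw: "0 < block_poly \<beta> V ?\<kappa>' w" using 0 by (intro block_poly_lower_pos) (auto simp: less_imp_le)
  show ?case unfolding E D using pv pw by (simp add: power2_eq_square field_simps)
next
  case (Suc r)
  let ?\<kappa>' = "lower \<kappa> b" and ?\<kappa>'' = "lower (lower \<kappa> b) b" and ?S = "{x\<in>V. \<beta> x = b}"
  note V = Suc.prems(1) and w = Suc.prems(2) and v = Suc.prems(3)
  have \<kappa>b: "\<kappa> b = Suc (Suc r)" by fact
  have \<kappa>': "?\<kappa>' b = Suc r" by (simp add: lower_def \<kappa>b)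
  have w': "0 \<le> w x" if "x \<in> V" for x using w[OF that] by simp
  have Pw: "0 < block_poly \<beta> V \<kappa> w"
    using block_poly_pos_iff[of V v \<beta> \<kappa>] block_poly_pos_iff[of V w \<beta> \<kappa>] Suc.prems
    by (metis block_setsD less_imp_le subsetD)
  have Ew: "0 < block_poly \<beta> V ?\<kappa>' w" and Ev: "0 < block_poly \<beta> V ?\<kappa>' v"
    using Pw Suc.prems \<kappa>b w' by (auto intro!: block_poly_lower_pos)
  have main: "v x * block_poly \<beta> (V - {x}) ?\<kappa>' v / block_poly \<beta> V ?\<kappa>' v \<le>
     ((v x * block_poly \<beta> (V - {x}) ?\<kappa>' w + w x * block_poly_deriv \<beta> (V - {x}) ?\<kappa>' w v) * block_poly \<beta> V ?\<kappa>' w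
      - w x * block_poly \<beta> (V - {x}) ?\<kappa>' w * block_poly_deriv \<beta> V ?\<kappa>' w v) / (block_poly \<beta> V ?\<kappa>' w)\<^sup>2"
    if "x \<in> ?S" for x
  proof -
    have x: "x \<in> V" "\<beta> x = b" using that by auto
    define A B A' B' Av Bv where "A = block_poly \<beta> (V - {x}) ?\<kappa>' w"
      and "B = block_poly \<beta> (V - {x}) ?\<kappa>'' w"
      and "A' = block_poly_deriv \<beta> (V - {x}) ?\<kappa>' w v"
      and "B' = block_poly_deriv \<beta> (V - {x}) ?\<kappa>'' w v"
      and "Av = block_poly \<beta> (V - {x}) ?\<kappa>' v"
      and "Bv = block_poly \<beta> (V - {x}) ?\<kappa>'' v"
    have A: "0 < A" unfolding A_def by (rule block_poly_lower_pos(2)) (use Pw V w' \<kappa>b x in auto)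
    have Av: "0 < Av" unfolding Av_def
      by (rule block_poly_lower_pos(2)) (use Suc.prems \<kappa>b x in auto)
    have B: "0 < B" unfolding B_def
      by (rule block_poly_lower_pos(1)) (use A w' V \<kappa>' in \<open>auto simp: A_def\<close>)
    have Bv: "0 < Bv" unfolding Bv_def
      by (rule block_poly_lower_pos(1)) (use Av Suc.prems \<kappa>' in \<open>auto simp: Av_def\<close>)
    have E: "block_poly \<beta> V ?\<kappa>' u = block_poly \<beta> (V - {x}) ?\<kappa>' u + u x * block_poly \<beta> (V - {x}) ?\<kappa>'' u" for u
      using block_poly_split[of V x ?\<kappa>' \<beta> u] V x \<kappa>' by simp
    have E': "block_poly_deriv \<beta> V ?\<kappa>' w v = A' + (v x * B + w x * B')"
      using block_poly_deriv_split[of V x ?\<kappa>' \<beta> w v] V x \<kappa>' by (simp add: A'_def B'_def B_def)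
    have IH: "Av / Bv \<le> (A' * B - A * B') / B\<^sup>2"
      unfolding Av_def Bv_def A'_def A_def B_def B'_def
      by (rule Suc.IH) (use V w v \<kappa>' Av in \<open>auto simp: Av_def\<close>)
    have wx: "0 < w x" and vx: "0 \<le> v x" using w v x by auto
    have "v x * Av / (Av + v x * Bv) = v x * (Av / Bv) / (v x + Av / Bv)"
      using Av Bv vx by (simp add: field_simps)
    also have "\<dots> \<le> (A / B / (w x + A / B))\<^sup>2 * v x + (w x / (w x + A / B))\<^sup>2 * (Av / Bv)"
      using Av Bv vx wx A B by (intro harmonic_tangent) auto
    also have "\<dots> \<le> (A / B / (w x + A / B))\<^sup>2 * v x + (w x / (w x + A / B))\<^sup>2 * ((A' * B - A * B') / B\<^sup>2)"
      using IH by (intro add_left_mono mult_left_mono) auto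
    also have "A / B / (w x + A / B) = A / (A + w x * B)" using B by (simp add: field_simps)
    also have "w x / (w x + A / B) = w x * B / (A + w x * B)" using B by (simp add: field_simps)
    also have "(A / (A + w x * B))\<^sup>2 * v x + (w x * B / (A + w x * B))\<^sup>2 * ((A' * B - A * B') / B\<^sup>2)
       = (A\<^sup>2 * v x + (w x)\<^sup>2 * (A' * B - A * B')) / (A + w x * B)\<^sup>2"
      using B by (simp add: power_divide power_mult_distrib add_divide_distrib)
    also have "A\<^sup>2 * v x + (w x)\<^sup>2 * (A' * B - A * B') =
       (v x * A + w x * A') * (A + w x * B) - w x * A * (A' + (v x * B + w x * B'))"
      by (simp add: power2_eq_square algebra_simps)
    finally show ?thesis
      unfolding E' unfolding E unfolding A_def[symmetric] B_def[symmetric] A'_def[symmetric]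
        Av_def[symmetric] Bv_def[symmetric] .
  qed
  have "real (\<kappa> b) * (block_poly \<beta> V \<kappa> v / block_poly \<beta> V ?\<kappa>' v)
      = (\<Sum>x\<in>?S. v x * block_poly \<beta> (V - {x}) ?\<kappa>' v / block_poly \<beta> V ?\<kappa>' v)"
    using block_poly_euler[of V \<kappa> b \<beta> v] V \<kappa>b by (simp add: sum_divide_distrib)
  also have "\<dots> \<le> (\<Sum>x\<in>?S. ((v x * block_poly \<beta> (V - {x}) ?\<kappa>' w + w x * block_poly_deriv \<beta> (V - {x}) ?\<kappa>' w v) * block_poly \<beta> V ?\<kappa>' w
      - w x * block_poly \<beta> (V - {x}) ?\<kappa>' w * block_poly_deriv \<beta> V ?\<kappa>' w v) / (block_poly \<beta> V ?\<kappa>' w)\<^sup>2)"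
    by (rule sum_mono[OF main])
  also have "\<dots> = ((\<Sum>x\<in>?S. v x * block_poly \<beta> (V - {x}) ?\<kappa>' w + w x * block_poly_deriv \<beta> (V - {x}) ?\<kappa>' w v) * block_poly \<beta> V ?\<kappa>' w
      - (\<Sum>x\<in>?S. w x * block_poly \<beta> (V - {x}) ?\<kappa>' w) * block_poly_deriv \<beta> V ?\<kappa>' w v) / (block_poly \<beta> V ?\<kappa>' w)\<^sup>2"
    by (simp only: sum_divide_distrib[symmetric] sum_subtractf sum_distrib_right[symmetric])
  also have "\<dots> = (real (\<kappa> b) * block_poly_deriv \<beta> V \<kappa> w v * block_poly \<beta> V ?\<kappa>' w
      - real (\<kappa> b) * block_poly \<beta> V \<kappa> w * block_poly_deriv \<beta> V ?\<kappa>' w v) / (block_poly \<beta> V ?\<kappa>' w)\<^sup>2"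
    using block_poly_euler[of V \<kappa> b \<beta> w] block_poly_deriv_euler[of V \<kappa> b \<beta> w v] V \<kappa>b by simp
  also have "\<dots> = real (\<kappa> b) * ((block_poly_deriv \<beta> V \<kappa> w v * block_poly \<beta> V ?\<kappa>' w
      - block_poly \<beta> V \<kappa> w * block_poly_deriv \<beta> V ?\<kappa>' w v) / (block_poly \<beta> V ?\<kappa>' w)\<^sup>2)"
    by (simp add: algebra_simps)
  finally show ?case
    by (rule mult_left_le_imp_le) (simp add: \<kappa>b)
qed

lemma card_block_sets:
  assumes "finite V" "X \<in> block_sets \<beta> V \<kappa>"
  shows "card X = (\<Sum>b\<in>\<beta> ` V. \<kappa> b)"
proof -
  have X: "finite X" "X \<subseteq> V" using block_sets_finite_elem[OF assms] block_setsD[OF assms(2)] by auto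
  have "(\<Sum>b\<in>\<beta> ` V. \<kappa> b) = (\<Sum>b\<in>\<beta> ` V. \<Sum>x\<in>{x. x \<in> X \<and> \<beta> x = b}. 1)"
    using assms(2) by (simp add: block_sets_def)
  also have "\<dots> = (\<Sum>x\<in>X. 1)"
    using X assms(1) by (intro sum.group) auto
  finally show ?thesis by simp
qed

lemma block_poly_pos:
  assumes "finite V" "\<And>x. x \<in> V \<Longrightarrow> 0 < w x" "block_sets \<beta> V \<kappa> \<noteq> {}"
  shows "0 < block_poly \<beta> V \<kappa> w"
  unfolding block_poly_def
proof (rule sum_pos[OF finite_block_sets[OF assms(1)] assms(3)])
  fix X assume "X \<in> block_sets \<beta> V \<kappa>"
  then show "0 < (\<Prod>x\<in>X. w x)" using assms(2) block_setsD[of X \<beta> V \<kappa>] by (intro prod_pos) auto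
qed

text \<open>
  The polynomial is a telescoping product of the quotients of \<open>block_poly_quotient_tangent\<close>,
  taken while the \<open>k\<close> elements are removed one by one. For each factor, \<open>ln q \<le> q - 1\<close> and
  the tangent bound combine, and the derivatives telescope too.
\<close>

lemma log_block_poly_le_deriv:
  assumes "finite V" "\<And>x. x \<in> V \<Longrightarrow> 0 < w x" "\<And>x. x \<in> V \<Longrightarrow> 0 \<le> v x"
    and "0 < block_poly \<beta> V \<kappa> v" "(\<Sum>b\<in>\<beta> ` V. \<kappa> b) = k"
  shows "ln (block_poly \<beta> V \<kappa> v / block_poly \<beta> V \<kappa> w)
    \<le> block_poly_deriv \<beta> V \<kappa> w v / block_poly \<beta> V \<kappa> w - real k"
  using assms
proof (induction k arbitrary: \<kappa>)
  case 0
  obtain X where "X \<in> block_sets \<beta> V \<kappa>" using 0 block_poly_pos_iff[of V v \<beta> \<kappa>] by auto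
  have "X = {}" if "X \<in> block_sets \<beta> V \<kappa>" for X
    using card_block_sets[OF 0(1) that] 0(5) block_sets_finite_elem[OF 0(1) that] by simp
  then have "block_sets \<beta> V \<kappa> = {{}}" using \<open>X \<in> block_sets \<beta> V \<kappa>\<close> by auto
  then show ?case by (simp add: block_poly_def block_poly_deriv_def)
next
  case (Suc k)
  note V = Suc.prems(1) and w = Suc.prems(2) and v = Suc.prems(3)
  have w': "0 \<le> w x" if "x \<in> V" for x using w[OF that] by simp
  obtain b where b: "b \<in> \<beta> ` V" "\<kappa> b > 0" using Suc.prems(5) by (metis gr0I nat.distinct(1) sum.neutral)
  let ?E = "block_poly \<beta> V (lower \<kappa> b)" and ?P = "block_poly \<beta> V \<kappa>"
  let ?E' = "block_poly_deriv \<beta> V (lower \<kappa> b) w v" and ?P' = "block_poly_deriv \<beta> V \<kappa> w v"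
  have "block_sets \<beta> V \<kappa> \<noteq> {}" using Suc.prems block_poly_pos_iff[of V v \<beta> \<kappa>] by auto
  then have Pw: "0 < ?P w" using V w by (intro block_poly_pos) auto
  have Ew: "0 < ?E w" using Pw b V w' by (intro block_poly_lower_pos) auto
  have Ev: "0 < ?E v" using Suc.prems b by (intro block_poly_lower_pos) auto
  have "sum (lower \<kappa> b) (\<beta> ` V) = sum (lower \<kappa> b) (\<beta> ` V - {b}) + (\<kappa> b - 1)"
    using V b by (subst sum.remove[of _ b]) (auto simp: lower_def)
  also have "sum (lower \<kappa> b) (\<beta> ` V - {b}) = sum \<kappa> (\<beta> ` V - {b})"
    by (intro sum.cong) (auto simp: lower_def)
  also have "sum \<kappa> (\<beta> ` V - {b}) + (\<kappa> b - 1) = k"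
    using Suc.prems(5) V b by (subst (asm) sum.remove[of _ b]) auto
  finally have k: "sum (lower \<kappa> b) (\<beta> ` V) = k" .
  have IH: "ln (?E v / ?E w) \<le> ?E' / ?E w - real k"
    by (rule Suc.IH[OF V w v Ev k])
  obtain r where "\<kappa> b = Suc r" using b by (metis gr0_implies_Suc)
  then have "?P v / ?E v \<le> (?P' * ?E w - ?P w * ?E') / (?E w)\<^sup>2"
    using Suc.prems by (intro block_poly_quotient_tangent) auto
  then have "(?P v / ?E v) * (?E w / ?P w) \<le> (?P' * ?E w - ?P w * ?E') / (?E w)\<^sup>2 * (?E w / ?P w)"
    using Pw Ew by (intro mult_right_mono) auto
  also have "\<dots> = ?P' / ?P w - ?E' / ?E w" using Pw Ew by (simp add: field_simps power2_eq_square)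
  finally have q: "(?P v / ?E v) * (?E w / ?P w) \<le> ?P' / ?P w - ?E' / ?E w" .
  have 1: "ln (?P v / ?P w) = ln ((?P v / ?E v) * (?E w / ?P w)) + ln (?E v / ?E w)"
    using Pw Ew Ev Suc.prems(4) by (simp add: ln_div ln_mult)
  have 2: "ln ((?P v / ?E v) * (?E w / ?P w)) \<le> (?P v / ?E v) * (?E w / ?P w) - 1"
    using Pw Ew Ev Suc.prems(4) by (intro ln_le_minus_one) auto
  show ?case using IH q 1 2 unfolding of_nat_Suc by linarith
qed

lemma block_poly_deriv_altdef:
  assumes "finite V" "\<And>x. x \<in> V \<Longrightarrow> 0 < w x"
  shows "block_poly_deriv \<beta> V \<kappa> w v = (\<Sum>X\<in>block_sets \<beta> V \<kappa>. (\<Prod>x\<in>X. w x) * (\<Sum>x\<in>X. v x / w x))"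
  unfolding block_poly_deriv_def sum_distrib_left
proof (intro sum.cong refl)
  fix X x assume X: "X \<in> block_sets \<beta> V \<kappa>" "x \<in> X"
  have "(\<Prod>x\<in>X. w x) = w x * (\<Prod>y\<in>X - {x}. w y)"
    using block_sets_finite_elem[OF assms(1) X(1)] X(2) by (rule prod.remove)
  moreover have "0 < w x" using X block_setsD[OF X(1)] assms(2) by auto
  ultimately show "v x * (\<Prod>y\<in>X - {x}. w y) = (\<Prod>x\<in>X. w x) * (v x / w x)" by simp
qed

text \<open>
  For a random \<open>X\<close> with probability proportional to \<open>\<Prod>x\<in>X. w x\<close> this reads
  \<open>ln E[\<Prod>x\<in>X. f x] \<le> E[\<Sum>x\<in>X. (f x - 1)]\<close>: the elements of \<open>X\<close> behave no worse than
  independent ones.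
\<close>

lemma log_block_poly_le:
  assumes "finite V" "\<And>x. x \<in> V \<Longrightarrow> 0 < w x" "\<And>x. x \<in> V \<Longrightarrow> 0 \<le> f x"
    and "block_sets \<beta> V \<kappa> \<noteq> {}" "\<And>X. X \<in> block_sets \<beta> V \<kappa> \<Longrightarrow> card X = k"
    and "0 < (\<Sum>X\<in>block_sets \<beta> V \<kappa>. (\<Prod>x\<in>X. w x) * (\<Prod>x\<in>X. f x))"
  shows "ln ((\<Sum>X\<in>block_sets \<beta> V \<kappa>. (\<Prod>x\<in>X. w x) * (\<Prod>x\<in>X. f x)) / (\<Sum>X\<in>block_sets \<beta> V \<kappa>. \<Prod>x\<in>X. w x))
    \<le> (\<Sum>X\<in>block_sets \<beta> V \<kappa>. (\<Prod>x\<in>X. w x) * (\<Sum>x\<in>X. f x)) / (\<Sum>X\<in>block_sets \<beta> V \<kappa>. \<Prod>x\<in>X. w x) - real k"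
proof -
  have eq: "block_poly \<beta> V \<kappa> (\<lambda>x. w x * f x) = (\<Sum>X\<in>block_sets \<beta> V \<kappa>. (\<Prod>x\<in>X. w x) * (\<Prod>x\<in>X. f x))"
    by (simp add: block_poly_def prod.distrib)
  have eq2: "block_poly_deriv \<beta> V \<kappa> w (\<lambda>x. w x * f x) = (\<Sum>X\<in>block_sets \<beta> V \<kappa>. (\<Prod>x\<in>X. w x) * (\<Sum>x\<in>X. f x))"
  proof -
    have "(\<Sum>x\<in>X. w x * f x / w x) = (\<Sum>x\<in>X. f x)" if "X \<in> block_sets \<beta> V \<kappa>" for X
    proof (intro sum.cong refl)
      fix x assume "x \<in> X"
      then have "0 < w x" using block_setsD[OF that] assms(2) by auto
      then show "w x * f x / w x = f x" by simp
    qed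
    then show ?thesis
      using block_poly_deriv_altdef[of V w \<beta> \<kappa> "\<lambda>x. w x * f x"] assms(1,2) by simp
  qed
  obtain X where "X \<in> block_sets \<beta> V \<kappa>" using assms(4) by auto
  then have k: "(\<Sum>b\<in>\<beta> ` V. \<kappa> b) = k" using card_block_sets[OF assms(1)] assms(5) by metis
  have "ln (block_poly \<beta> V \<kappa> (\<lambda>x. w x * f x) / block_poly \<beta> V \<kappa> w)
      \<le> block_poly_deriv \<beta> V \<kappa> w (\<lambda>x. w x * f x) / block_poly \<beta> V \<kappa> w - real k"
    using assms(1-3,6) k by (intro log_block_poly_le_deriv) (auto simp: eq less_imp_le)
  then show ?thesis unfolding eq eq2 unfolding block_poly_def .
qed

section \<open>Factorization of entropy for product weights\<close>

text \<open>
  Restricting weights to \<open>above \<B> T\<close> conditions a random member of \<open>\<B>\<close> to contain \<open>T\<close>.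
\<close>

definition above :: "'v set set \<Rightarrow> 'v set \<Rightarrow> 'v set set" where
  "above \<B> T = {X\<in>\<B>. T \<subseteq> X}"

lemma sum_swap_members_above:
  assumes V: "finite V" and \<B>: "\<And>X. X \<in> \<B> \<Longrightarrow> X \<subseteq> V"
  shows "(\<Sum>X\<in>above \<B> T. \<Sum>x\<in>X - T. f x X) = (\<Sum>x\<in>V - T. \<Sum>X\<in>above \<B> (insert x T). (f x X :: real))"
proof -
  have fin: "finite \<B>" using V \<B> by (intro finite_subset[of \<B> "Pow V"]) auto
  have fin': "finite (above \<B> T)" using fin by (simp add: above_def)
  have "(\<Sum>X\<in>above \<B> T. \<Sum>x\<in>X - T. f x X) = (\<Sum>X\<in>above \<B> T. \<Sum>x\<in>V - T. if x \<in> X then f x X else 0)"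
    using assms by (intro sum.cong refl sum.mono_neutral_cong_left) (auto simp: above_def)
  also have "\<dots> = (\<Sum>x\<in>V - T. \<Sum>X\<in>above \<B> T. if x \<in> X then f x X else 0)" by (rule sum.swap)
  also have "\<dots> = (\<Sum>x\<in>V - T. \<Sum>X\<in>above \<B> (insert x T). f x X)"
  proof (rule sum.cong[OF refl])
    fix x
    have "above \<B> (insert x T) = {X\<in>above \<B> T. x \<in> X}" by (auto simp: above_def)
    then show "(\<Sum>X\<in>above \<B> T. if x \<in> X then f x X else 0) = (\<Sum>X\<in>above \<B> (insert x T). f x X)"
      by (simp add: sum.inter_filter fin')
  qed
  finally show ?thesis .
qed

lemma went_singleton:
  assumes "0 < w a" "0 \<le> F a"
  shows "went {a} w F = 0"
  using assms by (cases "F a = 0") (simp_all add: went_def)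

text \<open>
  Here \<open>u x / z x\<close> is the mean of \<open>F\<close> given \<open>x \<in> X\<close>, and the left-hand side is \<open>r\<close> times the
  entropy that a uniformly random element of \<open>X - T\<close> reveals. The hypothesis \<open>star\<close> is an
  upper bound for exponential moments of sums over the elements; \<open>gibbs_variational\<close> turns
  it into this lower bound for the entropy of \<open>F\<close>.
\<close>

lemma entropic_independence:
  fixes \<B> :: "'v set set"
  assumes V: "finite V" and \<B>: "\<And>X. X \<in> \<B> \<Longrightarrow> X \<subseteq> V" and r: "\<And>X. X \<in> above \<B> T \<Longrightarrow> card (X - T) = r"
    and w: "\<And>X. X \<in> \<B> \<Longrightarrow> 0 < w X" and F: "\<And>X. X \<in> \<B> \<Longrightarrow> 0 \<le> F X"
    and star: "\<And>f. (\<And>x. x \<in> V - T \<Longrightarrow> 0 \<le> f x) \<Longrightarrow>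
        0 < (\<Sum>X\<in>above \<B> T. w X * (\<Prod>x\<in>X - T. f x)) \<Longrightarrow>
        ln ((\<Sum>X\<in>above \<B> T. w X * (\<Prod>x\<in>X - T. f x)) / (\<Sum>X\<in>above \<B> T. w X))
          \<le> (\<Sum>X\<in>above \<B> T. w X * (\<Sum>x\<in>X - T. f x)) / (\<Sum>X\<in>above \<B> T. w X) - real r"
  defines "u \<equiv> \<lambda>x. \<Sum>X\<in>above \<B> (insert x T). w X * F X"
    and "z \<equiv> \<lambda>x. \<Sum>X\<in>above \<B> (insert x T). w X"
  shows "(\<Sum>x\<in>V - T. u x * ln (u x / z x)) -
      real r * ((\<Sum>X\<in>above \<B> T. w X * F X) * ln ((\<Sum>X\<in>above \<B> T. w X * F X) / (\<Sum>X\<in>above \<B> T. w X)))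
     \<le> went (above \<B> T) w F"
proof -
  define B where "B = above \<B> T"
  define U Z where "U = (\<Sum>X\<in>B. w X * F X)" and "Z = (\<Sum>X\<in>B. w X)"
  have fin: "finite \<B>" using V \<B> by (intro finite_subset[of \<B> "Pow V"]) auto
  have finA: "finite (above \<B> S)" for S using fin by (simp add: above_def)
  have AB: "X \<in> above \<B> S \<Longrightarrow> X \<in> \<B>" for X S by (simp add: above_def)
  have wB: "0 < w X" if "X \<in> above \<B> S" for X S using w that by (auto simp: above_def)
  have FB: "0 \<le> F X" if "X \<in> above \<B> S" for X S using F that by (auto simp: above_def)
  have u0: "0 \<le> u x" for x unfolding u_def
    using wB FB by (intro sum_nonneg mult_nonneg_nonneg) (auto simp: less_imp_le)
  have zpos: "0 < z x" if "u x \<noteq> 0" for x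
  proof -
    have "above \<B> (insert x T) \<noteq> {}" using that by (auto simp: u_def)
    then show ?thesis unfolding z_def using finA wB by (intro sum_pos) auto
  qed
  have sum_u: "(\<Sum>x\<in>V - T. u x) = real r * U"
  proof -
    have "(\<Sum>x\<in>V - T. u x) = (\<Sum>X\<in>B. \<Sum>x\<in>X - T. w X * F X)"
      unfolding u_def B_def by (rule sum_swap_members_above[symmetric, OF V \<B>])
    also have "\<dots> = (\<Sum>X\<in>B. real r * (w X * F X))"
      using r by (intro sum.cong) (auto simp: B_def)
    finally show ?thesis by (simp add: U_def sum_distrib_left)
  qed
  have B0: "0 \<le> went B w F"
    unfolding B_def by (rule went_nonneg[OF finA]) (use wB FB in auto)
  show ?thesis
  proof (cases "U = 0")
    case True
    then have "\<forall>x\<in>V - T. u x = 0"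
      using sum_u u0 V by (simp add: sum_nonneg_eq_0_iff)
    then show ?thesis
      using True B0 by (simp add: U_def[symmetric] B_def[symmetric])
  next
    case False
    have "0 \<le> U" unfolding U_def B_def
      using wB FB by (intro sum_nonneg mult_nonneg_nonneg) (auto simp: less_imp_le)
    with False have U: "0 < U" by simp
    have "B \<noteq> {}" using False by (auto simp: U_def)
    then have Z: "0 < Z" unfolding Z_def B_def using finA wB by (intro sum_pos) auto
    \<comment> \<open>The mean of \<open>F\<close> given \<open>x \<in> X\<close>, relative to the mean of \<open>F\<close>. The sum of \<open>f\<close> over
      \<open>X - T\<close> then has mean exactly \<open>r\<close>, so \<open>star\<close> says that \<open>G = \<Prod>f\<close> has mean at most
      1.\<close>
    define f where "f x = u x / z x / (U / Z)" for x
    have f0: "0 \<le> f x" for x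
      unfolding f_def z_def using u0 U Z wB by (intro divide_nonneg_nonneg sum_nonneg) (auto simp: less_imp_le)
    have fpos: "0 < f x" if "X \<in> B" "0 < F X" "x \<in> X - T" for x X
    proof -
      have X: "X \<in> above \<B> (insert x T)" using that by (auto simp: B_def above_def)
      have "0 < w X * F X" using wB[OF X] that by simp
      also have "\<dots> \<le> u x" unfolding u_def
        using X finA wB FB by (intro member_le_sum) (auto simp: less_imp_le)
      finally show ?thesis using zpos U Z by (simp add: f_def)
    qed
    define G where "G X = (\<Prod>x\<in>X - T. f x)" for X
    have G0: "0 \<le> G X" for X unfolding G_def using f0 by (intro prod_nonneg) auto
    have Gpos: "0 < G X" if "X \<in> B" "0 < F X" for X
      unfolding G_def using fpos[OF that] by (intro prod_pos) auto
    have lnG: "(\<Sum>X\<in>B. w X * F X * ln (G X)) = (\<Sum>x\<in>V - T. u x * ln (u x / z x)) - real r * (U * ln (U / Z))"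
    proof -
      have "(\<Sum>X\<in>B. w X * F X * ln (G X)) = (\<Sum>X\<in>B. \<Sum>x\<in>X - T. w X * F X * ln (f x))"
      proof (rule sum.cong[OF refl])
        fix X assume X: "X \<in> B"
        show "w X * F X * ln (G X) = (\<Sum>x\<in>X - T. w X * F X * ln (f x))"
        proof (cases "F X = 0")
          case False
          then have "0 < F X" using FB X by (simp add: B_def less_le)
          then have "ln (G X) = (\<Sum>x\<in>X - T. ln (f x))"
            unfolding G_def
          proof (intro ln_prod)
            show "finite (X - T)" using X \<B>[of X] V finite_subset[of X V] by (auto simp: B_def above_def)
            show "f x \<noteq> 0" if "x \<in> X - T" for x using fpos[OF X \<open>0 < F X\<close> that] by simp
          qed
          then show ?thesis by (simp add: sum_distrib_left)
        qed simp
      qed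
      also have "\<dots> = (\<Sum>x\<in>V - T. \<Sum>X\<in>above \<B> (insert x T). w X * F X * ln (f x))"
        unfolding B_def by (rule sum_swap_members_above[OF V \<B>])
      also have "\<dots> = (\<Sum>x\<in>V - T. u x * ln (f x))"
        by (simp add: u_def sum_distrib_right)
      also have "\<dots> = (\<Sum>x\<in>V - T. u x * ln (u x / z x) - u x * ln (U / Z))"
      proof (rule sum.cong[OF refl])
        fix x
        show "u x * ln (f x) = u x * ln (u x / z x) - u x * ln (U / Z)"
          using u0[of x] zpos[of x] U Z by (cases "u x = 0") (auto simp: f_def ln_div ln_mult algebra_simps)
      qed
      also have "\<dots> = (\<Sum>x\<in>V - T. u x * ln (u x / z x)) - real r * U * ln (U / Z)"
        by (simp add: sum_subtractf sum_distrib_right[symmetric] sum_u)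
      finally show ?thesis by simp
    qed
    have sumf: "(\<Sum>X\<in>B. w X * (\<Sum>x\<in>X - T. f x)) = real r * Z"
    proof -
      have "(\<Sum>X\<in>B. w X * (\<Sum>x\<in>X - T. f x)) = (\<Sum>X\<in>B. \<Sum>x\<in>X - T. w X * f x)"
        by (simp add: sum_distrib_left)
      also have "\<dots> = (\<Sum>x\<in>V - T. \<Sum>X\<in>above \<B> (insert x T). w X * f x)"
        unfolding B_def by (rule sum_swap_members_above[OF V \<B>])
      also have "\<dots> = (\<Sum>x\<in>V - T. z x * f x)"
        by (simp add: z_def sum_distrib_right)
      also have "\<dots> = (\<Sum>x\<in>V - T. u x * (Z / U))"
      proof (rule sum.cong[OF refl])
        fix x
        show "z x * f x = u x * (Z / U)"
          using zpos[of x] U Z by (cases "u x = 0") (auto simp: f_def)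
      qed
      also have "\<dots> = real r * Z" unfolding sum_distrib_right[symmetric] sum_u using U by simp
      finally show ?thesis .
    qed
    obtain X where X: "X \<in> B" "w X * F X \<noteq> 0" using False unfolding U_def by (meson sum.neutral)
    then have "0 < F X" using FB by (auto simp: B_def less_le)
    have "0 < w X * G X" using wB X Gpos[OF X(1) \<open>0 < F X\<close>] by (simp add: B_def)
    also have "\<dots> \<le> (\<Sum>X\<in>B. w X * G X)"
      using X finA wB G0 by (intro member_le_sum) (auto simp: B_def less_imp_le)
    finally have pos: "0 < (\<Sum>X\<in>B. w X * G X)" .
    have "ln ((\<Sum>X\<in>B. w X * G X) / Z) \<le> (\<Sum>X\<in>B. w X * (\<Sum>x\<in>X - T. f x)) / Z - real r"
      unfolding G_def Z_def B_def by (rule star) (use f0 pos in \<open>auto simp: G_def B_def\<close>)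
    also have "\<dots> = 0" using Z by (simp add: sumf)
    finally have neg: "U * ln ((\<Sum>X\<in>B. w X * G X) / Z) \<le> 0"
      using U by (simp add: mult_nonneg_nonpos)
    have "(\<Sum>X\<in>B. w X * F X * ln (G X)) \<le> went B w F + U * ln ((\<Sum>X\<in>B. w X * G X) / Z)"
      unfolding U_def Z_def using finA wB FB G0 Gpos
      by (intro gibbs_variational) (auto simp: B_def)
    with neg lnG show ?thesis by (simp add: U_def Z_def B_def)
  qed
qed

text \<open>
  Reveal one of the \<open>r + 1\<close> remaining elements. By the chain rule, the entropies given the
  revealed element \<open>x\<close> add up to \<open>r + 1\<close> times the entropy, minus what the elements reveal,
  and by \<open>entropic_independence\<close> the latter is at most the entropy itself. So at least \<open>r\<close>
  times the entropy is left. By induction it is spread over the sets \<open>S\<close> above \<open>insert x T\<close>;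
  each \<open>S\<close> above \<open>T\<close> then occurs for \<open>r\<close> elements \<open>x\<close>, and the factors \<open>r\<close> cancel.
\<close>

lemma entropy_factorization_above:
  fixes \<B> :: "'v set set"
  assumes V: "finite V" and \<B>: "\<And>X. X \<in> \<B> \<Longrightarrow> X \<subseteq> V" and k: "\<And>X. X \<in> \<B> \<Longrightarrow> card X = k"
    and w: "\<And>X. X \<in> \<B> \<Longrightarrow> 0 < w X" and F: "\<And>X. X \<in> \<B> \<Longrightarrow> 0 \<le> F X"
    and star: "\<And>T f r. T \<subseteq> V \<Longrightarrow> card T + r = k \<Longrightarrow> above \<B> T \<noteq> {} \<Longrightarrow> (\<And>x. x \<in> V - T \<Longrightarrow> 0 \<le> f x) \<Longrightarrow>
        0 < (\<Sum>X\<in>above \<B> T. w X * (\<Prod>x\<in>X - T. f x)) \<Longrightarrow>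
        ln ((\<Sum>X\<in>above \<B> T. w X * (\<Prod>x\<in>X - T. f x)) / (\<Sum>X\<in>above \<B> T. w X))
          \<le> (\<Sum>X\<in>above \<B> T. w X * (\<Sum>x\<in>X - T. f x)) / (\<Sum>X\<in>above \<B> T. w X) - real r"
    and T: "T \<subseteq> V" "card T + r = k"
  shows "went (above \<B> T) w F \<le> (\<Sum>S\<in>above {S. S \<subseteq> V \<and> card S + 1 = k} T. went (above \<B> S) w F)"
  using T
proof (induction r arbitrary: T)
  let ?\<S> = "{S. S \<subseteq> V \<and> card S + 1 = k}"
  have fin: "finite \<B>" using V \<B> by (intro finite_subset[of \<B> "Pow V"]) auto
  have finA: "finite (above \<B> S)" for S using fin by (simp add: above_def)
  have nonneg: "0 \<le> went (above \<B> S) w F" for S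
    using finA w F by (intro went_nonneg) (auto simp: above_def)
  case 0
  have "X = T" if "X \<in> above \<B> T" for X
    using that 0 k[of X] \<B>[of X] V card_subset_eq[of X T] finite_subset[of X V] by (auto simp: above_def)
  then have "above \<B> T = {} \<or> above \<B> T = {T}" by blast
  then have "went (above \<B> T) w F = 0"
  proof
    assume T: "above \<B> T = {T}"
    then have "T \<in> \<B>" by (auto simp: above_def)
    then show ?thesis unfolding T using w F by (intro went_singleton) auto
  qed (simp add: went_def)
  then show ?case using nonneg by (simp add: sum_nonneg)
next
  let ?\<S> = "{S. S \<subseteq> V \<and> card S + 1 = k}"
  have fin: "finite \<B>" using V \<B> by (intro finite_subset[of \<B> "Pow V"]) auto
  have finA: "finite (above \<B> S)" for S using fin by (simp add: above_def)
  have finS: "finite (above ?\<S> S)" for S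
    by (rule finite_subset[of _ "Pow V"]) (auto simp: above_def V)
  have nonneg: "0 \<le> went (above \<B> S) w F" for S
    using finA w F by (intro went_nonneg) (auto simp: above_def)
  case (Suc r)
  show ?case
  proof (cases "r = 0 \<or> above \<B> T = {}")
    case True
    then show ?thesis
    proof
      assume "r = 0"
      then have "T \<in> above ?\<S> T" using Suc.prems by (auto simp: above_def)
      then show ?thesis using finS nonneg by (intro member_le_sum) auto
    next
      assume "above \<B> T = {}"
      then have "went (above \<B> T) w F = 0" by (simp add: went_def)
      then show ?thesis using nonneg by (simp add: sum_nonneg)
    qed
  next
    case False
    then have r: "0 < r" and ne: "above \<B> T \<noteq> {}" by auto
    have finT: "finite T" using Suc.prems V finite_subset by auto
    let ?B = "above \<B> T"
    define U Z where "U = (\<Sum>X\<in>?B. w X * F X)" and "Z = (\<Sum>X\<in>?B. w X)"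
    define u z where "u x = (\<Sum>X\<in>above \<B> (insert x T). w X * F X)"
      and "z x = (\<Sum>X\<in>above \<B> (insert x T). w X)" for x
    have card_diff: "card (X - T) = Suc r" if "X \<in> above \<B> T" for X
      using that k[of X] Suc.prems card_Diff_subset[OF finT, of X] by (auto simp: above_def)
    have 1: "(\<Sum>x\<in>V - T. u x * ln (u x / z x)) - real (Suc r) * (U * ln (U / Z)) \<le> went ?B w F"
      unfolding u_def z_def U_def Z_def
    proof (rule entropic_independence[OF V \<B> card_diff w F])
      fix f :: "'v \<Rightarrow> real"
      assume "\<And>x. x \<in> V - T \<Longrightarrow> 0 \<le> f x" "0 < (\<Sum>X\<in>above \<B> T. w X * (\<Prod>x\<in>X - T. f x))"
      then show "ln ((\<Sum>X\<in>above \<B> T. w X * (\<Prod>x\<in>X - T. f x)) / (\<Sum>X\<in>above \<B> T. w X))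
          \<le> (\<Sum>X\<in>above \<B> T. w X * (\<Sum>x\<in>X - T. f x)) / (\<Sum>X\<in>above \<B> T. w X) - real (Suc r)"
        using star[OF Suc.prems ne, of f] by blast
    qed
    have "(\<Sum>x\<in>V - T. went (above \<B> (insert x T)) w F)
        = (\<Sum>x\<in>V - T. \<Sum>X\<in>above \<B> (insert x T). w X * (F X * ln (F X))) - (\<Sum>x\<in>V - T. u x * ln (u x / z x))"
      by (simp add: went_def u_def z_def sum_subtractf)
    also have "(\<Sum>x\<in>V - T. \<Sum>X\<in>above \<B> (insert x T). w X * (F X * ln (F X)))
        = (\<Sum>X\<in>?B. \<Sum>x\<in>X - T. w X * (F X * ln (F X)))"
      by (rule sum_swap_members_above[OF V \<B>, symmetric])
    also have "\<dots> = (\<Sum>X\<in>?B. real (Suc r) * (w X * (F X * ln (F X))))"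
      using card_diff by (intro sum.cong refl) simp
    also have "\<dots> = real (Suc r) * (went ?B w F + U * ln (U / Z))"
      by (simp add: sum_distrib_left[symmetric] went_def U_def Z_def)
    finally have 2: "(\<Sum>x\<in>V - T. went (above \<B> (insert x T)) w F) =
        real (Suc r) * (went ?B w F + U * ln (U / Z)) - (\<Sum>x\<in>V - T. u x * ln (u x / z x))" .
    have "(\<Sum>x\<in>V - T. went (above \<B> (insert x T)) w F)
        \<le> (\<Sum>x\<in>V - T. \<Sum>S\<in>above ?\<S> (insert x T). went (above \<B> S) w F)"
      using Suc.prems finT by (intro sum_mono Suc.IH) auto
    also have "\<dots> = (\<Sum>S\<in>above ?\<S> T. \<Sum>x\<in>S - T. went (above \<B> S) w F)"
      using V by (intro sum_swap_members_above[symmetric]) auto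
    also have "\<dots> = (\<Sum>S\<in>above ?\<S> T. real r * went (above \<B> S) w F)"
    proof (intro sum.cong refl)
      fix S assume "S \<in> above ?\<S> T"
      then have "card (S - T) = r" using Suc.prems card_Diff_subset[OF finT, of S] by (auto simp: above_def)
      then show "(\<Sum>x\<in>S - T. went (above \<B> S) w F) = real r * went (above \<B> S) w F" by simp
    qed
    also have "\<dots> = real r * (\<Sum>S\<in>above ?\<S> T. went (above \<B> S) w F)"
      by (simp add: sum_distrib_left)
    finally have 3: "(\<Sum>x\<in>V - T. went (above \<B> (insert x T)) w F) \<le> real r * (\<Sum>S\<in>above ?\<S> T. went (above \<B> S) w F)" .
    have "real r * went ?B w F \<le> real r * (\<Sum>S\<in>above ?\<S> T. went (above \<B> S) w F)"
      using 1 2 3 by (simp add: algebra_simps)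
    then show ?thesis using r by simp
  qed
qed

text \<open>
  Conditioning on \<open>T \<subseteq> X\<close> leaves a set with prescribed block counts on \<open>V - T\<close>. This is why
  a bound for all block counts also holds for the conditioned families that
  \<open>entropy_factorization_above\<close> needs.
\<close>

lemma above_block_sets:
  assumes V: "finite V" and T: "T \<subseteq> V" and X0: "X0 \<in> above (block_sets \<beta> V \<kappa>) T"
  shows "bij_betw (\<lambda>Y. T \<union> Y) (block_sets \<beta> (V - T) (\<lambda>b. \<kappa> b - card {x\<in>T. \<beta> x = b})) (above (block_sets \<beta> V \<kappa>) T)"
proof -
  have finT: "finite T" using V T finite_subset by auto
  have le: "card {x\<in>T. \<beta> x = b} \<le> \<kappa> b" for b
  proof -
    have "card {x\<in>T. \<beta> x = b} \<le> card {x\<in>X0. \<beta> x = b}"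
      using X0 block_sets_finite_elem[OF V, of X0 \<beta> \<kappa>] by (intro card_mono) (auto simp: above_def)
    then show ?thesis using X0 by (simp add: above_def block_sets_def)
  qed
  have iff: "T \<union> Y \<in> block_sets \<beta> V \<kappa> \<longleftrightarrow> Y \<in> block_sets \<beta> (V - T) (\<lambda>b. \<kappa> b - card {x\<in>T. \<beta> x = b})"
    if "Y \<subseteq> V - T" for Y
  proof -
    have finY: "finite Y" using that V finite_subset by blast
    have "card {x\<in>T \<union> Y. \<beta> x = b} = card {x\<in>T. \<beta> x = b} + card {x\<in>Y. \<beta> x = b}" for b
    proof -
      have "{x\<in>T \<union> Y. \<beta> x = b} = {x\<in>T. \<beta> x = b} \<union> {x\<in>Y. \<beta> x = b}" by auto
      moreover have "{x\<in>T. \<beta> x = b} \<inter> {x\<in>Y. \<beta> x = b} = {}" using that by auto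
      ultimately show ?thesis using finT finY by (simp add: card_Un_disjoint)
    qed
    then have "card {x\<in>T \<union> Y. \<beta> x = b} = \<kappa> b \<longleftrightarrow> card {x\<in>Y. \<beta> x = b} = \<kappa> b - card {x\<in>T. \<beta> x = b}" for b
      using le[of b] by simp arith
    then have "(\<forall>b. card {x\<in>T \<union> Y. \<beta> x = b} = \<kappa> b) \<longleftrightarrow> (\<forall>b. card {x\<in>Y. \<beta> x = b} = \<kappa> b - card {x\<in>T. \<beta> x = b})"
      by simp
    then show ?thesis using that T by (auto simp: block_sets_def)
  qed
  show ?thesis
  proof (rule bij_betw_byWitness[where f'="\<lambda>X. X - T"])
    show "\<forall>Y\<in>block_sets \<beta> (V - T) (\<lambda>b. \<kappa> b - card {x\<in>T. \<beta> x = b}). T \<union> Y - T = Y"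
      by (auto dest: block_setsD)
    show "\<forall>X\<in>above (block_sets \<beta> V \<kappa>) T. T \<union> (X - T) = X" by (auto simp: above_def)
    show "(\<union>) T ` block_sets \<beta> (V - T) (\<lambda>b. \<kappa> b - card {x\<in>T. \<beta> x = b}) \<subseteq> above (block_sets \<beta> V \<kappa>) T"
      using iff block_setsD[of _ \<beta> "V - T"] by (auto simp: above_def)
    show "(\<lambda>X. X - T) ` above (block_sets \<beta> V \<kappa>) T \<subseteq> block_sets \<beta> (V - T) (\<lambda>b. \<kappa> b - card {x\<in>T. \<beta> x = b})"
    proof
      fix Y assume "Y \<in> (\<lambda>X. X - T) ` above (block_sets \<beta> V \<kappa>) T"
      then obtain X where X: "X \<in> block_sets \<beta> V \<kappa>" "T \<subseteq> X" "Y = X - T" by (auto simp: above_def)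
      then have "T \<union> Y = X" "Y \<subseteq> V - T" using block_setsD[OF X(1)] by auto
      then show "Y \<in> block_sets \<beta> (V - T) (\<lambda>b. \<kappa> b - card {x\<in>T. \<beta> x = b})" using iff[of Y] X by simp
    qed
  qed
qed

lemma log_block_poly_le_above:
  assumes V: "finite V" and w: "\<And>x. x \<in> V \<Longrightarrow> 0 < w x"
    and k: "\<And>X. X \<in> block_sets \<beta> V \<kappa> \<Longrightarrow> card X = k" and T: "T \<subseteq> V" "card T + r = k"
    and ne: "above (block_sets \<beta> V \<kappa>) T \<noteq> {}" and f: "\<And>x. x \<in> V - T \<Longrightarrow> 0 \<le> f x"
    and pos: "0 < (\<Sum>X\<in>above (block_sets \<beta> V \<kappa>) T. (\<Prod>x\<in>X. w x) * (\<Prod>x\<in>X - T. f x))"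
  shows "ln ((\<Sum>X\<in>above (block_sets \<beta> V \<kappa>) T. (\<Prod>x\<in>X. w x) * (\<Prod>x\<in>X - T. f x)) /
            (\<Sum>X\<in>above (block_sets \<beta> V \<kappa>) T. \<Prod>x\<in>X. w x))
          \<le> (\<Sum>X\<in>above (block_sets \<beta> V \<kappa>) T. (\<Prod>x\<in>X. w x) * (\<Sum>x\<in>X - T. f x)) /
            (\<Sum>X\<in>above (block_sets \<beta> V \<kappa>) T. \<Prod>x\<in>X. w x) - real r"
proof -
  let ?A = "above (block_sets \<beta> V \<kappa>) T"
  let ?L = "block_sets \<beta> (V - T) (\<lambda>b. \<kappa> b - card {x\<in>T. \<beta> x = b})"
  obtain X0 where X0: "X0 \<in> ?A" using ne by auto
  note bij = above_block_sets[OF V T(1) X0]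
  have finT: "finite T" using V T(1) finite_subset by auto
  define c where "c = (\<Prod>x\<in>T. w x)"
  have c: "0 < c" unfolding c_def using w T by (intro prod_pos) auto
  have YV: "Y \<subseteq> V - T" if "Y \<in> ?L" for Y using block_setsD[OF that] .
  have finY: "finite Y" if "Y \<in> ?L" for Y using YV[OF that] V finite_subset[of Y V] by auto
  have dj: "T \<inter> Y = {}" "T \<union> Y - T = Y" if "Y \<in> ?L" for Y using YV[OF that] by auto
  have tr: "(\<Sum>X\<in>?A. (\<Prod>x\<in>X. w x) * H (X - T)) = c * (\<Sum>Y\<in>?L. (\<Prod>x\<in>Y. w x) * H Y)" for H :: "'a set \<Rightarrow> real"
  proof -
    have "(\<Sum>X\<in>?A. (\<Prod>x\<in>X. w x) * H (X - T)) = (\<Sum>Y\<in>?L. (\<Prod>x\<in>T \<union> Y. w x) * H (T \<union> Y - T))"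
      by (rule sum.reindex_bij_betw[OF bij, symmetric])
    also have "\<dots> = (\<Sum>Y\<in>?L. c * ((\<Prod>x\<in>Y. w x) * H Y))"
    proof (rule sum.cong[OF refl])
      fix Y assume Y: "Y \<in> ?L"
      have "(\<Prod>x\<in>T \<union> Y. w x) = c * (\<Prod>x\<in>Y. w x)"
        unfolding c_def by (rule prod.union_disjoint[OF finT finY[OF Y] dj(1)[OF Y]])
      then show "(\<Prod>x\<in>T \<union> Y. w x) * H (T \<union> Y - T) = c * ((\<Prod>x\<in>Y. w x) * H Y)"
        by (simp add: dj(2)[OF Y])
    qed
    finally show ?thesis by (simp add: sum_distrib_left)
  qed
  have tr1: "(\<Sum>X\<in>?A. \<Prod>x\<in>X. w x) = c * (\<Sum>Y\<in>?L. \<Prod>x\<in>Y. w x)"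
    using tr[of "\<lambda>_. 1"] by simp
  have cardL: "card Y = r" if "Y \<in> ?L" for Y
  proof -
    have "T \<union> Y \<in> ?A" using bij that by (auto simp: bij_betw_def)
    then have "card (T \<union> Y) = k" using k by (simp add: above_def)
    then show ?thesis using T(2) card_Un_disjoint[OF finT finY[OF that] dj(1)[OF that]] by simp
  qed
  have neL: "?L \<noteq> {}" using bij ne by (auto simp: bij_betw_def)
  have posL: "0 < (\<Sum>Y\<in>?L. (\<Prod>x\<in>Y. w x) * (\<Prod>x\<in>Y. f x))"
    using pos c unfolding tr[of "\<lambda>Y. \<Prod>x\<in>Y. f x"] by (simp add: zero_less_mult_iff)
  have "ln ((\<Sum>X\<in>?L. (\<Prod>x\<in>X. w x) * (\<Prod>x\<in>X. f x)) / (\<Sum>X\<in>?L. \<Prod>x\<in>X. w x))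
    \<le> (\<Sum>X\<in>?L. (\<Prod>x\<in>X. w x) * (\<Sum>x\<in>X. f x)) / (\<Sum>X\<in>?L. \<Prod>x\<in>X. w x) - real r"
  proof (rule log_block_poly_le)
    show "finite (V - T)" using V by simp
    show "0 < w x" if "x \<in> V - T" for x using w that by simp
  qed (fact f neL cardL posL)+
  then show ?thesis
    unfolding tr[of "\<lambda>Y. \<Prod>x\<in>Y. f x"] tr[of "\<lambda>Y. \<Sum>x\<in>Y. f x"] tr1 using c by simp
qed

theorem block_entropy_factorization:
  assumes V: "finite V" and w: "\<And>x. x \<in> V \<Longrightarrow> 0 < w x"
    and k: "\<And>X. X \<in> block_sets \<beta> V \<kappa> \<Longrightarrow> card X = k"
    and F: "\<And>X. X \<in> block_sets \<beta> V \<kappa> \<Longrightarrow> 0 \<le> F X"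
  shows "went (block_sets \<beta> V \<kappa>) (\<lambda>X. \<Prod>x\<in>X. w x) F
     \<le> (\<Sum>S\<in>{S. S \<subseteq> V \<and> card S + 1 = k}. went (above (block_sets \<beta> V \<kappa>) S) (\<lambda>X. \<Prod>x\<in>X. w x) F)"
proof -
  have pos: "0 < (\<Prod>x\<in>X. w x)" if "X \<in> block_sets \<beta> V \<kappa>" for X
    using that w block_setsD[OF that] by (intro prod_pos) auto
  have "went (above (block_sets \<beta> V \<kappa>) {}) (\<lambda>X. \<Prod>x\<in>X. w x) F
     \<le> (\<Sum>S\<in>above {S. S \<subseteq> V \<and> card S + 1 = k} {}. went (above (block_sets \<beta> V \<kappa>) S) (\<lambda>X. \<Prod>x\<in>X. w x) F)"
  proof (rule entropy_factorization_above[OF V _ k pos F])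
    fix T r and f :: "'a \<Rightarrow> real"
    assume a: "T \<subseteq> V" "card T + r = k" "above (block_sets \<beta> V \<kappa>) T \<noteq> {}" "\<And>x. x \<in> V - T \<Longrightarrow> 0 \<le> f x"
       "0 < (\<Sum>X\<in>above (block_sets \<beta> V \<kappa>) T. (\<Prod>x\<in>X. w x) * (\<Prod>x\<in>X - T. f x))"
    show "ln ((\<Sum>X\<in>above (block_sets \<beta> V \<kappa>) T. (\<Prod>x\<in>X. w x) * (\<Prod>x\<in>X - T. f x)) /
            (\<Sum>X\<in>above (block_sets \<beta> V \<kappa>) T. \<Prod>x\<in>X. w x))
          \<le> (\<Sum>X\<in>above (block_sets \<beta> V \<kappa>) T. (\<Prod>x\<in>X. w x) * (\<Sum>x\<in>X - T. f x)) /
            (\<Sum>X\<in>above (block_sets \<beta> V \<kappa>) T. \<Prod>x\<in>X. w x) - real r"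
      by (rule log_block_poly_le_above[of V w \<beta> \<kappa> k T r f]) (fact V w k a)+
  qed (auto dest: block_setsD)
  then show ?thesis by (simp add: above_def)
qed

section \<open>A variance bound for product weights\<close>

lemma wvar_altdef:
  assumes "(\<Sum>x\<in>X. w x) \<noteq> 0"
  shows "wvar X w f = wmean X w (\<lambda>x. (f x)\<^sup>2) - (wmean X w f)\<^sup>2"
proof -
  define Z m where "Z = (\<Sum>x\<in>X. w x)" and "m = wmean X w f"
  have Z: "Z \<noteq> 0" using assms by (simp add: Z_def)
  have m: "(\<Sum>x\<in>X. w x * f x) = m * Z" using Z by (simp add: m_def wmean_def Z_def)
  have "(\<Sum>x\<in>X. w x * (f x - m)\<^sup>2) = (\<Sum>x\<in>X. w x * (f x)\<^sup>2 - 2 * m * (w x * f x) + m\<^sup>2 * w x)"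
    by (intro sum.cong refl) (simp add: power2_eq_square algebra_simps)
  also have "\<dots> = (\<Sum>x\<in>X. w x * (f x)\<^sup>2) - 2 * m * (\<Sum>x\<in>X. w x * f x) + m\<^sup>2 * Z"
    by (simp only: sum.distrib sum_subtractf sum_distrib_left[symmetric] Z_def)
  also have "\<dots> = (\<Sum>x\<in>X. w x * (f x)\<^sup>2) - m\<^sup>2 * Z" by (simp add: m power2_eq_square)
  finally have "(\<Sum>x\<in>X. w x * (f x - m)\<^sup>2) / Z = (\<Sum>x\<in>X. w x * (f x)\<^sup>2) / Z - m\<^sup>2"
    using Z by (simp add: diff_divide_distrib)
  then show ?thesis by (simp add: wvar_def wmean_def[of X w "\<lambda>x. (f x - c)\<^sup>2" for c] m_def[symmetric]
        wmean_def[of X w "\<lambda>x. (f x)\<^sup>2"] Z_def)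
qed

text \<open>
  The first two derivatives of the log-Laplace transform are the mean and the variance of
  the tilted weight.
\<close>

lemma log_laplace_derivatives:
  fixes w \<phi> :: "'x \<Rightarrow> real"
  assumes X: "finite X" "X \<noteq> {}" and w: "\<And>x. x \<in> X \<Longrightarrow> 0 < w x"
  shows "((\<lambda>t. ln (\<Sum>x\<in>X. w x * exp (t * \<phi> x))) has_real_derivative
            wmean X (\<lambda>x. w x * exp (t * \<phi> x)) \<phi>) (at t)"
    and "((\<lambda>t. wmean X (\<lambda>x. w x * exp (t * \<phi> x)) \<phi>) has_real_derivative
            wvar X (\<lambda>x. w x * exp (t * \<phi> x)) \<phi>) (at t)"
proof -
  have D: "((\<lambda>t. \<Sum>x\<in>X. w x * exp (t * \<phi> x)) has_real_derivative (\<Sum>x\<in>X. w x * exp (t * \<phi> x) * \<phi> x)) (at t)"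
    by (auto intro!: derivative_eq_intros DERIV_sum simp: mult.assoc mult.commute)
  have N: "((\<lambda>t. \<Sum>x\<in>X. w x * exp (t * \<phi> x) * \<phi> x) has_real_derivative (\<Sum>x\<in>X. w x * exp (t * \<phi> x) * (\<phi> x)\<^sup>2)) (at t)"
    by (auto intro!: derivative_eq_intros DERIV_sum simp: power2_eq_square mult.assoc mult.commute)
  have pos: "0 < (\<Sum>x\<in>X. w x * exp (t * \<phi> x))" for t
    using X w by (intro sum_pos) auto
  show "((\<lambda>t. ln (\<Sum>x\<in>X. w x * exp (t * \<phi> x))) has_real_derivative
            wmean X (\<lambda>x. w x * exp (t * \<phi> x)) \<phi>) (at t)"
    using DERIV_chain2[OF DERIV_ln[OF pos] D] by (simp add: wmean_def field_simps)
  have "((\<lambda>t. wmean X (\<lambda>x. w x * exp (t * \<phi> x)) \<phi>) has_real_derivative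
     ((\<Sum>x\<in>X. w x * exp (t * \<phi> x) * (\<phi> x)\<^sup>2) * (\<Sum>x\<in>X. w x * exp (t * \<phi> x)) -
       (\<Sum>x\<in>X. w x * exp (t * \<phi> x) * \<phi> x) * (\<Sum>x\<in>X. w x * exp (t * \<phi> x) * \<phi> x)) /
      ((\<Sum>x\<in>X. w x * exp (t * \<phi> x)) * (\<Sum>x\<in>X. w x * exp (t * \<phi> x)))) (at t)"
    unfolding wmean_def using pos[of t] by (intro DERIV_divide D N) simp
  also have "((\<Sum>x\<in>X. w x * exp (t * \<phi> x) * (\<phi> x)\<^sup>2) * (\<Sum>x\<in>X. w x * exp (t * \<phi> x)) -
       (\<Sum>x\<in>X. w x * exp (t * \<phi> x) * \<phi> x) * (\<Sum>x\<in>X. w x * exp (t * \<phi> x) * \<phi> x)) /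
      ((\<Sum>x\<in>X. w x * exp (t * \<phi> x)) * (\<Sum>x\<in>X. w x * exp (t * \<phi> x)))
    = wvar X (\<lambda>x. w x * exp (t * \<phi> x)) \<phi>"
    using pos[of t] by (subst wvar_altdef) (simp_all add: wmean_def power2_eq_square diff_divide_distrib)
  finally show "((\<lambda>t. wmean X (\<lambda>x. w x * exp (t * \<phi> x)) \<phi>) has_real_derivative
            wvar X (\<lambda>x. w x * exp (t * \<phi> x)) \<phi>) (at t)" .
qed

lemma second_derivative_at_minimum:
  fixes h h' :: "real \<Rightarrow> real"
  assumes h: "\<And>t. (h has_real_derivative h' t) (at t)" and h': "(h' has_real_derivative c) (at 0)"
    and "h' 0 = 0" and min: "\<And>t. h 0 \<le> h t"
  shows "0 \<le> c"
proof (rule ccontr)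
  assume "\<not> 0 \<le> c"
  then obtain d where d: "d > 0" "\<And>s. 0 < s \<Longrightarrow> s < d \<Longrightarrow> h' (0 + s) < h' 0"
    using DERIV_neg_dec_right[OF h'] by (auto simp: not_le)
  obtain z where z: "0 < z" "z < d / 2" "h (d / 2) - h 0 = (d / 2 - 0) * h' z"
    using MVT2[of 0 "d / 2" h h'] d h by auto
  have "h' z < 0" using d(2)[of z] z d(1) assms(3) by simp
  then have "(d / 2 - 0) * h' z < 0" using d(1) by (simp add: mult_pos_neg)
  then show False using z(3) min[of "d / 2"] by simp
qed

text \<open>
  The complement of a random \<open>X\<close> with product weight \<open>w\<close> is again of this kind, with weight
  \<open>1 / w\<close>.
\<close>

lemma block_sets_complement:
  assumes V: "finite V" and ne: "block_sets \<beta> V \<kappa> \<noteq> {}"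
  shows "bij_betw (\<lambda>X. V - X) (block_sets \<beta> V (\<lambda>b. card {x\<in>V. \<beta> x = b} - \<kappa> b)) (block_sets \<beta> V \<kappa>)"
proof -
  obtain X0 where X0: "X0 \<in> block_sets \<beta> V \<kappa>" using ne by auto
  have le: "\<kappa> b \<le> card {x\<in>V. \<beta> x = b}" for b
  proof -
    have "card {x\<in>X0. \<beta> x = b} \<le> card {x\<in>V. \<beta> x = b}"
      using V block_setsD[OF X0] by (intro card_mono) auto
    then show ?thesis using X0 by (simp add: block_sets_def)
  qed
  have card: "card {x\<in>V - X. \<beta> x = b} = card {x\<in>V. \<beta> x = b} - card {x\<in>X. \<beta> x = b}"
    and cardle: "card {x\<in>X. \<beta> x = b} \<le> card {x\<in>V. \<beta> x = b}" if "X \<subseteq> V" for X b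
  proof -
    have "{x\<in>V - X. \<beta> x = b} = {x\<in>V. \<beta> x = b} - {x\<in>X. \<beta> x = b}" by auto
    moreover have sub: "{x\<in>X. \<beta> x = b} \<subseteq> {x\<in>V. \<beta> x = b}" using that by auto
    moreover have "finite {x\<in>X. \<beta> x = b}" using that V finite_subset[of X V] by auto
    ultimately show "card {x\<in>V - X. \<beta> x = b} = card {x\<in>V. \<beta> x = b} - card {x\<in>X. \<beta> x = b}"
      by (simp add: card_Diff_subset)
    show "card {x\<in>X. \<beta> x = b} \<le> card {x\<in>V. \<beta> x = b}"
      using sub V by (intro card_mono) auto
  qed
  show ?thesis
  proof (rule bij_betw_byWitness[where f'="\<lambda>X. V - X"])
    show "\<forall>X\<in>block_sets \<beta> V (\<lambda>b. card {x\<in>V. \<beta> x = b} - \<kappa> b). V - (V - X) = X"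
      by (auto dest: block_setsD)
    show "\<forall>X\<in>block_sets \<beta> V \<kappa>. V - (V - X) = X"
      by (auto dest: block_setsD)
    show "(-) V ` block_sets \<beta> V (\<lambda>b. card {x\<in>V. \<beta> x = b} - \<kappa> b) \<subseteq> block_sets \<beta> V \<kappa>"
    proof
      fix Y assume "Y \<in> (-) V ` block_sets \<beta> V (\<lambda>b. card {x\<in>V. \<beta> x = b} - \<kappa> b)"
      then obtain X where X: "X \<in> block_sets \<beta> V (\<lambda>b. card {x\<in>V. \<beta> x = b} - \<kappa> b)" "Y = V - X" by auto
      then have "card {x\<in>Y. \<beta> x = b} = \<kappa> b" for b
        using card[OF block_setsD[OF X(1)], of b] le[of b] by (simp add: block_sets_def)
      then show "Y \<in> block_sets \<beta> V \<kappa>" using X by (auto simp: block_sets_def)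
    qed
    show "(-) V ` block_sets \<beta> V \<kappa> \<subseteq> block_sets \<beta> V (\<lambda>b. card {x\<in>V. \<beta> x = b} - \<kappa> b)"
    proof
      fix Y assume "Y \<in> (-) V ` block_sets \<beta> V \<kappa>"
      then obtain X where X: "X \<in> block_sets \<beta> V \<kappa>" "Y = V - X" by auto
      then have "card {x\<in>Y. \<beta> x = b} = card {x\<in>V. \<beta> x = b} - \<kappa> b" for b
        using card[OF block_setsD[OF X(1)], of b] by (simp add: block_sets_def)
      then show "Y \<in> block_sets \<beta> V (\<lambda>b. card {x\<in>V. \<beta> x = b} - \<kappa> b)" using X by (auto simp: block_sets_def)
    qed
  qed
qed

text \<open>
  Write \<open>\<phi> X = (\<Sum>x\<in>X. u x)\<close>. Taking \<open>f = exp (t u)\<close> in \<open>log_block_poly_le\<close> gives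
  \<open>ln E[exp (t \<phi>)] \<le> E[\<Sum>x\<in>X. (exp (t u x) - 1)]\<close>, and the complement gives
  \<open>ln E[exp (t \<phi>)] \<le> t (\<Sum>x\<in>V. u x) + E[\<Sum>x\<in>V - X. (exp (- t u x) - 1)]\<close>. Both are equalities
  to first order at \<open>t = 0\<close>. Added together, they say at second order that \<open>2 Var \<phi>\<close> is at
  most the sum of \<open>(u x)\<^sup>2\<close> over \<open>X\<close> and over \<open>V - X\<close>, which does not depend on \<open>X\<close>.
\<close>

theorem block_variance_bound:
  fixes w u :: "'v \<Rightarrow> real"
  assumes V: "finite V" and w: "\<And>x. x \<in> V \<Longrightarrow> 0 < w x"
    and k: "\<And>X. X \<in> block_sets \<beta> V \<kappa> \<Longrightarrow> card X = k" and ne: "block_sets \<beta> V \<kappa> \<noteq> {}"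
  shows "wvar (block_sets \<beta> V \<kappa>) (\<lambda>X. \<Prod>x\<in>X. w x) (\<lambda>X. \<Sum>x\<in>X. u x) \<le> (\<Sum>x\<in>V. (u x)\<^sup>2) / 2"
proof -
  define \<B> where "\<B> = block_sets \<beta> V \<kappa>"
  define \<omega> \<phi> where "\<omega> X = (\<Prod>x\<in>X. w x)" and "\<phi> X = (\<Sum>x\<in>X. u x)" for X
  define Z U where "Z = (\<Sum>X\<in>\<B>. \<omega> X)" and "U = (\<Sum>x\<in>V. u x)"
  have BV: "X \<subseteq> V" if "X \<in> \<B>" for X using that block_setsD unfolding \<B>_def by metis
  have finX: "finite X" if "X \<in> \<B>" for X using BV[OF that] V by (rule finite_subset)
  have fin: "finite \<B>" unfolding \<B>_def by (rule finite_block_sets[OF V])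
  have \<omega>: "0 < \<omega> X" if "X \<in> \<B>" for X unfolding \<omega>_def using BV[OF that] w by (intro prod_pos) auto
  have Z: "0 < Z" unfolding Z_def using fin ne \<omega> by (intro sum_pos) (auto simp: \<B>_def)
  have kB: "card X = k" if "X \<in> \<B>" for X using that k unfolding \<B>_def by blast
  define S where "S t = (\<Sum>X\<in>\<B>. \<omega> X * exp (t * \<phi> X))" for t
  have S: "0 < S t" for t unfolding S_def using fin ne \<omega> by (intro sum_pos) (auto simp: \<B>_def)
  have particles: "ln (S t / Z) \<le> (\<Sum>X\<in>\<B>. \<omega> X * (\<Sum>x\<in>X. exp (t * u x))) / Z - real k" for t
  proof -
    have e: "\<omega> X * exp (t * \<phi> X) = (\<Prod>x\<in>X. w x) * (\<Prod>x\<in>X. exp (t * u x))" if "X \<in> \<B>" for X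
      using finX[OF that] by (simp add: \<omega>_def \<phi>_def exp_sum sum_distrib_left)
    have S_eq: "S t = (\<Sum>X\<in>\<B>. (\<Prod>x\<in>X. w x) * (\<Prod>x\<in>X. exp (t * u x)))"
      unfolding S_def by (intro sum.cong refl e)
    have "0 < (\<Sum>X\<in>\<B>. (\<Prod>x\<in>X. w x) * (\<Prod>x\<in>X. exp (t * u x)))" using S[of t] S_eq by simp
    then show ?thesis
      using log_block_poly_le[of V w "\<lambda>x. exp (t * u x)" \<beta> \<kappa> k] V w ne k
      unfolding S_eq Z_def \<omega>_def \<B>_def by simp
  qed
  let ?\<kappa>' = "\<lambda>b. card {x\<in>V. \<beta> x = b} - \<kappa> b"
  define c where "c = (\<Prod>x\<in>V. w x)"
  have c: "0 < c" unfolding c_def using w by (intro prod_pos) auto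
  have tr: "(\<Sum>Y\<in>block_sets \<beta> V ?\<kappa>'. (\<Prod>x\<in>Y. 1 / w x) * H Y) = (\<Sum>X\<in>\<B>. \<omega> X * H (V - X)) / c" for H
  proof -
    have "(\<Sum>X\<in>\<B>. \<omega> X * H (V - X)) = (\<Sum>Y\<in>block_sets \<beta> V ?\<kappa>'. \<omega> (V - Y) * H (V - (V - Y)))"
      unfolding \<B>_def by (rule sum.reindex_bij_betw[OF block_sets_complement[OF V ne], symmetric])
    also have "\<dots> = (\<Sum>Y\<in>block_sets \<beta> V ?\<kappa>'. c * ((\<Prod>x\<in>Y. 1 / w x) * H Y))"
    proof (rule sum.cong[OF refl])
      fix Y assume "Y \<in> block_sets \<beta> V ?\<kappa>'"
      then have Y: "Y \<subseteq> V" by (rule block_setsD)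
      have "(\<Prod>x\<in>V - Y. w x) * (\<Prod>x\<in>Y. w x) = c"
        unfolding c_def using prod.subset_diff[OF Y V, of w] by simp
      moreover have "0 < (\<Prod>x\<in>Y. w x)" using w Y by (intro prod_pos) auto
      moreover have "V - (V - Y) = Y" using Y by auto
      ultimately show "\<omega> (V - Y) * H (V - (V - Y)) = c * ((\<Prod>x\<in>Y. 1 / w x) * H Y)"
        by (simp add: \<omega>_def prod_dividef field_simps)
    qed
    finally show ?thesis using c by (simp add: sum_distrib_left[symmetric])
  qed
  have holes: "ln (S t / Z) - t * U \<le> (\<Sum>X\<in>\<B>. \<omega> X * (\<Sum>x\<in>V - X. exp (- t * u x))) / Z - (real (card V) - real k)" for t
  proof -
    have e: "\<omega> X * (\<Prod>x\<in>V - X. exp (- t * u x)) = exp (- t * U) * (\<omega> X * exp (t * \<phi> X))" if "X \<in> \<B>" for X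
    proof -
      have "(\<Prod>x\<in>V - X. exp (- t * u x)) = exp (\<Sum>x\<in>V - X. - t * u x)"
        using V by (intro exp_sum[symmetric]) simp
      also have "(\<Sum>x\<in>V - X. - t * u x) = - t * U + t * \<phi> X"
        using sum.subset_diff[OF BV[OF that] V, of u]
        by (simp add: U_def \<phi>_def sum_distrib_left[symmetric] sum_negf algebra_simps)
      finally show ?thesis using exp_add[of "- t * U" "t * \<phi> X"] by simp
    qed
    have S_eq: "(\<Sum>X\<in>\<B>. \<omega> X * (\<Prod>x\<in>V - X. exp (- t * u x))) = exp (- t * U) * S t"
      unfolding S_def sum_distrib_left by (intro sum.cong refl e)
    have card': "card Y = card V - k" if "Y \<in> block_sets \<beta> V ?\<kappa>'" for Y
    proof -
      have "V - Y \<in> \<B>" using block_sets_complement[OF V ne] that unfolding \<B>_def bij_betw_def by auto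
      then have "card (V - Y) = k" by (rule kB)
      moreover have "Y \<subseteq> V" using that by (rule block_setsD)
      ultimately show ?thesis
        using card_mono[OF V \<open>Y \<subseteq> V\<close>] V by (simp add: card_Diff_subset finite_subset)
    qed
    have kV: "k \<le> card V" using ne kB BV V card_mono unfolding \<B>_def by (metis ex_in_conv)
    have ne': "block_sets \<beta> V ?\<kappa>' \<noteq> {}"
      using block_sets_complement[OF V ne] ne by (auto simp: bij_betw_def)
    have tr1: "(\<Sum>Y\<in>block_sets \<beta> V ?\<kappa>'. \<Prod>x\<in>Y. 1 / w x) = Z / c" using tr[of "\<lambda>_. 1"] by (simp add: Z_def)
    have "ln ((\<Sum>Y\<in>block_sets \<beta> V ?\<kappa>'. (\<Prod>x\<in>Y. 1 / w x) * (\<Prod>x\<in>Y. exp (- t * u x))) / (\<Sum>Y\<in>block_sets \<beta> V ?\<kappa>'. \<Prod>x\<in>Y. 1 / w x))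
      \<le> (\<Sum>Y\<in>block_sets \<beta> V ?\<kappa>'. (\<Prod>x\<in>Y. 1 / w x) * (\<Sum>x\<in>Y. exp (- t * u x))) / (\<Sum>Y\<in>block_sets \<beta> V ?\<kappa>'. \<Prod>x\<in>Y. 1 / w x)
         - real (card V - k)"
    proof (rule log_block_poly_le[OF V])
      show "0 < 1 / w x" if "x \<in> V" for x using w[OF that] by simp
      show "0 < (\<Sum>Y\<in>block_sets \<beta> V ?\<kappa>'. (\<Prod>x\<in>Y. 1 / w x) * (\<Prod>x\<in>Y. exp (- t * u x)))"
        unfolding tr S_eq using S[of t] c by simp
    qed (simp, fact ne', fact card')
    then have "ln (exp (- t * U) * S t / Z) \<le> (\<Sum>X\<in>\<B>. \<omega> X * (\<Sum>x\<in>V - X. exp (- t * u x))) / Z - real (card V - k)"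
      unfolding tr tr1 S_eq using c by simp
    moreover have "ln (exp (- t * U) * S t / Z) = - t * U + ln (S t / Z)"
      using S[of t] Z by (simp add: ln_div ln_mult)
    ultimately show ?thesis using kV by (simp add: of_nat_diff)
  qed
  define Q where "Q t = (\<Sum>X\<in>\<B>. \<omega> X * ((\<Sum>x\<in>X. exp (t * u x)) + (\<Sum>x\<in>V - X. exp (- t * u x))))" for t
  define Q' where "Q' t = (\<Sum>X\<in>\<B>. \<omega> X * ((\<Sum>x\<in>X. u x * exp (t * u x)) - (\<Sum>x\<in>V - X. u x * exp (- t * u x))))" for t
  define M where "M t = wmean \<B> (\<lambda>X. \<omega> X * exp (t * \<phi> X)) \<phi>" for t
  have BNe: "\<B> \<noteq> {}" using ne by (simp add: \<B>_def)
  define L where "L t = ln (S t)" for t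
  have dL: "(L has_real_derivative M t) (at t)" for t
    unfolding L_def[abs_def] S_def M_def by (rule log_laplace_derivatives(1)[OF fin BNe \<omega>])
  have dM: "(M has_real_derivative wvar \<B> \<omega> \<phi>) (at 0)"
    using log_laplace_derivatives(2)[OF fin BNe, of \<omega> \<phi> 0, OF \<omega>] by (simp add: M_def[abs_def])
  have dexp: "((\<lambda>t. exp (t * a)) has_real_derivative a * exp (t * a)) (at t)"
    "((\<lambda>t. exp (- t * a)) has_real_derivative - (a * exp (- t * a))) (at t)" for a t :: real
    by (auto intro!: derivative_eq_intros)
  have dQ: "(Q has_real_derivative Q' t) (at t)" for t
  proof -
    have "((\<lambda>t. \<Sum>X\<in>\<B>. \<omega> X * ((\<Sum>x\<in>X. exp (t * u x)) + (\<Sum>x\<in>V - X. exp (- t * u x)))) has_real_derivative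
      (\<Sum>X\<in>\<B>. \<omega> X * ((\<Sum>x\<in>X. u x * exp (t * u x)) + (\<Sum>x\<in>V - X. - (u x * exp (- t * u x)))))) (at t)"
      by (intro DERIV_sum DERIV_cmult DERIV_add dexp)
    then show ?thesis unfolding sum_negf by (simp add: Q_def[abs_def] Q'_def)
  qed
  have dQ': "(Q' has_real_derivative (\<Sum>X\<in>\<B>. \<omega> X * (\<Sum>x\<in>V. (u x)\<^sup>2))) (at 0)"
  proof -
    have "(Q' has_real_derivative (\<Sum>X\<in>\<B>. \<omega> X * ((\<Sum>x\<in>X. u x * (u x * exp (0 * u x)))
        - (\<Sum>x\<in>V - X. u x * - (u x * exp (- 0 * u x)))))) (at 0)"
      unfolding Q'_def[abs_def] by (intro DERIV_sum DERIV_cmult DERIV_diff dexp)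
    also have "(\<Sum>X\<in>\<B>. \<omega> X * ((\<Sum>x\<in>X. u x * (u x * exp (0 * u x)))
        - (\<Sum>x\<in>V - X. u x * - (u x * exp (- 0 * u x))))) = (\<Sum>X\<in>\<B>. \<omega> X * (\<Sum>x\<in>V. (u x)\<^sup>2))"
    proof (rule sum.cong[OF refl])
      fix X assume X: "X \<in> \<B>"
      show "\<omega> X * ((\<Sum>x\<in>X. u x * (u x * exp (0 * u x))) - (\<Sum>x\<in>V - X. u x * - (u x * exp (- 0 * u x))))
          = \<omega> X * (\<Sum>x\<in>V. (u x)\<^sup>2)"
        using sum.subset_diff[OF BV[OF X] V, of "\<lambda>x. u x * u x"] by (simp add: power2_eq_square sum_negf)
    qed
    finally show ?thesis .
  qed
  \<comment> \<open>The sum of the two upper bounds minus twice the log-Laplace transform; its minimum is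
    at 0.\<close>
  define h where "h t = t * U + Q t / Z - real (card V) - 2 * (L t - ln Z)" for t
  define h' where "h' t = U + Q' t / Z - 2 * M t" for t
  have card: "(\<Sum>x\<in>X. 1::real) + (\<Sum>x\<in>V - X. 1) = card V" if "X \<in> \<B>" for X
    using sum.subset_diff[OF BV[OF that] V, of "\<lambda>_. 1::real"] by simp
  have "h 0 \<le> h t" for t
  proof -
    have "h 0 = 0"
    proof -
      have "(\<Sum>X\<in>\<B>. \<omega> X * ((\<Sum>x\<in>X. 1) + (\<Sum>x\<in>V - X. 1))) = (\<Sum>X\<in>\<B>. \<omega> X * real (card V))"
        by (rule sum.cong[OF refl]) (use card in simp)
      then show ?thesis using Z by (simp add: h_def Q_def L_def S_def Z_def[symmetric] sum_distrib_right[symmetric])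
    qed
    also have "0 \<le> h t"
      using particles[of t] holes[of t] S[of t] Z
      by (simp add: h_def Q_def L_def ln_div distrib_left sum.distrib add_divide_distrib)
    finally show ?thesis .
  qed
  moreover have "(h has_real_derivative h' t) (at t)" for t
    unfolding h_def h'_def using Z by (auto intro!: derivative_eq_intros dQ dL)
  moreover have "(h' has_real_derivative (\<Sum>x\<in>V. (u x)\<^sup>2) - 2 * wvar \<B> \<omega> \<phi>) (at 0)"
  proof -
    have "(h' has_real_derivative (\<Sum>X\<in>\<B>. \<omega> X * (\<Sum>x\<in>V. (u x)\<^sup>2)) / Z - 2 * wvar \<B> \<omega> \<phi>) (at 0)"
      unfolding h'_def using Z by (auto intro!: derivative_eq_intros dQ' dM)
    then show ?thesis using Z by (simp add: sum_distrib_right[symmetric] Z_def[symmetric])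
  qed
  moreover have "h' 0 = 0"
  proof -
    have "(\<Sum>X\<in>\<B>. \<omega> X * ((\<Sum>x\<in>X. u x) - (\<Sum>x\<in>V - X. u x))) = (\<Sum>X\<in>\<B>. 2 * (\<omega> X * \<phi> X) - \<omega> X * U)"
    proof (rule sum.cong[OF refl])
      fix X assume "X \<in> \<B>"
      then show "\<omega> X * ((\<Sum>x\<in>X. u x) - (\<Sum>x\<in>V - X. u x)) = 2 * (\<omega> X * \<phi> X) - \<omega> X * U"
        using sum.subset_diff[OF BV[OF \<open>X \<in> \<B>\<close>] V, of u] by (simp add: \<phi>_def U_def algebra_simps)
    qed
    also have "\<dots> = 2 * (\<Sum>X\<in>\<B>. \<omega> X * \<phi> X) - Z * U"
      by (simp only: sum_subtractf sum_distrib_left[symmetric] sum_distrib_right[symmetric] Z_def)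
    finally show ?thesis using Z by (simp add: h'_def Q'_def M_def wmean_def Z_def[symmetric] diff_divide_distrib)
  qed
  ultimately have "0 \<le> (\<Sum>x\<in>V. (u x)\<^sup>2) - 2 * wvar \<B> \<omega> \<phi>"
    by (intro second_derivative_at_minimum[of h h']) auto
  then show ?thesis by (simp add: \<B>_def \<omega>_def[abs_def] \<phi>_def[abs_def])
qed

section \<open>Entropy, total variation and Laplace transforms\<close>

lemma abs_exp_minus_linear_le:
  fixes x :: real
  assumes "\<bar>x\<bar> \<le> 1"
  shows "\<bar>exp x - 1 - x\<bar> \<le> x\<^sup>2"
proof -
  have "exp x \<le> 1 + x + x\<^sup>2"
  proof (cases "0 \<le> x")
    case True
    then show ?thesis using assms by (intro exp_bound) auto
  next
    case False
    define y where "y = - x"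
    have y: "0 < y" using False by (simp add: y_def)
    have "1 + y \<le> exp y" by (rule exp_ge_add_one_self)
    then have "exp (- y) \<le> 1 / (1 + y)" using y by (simp add: exp_minus field_simps)
    also have "\<dots> \<le> 1 - y + y\<^sup>2"
    proof -
      have "1 \<le> (1 - y + y\<^sup>2) * (1 + y)" using y by (simp add: algebra_simps power2_eq_square)
      then show ?thesis using y by (simp add: divide_le_eq)
    qed
    finally show ?thesis by (simp add: y_def)
  qed
  moreover have "1 + x \<le> exp x" by (rule exp_ge_add_one_self)
  ultimately show ?thesis by linarith
qed

lemma weighted_Cauchy_Schwarz:
  fixes w a b :: "'x \<Rightarrow> real"
  assumes "\<And>x. x \<in> X \<Longrightarrow> 0 \<le> w x"
  shows "(\<Sum>x\<in>X. w x * (a x * b x))\<^sup>2 \<le> (\<Sum>x\<in>X. w x * (a x)\<^sup>2) * (\<Sum>x\<in>X. w x * (b x)\<^sup>2)"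
proof -
  have 1: "(\<Sum>x\<in>X. (sqrt (w x) * a x) * (sqrt (w x) * b x)) = (\<Sum>x\<in>X. w x * (a x * b x))"
    using assms by (intro sum.cong refl) (simp add: mult.assoc mult.left_commute[of _ "sqrt _"] flip: mult.assoc)
  have 2: "(\<Sum>x\<in>X. (sqrt (w x) * c x)\<^sup>2) = (\<Sum>x\<in>X. w x * (c x)\<^sup>2)" for c
    using assms by (intro sum.cong refl) (simp add: power_mult_distrib)
  show ?thesis
    using Cauchy_Schwarz_ineq_sum[of "\<lambda>x. sqrt (w x) * a x" "\<lambda>x. sqrt (w x) * b x" X]
    unfolding 1 2 .
qed

lemma square_sum_le:
  fixes a b e :: real
  assumes "0 < e"
  shows "(a + b)\<^sup>2 \<le> (1 + e) * a\<^sup>2 + (1 + 1 / e) * b\<^sup>2"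
proof -
  have "0 \<le> (e * a - b)\<^sup>2 / e" using assms by simp
  also have "\<dots> = (1 + e) * a\<^sup>2 + (1 + 1 / e) * b\<^sup>2 - (a + b)\<^sup>2"
    using assms by (simp add: field_simps power2_eq_square)
  finally show ?thesis by simp
qed

lemma wmean_square_dev:
  assumes "(\<Sum>x\<in>X. w x) \<noteq> 0"
  shows "(\<Sum>x\<in>X. w x * (f x - c)\<^sup>2) = (\<Sum>x\<in>X. w x) * (wvar X w f + (wmean X w f - c)\<^sup>2)"
proof -
  define Z m where "Z = (\<Sum>x\<in>X. w x)" and "m = wmean X w f"
  have Z: "Z \<noteq> 0" using assms by (simp add: Z_def)
  have m: "(\<Sum>x\<in>X. w x * f x) = m * Z" using Z by (simp add: m_def wmean_def Z_def)
  have v: "(\<Sum>x\<in>X. w x * (f x)\<^sup>2) = Z * (wvar X w f + m\<^sup>2)"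
    using Z by (simp add: wvar_altdef[OF assms] m_def[symmetric] wmean_def[of X w "\<lambda>x. (f x)\<^sup>2"] Z_def)
  have "(\<Sum>x\<in>X. w x * (f x - c)\<^sup>2) = (\<Sum>x\<in>X. w x * (f x)\<^sup>2 - 2 * c * (w x * f x) + c\<^sup>2 * w x)"
    by (intro sum.cong refl) (simp add: power2_eq_square algebra_simps)
  also have "\<dots> = (\<Sum>x\<in>X. w x * (f x)\<^sup>2) - 2 * c * (\<Sum>x\<in>X. w x * f x) + c\<^sup>2 * Z"
    by (simp only: sum.distrib sum_subtractf sum_distrib_left[symmetric] Z_def)
  also have "\<dots> = Z * (wvar X w f + (m - c)\<^sup>2)" unfolding m v by (simp add: power2_eq_square algebra_simps)
  finally show ?thesis by (simp add: Z_def m_def)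
qed

lemma wmean_dev:
  assumes "(\<Sum>x\<in>X. w x) \<noteq> 0"
  shows "(\<Sum>x\<in>X. w x * (f x - c)) = (\<Sum>x\<in>X. w x) * (wmean X w f - c)"
proof -
  have "(\<Sum>x\<in>X. w x * (f x - c)) = (\<Sum>x\<in>X. w x * f x) - (\<Sum>x\<in>X. w x) * c"
    by (simp only: right_diff_distrib sum_subtractf sum_distrib_right[symmetric])
  then show ?thesis using assms by (simp add: wmean_def right_diff_distrib)
qed

text \<open>
  Summed against \<open>w\<close> with \<open>r\<close> the mean of \<open>F\<close>, this bounds the squared Hellinger distance by
  the entropy.
\<close>

lemma hellinger_pointwise:
  fixes F r :: real
  assumes "0 \<le> F" "0 < r"
  shows "(sqrt F - sqrt r)\<^sup>2 \<le> F * ln (F / r) - F + r"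
proof (cases "F = 0")
  case False
  then have F: "0 < F" using assms by simp
  have "ln (sqrt (r / F)) \<le> sqrt (r / F) - 1" using F assms by (intro ln_le_minus_one) simp
  moreover have "ln (sqrt (r / F)) = - ln (F / r) / 2" using F assms by (simp add: ln_sqrt ln_div)
  ultimately have "2 * F * (1 - sqrt (r / F)) \<le> 2 * F * (ln (F / r) / 2)"
    using F by (intro mult_left_mono) auto
  moreover have "F * sqrt (r / F) = sqrt F * sqrt r"
    using arg_cong[OF real_div_sqrt[of F], of "\<lambda>y. y * sqrt r"] F by (simp add: real_sqrt_divide)
  ultimately have "2 * F - 2 * (sqrt F * sqrt r) \<le> F * ln (F / r)" by (simp add: algebra_simps)
  moreover have "(sqrt F - sqrt r)\<^sup>2 = F - 2 * (sqrt F * sqrt r) + r"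
    using F assms by (simp add: power2_diff)
  ultimately show ?thesis by simp
qed (use assms in simp)

lemma went_relative:
  assumes "finite X" "\<And>x. x \<in> X \<Longrightarrow> 0 < w x" "\<And>x. x \<in> X \<Longrightarrow> 0 \<le> F x" "0 < (\<Sum>x\<in>X. w x * F x)"
  defines "r \<equiv> (\<Sum>x\<in>X. w x * F x) / (\<Sum>x\<in>X. w x)"
  shows "went X w F = (\<Sum>x\<in>X. w x * (F x * ln (F x / r) - F x + r))" "0 < r"
proof -
  have "X \<noteq> {}" using assms(4) by auto
  then have Z: "0 < (\<Sum>x\<in>X. w x)" using assms by (intro sum_pos) auto
  then show r: "0 < r" using assms(4) by (simp add: r_def)
  have "(\<Sum>x\<in>X. w x * (F x * ln (F x / r) - F x + r)) = (\<Sum>x\<in>X. w x * (F x * ln (F x)) - (w x * F x) * ln r - w x * F x + w x * r)"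
  proof (rule sum.cong[OF refl])
    fix x assume "x \<in> X"
    then show "w x * (F x * ln (F x / r) - F x + r) = w x * (F x * ln (F x)) - (w x * F x) * ln r - w x * F x + w x * r"
      using assms(3)[of x] r by (cases "F x = 0") (auto simp: ln_div algebra_simps)
  qed
  also have "\<dots> = (\<Sum>x\<in>X. w x * (F x * ln (F x))) - (\<Sum>x\<in>X. w x * F x) * ln r - (\<Sum>x\<in>X. w x * F x) + (\<Sum>x\<in>X. w x) * r"
    by (simp only: sum.distrib sum_subtractf sum_distrib_right[symmetric])
  also have "\<dots> = went X w F" using Z by (simp add: went_def r_def)
  finally show "went X w F = (\<Sum>x\<in>X. w x * (F x * ln (F x / r) - F x + r))" by simp
qed

text \<open>
  A form of Pinsker's inequality: factor \<open>F - r = (sqrt F - sqrt r) (sqrt F + sqrt r)\<close>,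
  apply the Cauchy-Schwarz inequality and bound the Hellinger distance by the entropy. The
  factor 4 is not sharp; it enters only into error terms of higher order in the step length.
\<close>

lemma total_variation_entropy:
  assumes X: "finite X" and w: "\<And>x. x \<in> X \<Longrightarrow> 0 < w x" and F: "\<And>x. x \<in> X \<Longrightarrow> 0 \<le> F x"
    and U: "0 < (\<Sum>x\<in>X. w x * F x)"
  shows "(\<Sum>x\<in>X. \<bar>w x * F x / (\<Sum>x\<in>X. w x * F x) - w x / (\<Sum>x\<in>X. w x)\<bar>)\<^sup>2
    \<le> 4 * went X w F / (\<Sum>x\<in>X. w x * F x)"
proof -
  define U Z r where "U = (\<Sum>x\<in>X. w x * F x)" and "Z = (\<Sum>x\<in>X. w x)" and "r = U / Z"
  have "X \<noteq> {}" using U by auto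
  then have Z: "0 < Z" unfolding Z_def using X w by (intro sum_pos) auto
  have U0: "0 < U" using U by (simp add: U_def)
  have r: "0 < r" using U0 Z by (simp add: r_def)
  have 1: "\<bar>w x * F x / U - w x / Z\<bar> = w x * (\<bar>sqrt (F x) - sqrt r\<bar> * (sqrt (F x) + sqrt r)) / U" if "x \<in> X" for x
  proof -
    have "w x * F x / U - w x / Z = w x * (F x - r) / U" using U0 Z by (simp add: r_def field_simps)
    also have "F x - r = (sqrt (F x) - sqrt r) * (sqrt (F x) + sqrt r)"
      using F[OF that] r by (simp add: algebra_simps)
    finally show ?thesis using w[OF that] U0 F[OF that] r by (simp add: abs_mult)
  qed
  have "(\<Sum>x\<in>X. w x * (\<bar>sqrt (F x) - sqrt r\<bar> * (sqrt (F x) + sqrt r)))\<^sup>2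
    \<le> (\<Sum>x\<in>X. w x * \<bar>sqrt (F x) - sqrt r\<bar>\<^sup>2) * (\<Sum>x\<in>X. w x * (sqrt (F x) + sqrt r)\<^sup>2)"
    using w by (intro weighted_Cauchy_Schwarz) (auto simp: less_imp_le)
  also have "\<dots> \<le> went X w F * (4 * U)"
  proof (rule mult_mono)
    have "(\<Sum>x\<in>X. w x * \<bar>sqrt (F x) - sqrt r\<bar>\<^sup>2) \<le> (\<Sum>x\<in>X. w x * (F x * ln (F x / r) - F x + r))"
    proof (rule sum_mono)
      fix x assume "x \<in> X"
      then show "w x * \<bar>sqrt (F x) - sqrt r\<bar>\<^sup>2 \<le> w x * (F x * ln (F x / r) - F x + r)"
        unfolding power2_abs using w[of x] F[of x] r by (intro mult_left_mono hellinger_pointwise) auto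
    qed
    also have "\<dots> = went X w F"
      unfolding r_def U_def Z_def by (rule went_relative(1)[symmetric]) (use X w F U in auto)
    finally show "(\<Sum>x\<in>X. w x * \<bar>sqrt (F x) - sqrt r\<bar>\<^sup>2) \<le> went X w F" .
    have "(\<Sum>x\<in>X. w x * (sqrt (F x) + sqrt r)\<^sup>2) \<le> (\<Sum>x\<in>X. 2 * (w x * F x) + w x * (2 * r))"
    proof (rule sum_mono)
      fix x assume x: "x \<in> X"
      have "0 \<le> (sqrt (F x) - sqrt r)\<^sup>2" by simp
      then have "(sqrt (F x) + sqrt r)\<^sup>2 \<le> 2 * F x + 2 * r"
        using F[OF x] r by (simp add: power2_sum power2_diff)
      then have "w x * (sqrt (F x) + sqrt r)\<^sup>2 \<le> w x * (2 * F x + 2 * r)"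
        using w[OF x] by (intro mult_left_mono) auto
      then show "w x * (sqrt (F x) + sqrt r)\<^sup>2 \<le> 2 * (w x * F x) + w x * (2 * r)" by (simp add: algebra_simps)
    qed
    also have "\<dots> = 2 * U + Z * (2 * r)"
      by (simp only: sum.distrib sum_distrib_left[symmetric] sum_distrib_right[symmetric] U_def Z_def)
    also have "\<dots> = 4 * U" using Z by (simp add: r_def)
    finally show "(\<Sum>x\<in>X. w x * (sqrt (F x) + sqrt r)\<^sup>2) \<le> 4 * U" .
    show "0 \<le> went X w F" using X w F by (intro went_nonneg) auto
    show "0 \<le> (\<Sum>x\<in>X. w x * (sqrt (F x) + sqrt r)\<^sup>2)"
      using w by (intro sum_nonneg mult_nonneg_nonneg) (auto simp: less_imp_le)
  qed
  finally have 2: "(\<Sum>x\<in>X. w x * (\<bar>sqrt (F x) - sqrt r\<bar> * (sqrt (F x) + sqrt r)))\<^sup>2 \<le> went X w F * (4 * U)" .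
  have "(\<Sum>x\<in>X. \<bar>w x * F x / U - w x / Z\<bar>) = (\<Sum>x\<in>X. w x * (\<bar>sqrt (F x) - sqrt r\<bar> * (sqrt (F x) + sqrt r))) / U"
    unfolding sum_divide_distrib by (intro sum.cong refl 1)
  then have "(\<Sum>x\<in>X. \<bar>w x * F x / U - w x / Z\<bar>)\<^sup>2 \<le> went X w F * (4 * U) / U\<^sup>2"
    using 2 U0 by (simp add: power_divide divide_right_mono)
  also have "\<dots> = 4 * went X w F / U" using U0 by (simp add: power2_eq_square)
  finally show ?thesis by (simp add: U_def Z_def)
qed

text \<open>
  The variance of the tilted weight is the second derivative of the log-Laplace transform,
  so a uniform bound \<open>v\<close> can be integrated twice.
\<close>

lemma log_laplace_le_quadratic:
  fixes w \<phi> :: "'x \<Rightarrow> real"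
  assumes X: "finite X" "X \<noteq> {}" and w: "\<And>x. x \<in> X \<Longrightarrow> 0 < w x"
    and var: "\<And>t. wvar X (\<lambda>x. w x * exp (t * \<phi> x)) \<phi> \<le> v" and s: "0 \<le> s"
  shows "ln (\<Sum>x\<in>X. w x * exp (s * \<phi> x)) \<le> ln (\<Sum>x\<in>X. w x) + s * wmean X w \<phi> + v * s\<^sup>2 / 2"
proof -
  define L where "L t = ln (\<Sum>x\<in>X. w x * exp (t * \<phi> x))" for t
  define M where "M t = wmean X (\<lambda>x. w x * exp (t * \<phi> x)) \<phi>" for t
  have dL: "(L has_real_derivative M t) (at t)" for t
    unfolding L_def[abs_def] M_def by (rule log_laplace_derivatives(1)[OF X w])
  have dM: "(M has_real_derivative wvar X (\<lambda>x. w x * exp (t * \<phi> x)) \<phi>) (at t)" for t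
    unfolding M_def[abs_def] by (rule log_laplace_derivatives(2)[OF X w])
  have M: "M t \<le> M 0 + v * t" if "0 \<le> t" for t
  proof -
    have "(\<lambda>t. v * t - M t) 0 \<le> (\<lambda>t. v * t - M t) t"
    proof (rule DERIV_nonneg_imp_nondecreasing[OF that])
      fix z :: real
      have "((\<lambda>t. v * t - M t) has_real_derivative v - wvar X (\<lambda>x. w x * exp (z * \<phi> x)) \<phi>) (at z)"
        by (auto intro!: derivative_eq_intros dM)
      then show "\<exists>y. ((\<lambda>t. v * t - M t) has_real_derivative y) (at z) \<and> 0 \<le> y"
        using var[of z] by auto
    qed
    then show ?thesis by simp
  qed
  have "(\<lambda>t. M 0 * t + v * t\<^sup>2 / 2 - L t) 0 \<le> (\<lambda>t. M 0 * t + v * t\<^sup>2 / 2 - L t) s"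
  proof (rule DERIV_nonneg_imp_nondecreasing[OF s])
    fix z :: real assume z: "0 \<le> z"
    have "((\<lambda>t. M 0 * t + v * t\<^sup>2 / 2 - L t) has_real_derivative M 0 + v * z - M z) (at z)"
      by (auto intro!: derivative_eq_intros dL)
    then show "\<exists>y. ((\<lambda>t. M 0 * t + v * t\<^sup>2 / 2 - L t) has_real_derivative y) (at z) \<and> 0 \<le> y"
      using M[OF z] by auto
  qed
  then show ?thesis by (simp add: L_def M_def mult.commute)
qed

section \<open>Random exponential tilts\<close>

text \<open>
  The functions \<open>g a\<close> are the features of a state, and the vectors \<open>s t\<close>, with \<open>t\<close> uniform
  in \<open>T\<close>, are the steps of a random walk in the space of fields: \<open>centred\<close> and \<open>isotropic\<close>
  say that a step has mean zero and covariance the identity. The constant \<open>R\<close> bounds the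
  effect of a step of unit length on the logarithm of a weight.
\<close>

locale tilted_family =
  fixes X :: "'x set" and I :: "'a set" and g :: "'a \<Rightarrow> 'x \<Rightarrow> real"
    and T :: "'c set" and s :: "'c \<Rightarrow> 'a \<Rightarrow> real" and R :: real
  assumes finX: "finite X" and neX: "X \<noteq> {}" and finI: "finite I" and finT: "finite T" and neT: "T \<noteq> {}"
    and centred: "\<And>a. a \<in> I \<Longrightarrow> (\<Sum>t\<in>T. s t a) = 0"
    and isotropic: "\<And>a b. a \<in> I \<Longrightarrow> b \<in> I \<Longrightarrow> (\<Sum>t\<in>T. s t a * s t b) = (if a = b then real (card T) else 0)"
    and R: "0 < R"
    and bound: "\<And>t x. t \<in> T \<Longrightarrow> x \<in> X \<Longrightarrow> \<bar>\<Sum>a\<in>I. s t a * g a x\<bar> \<le> R"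
begin

definition lin :: "('a \<Rightarrow> real) \<Rightarrow> 'x \<Rightarrow> real" where
  "lin u x = (\<Sum>a\<in>I. u a * g a x)"

definition sq :: "('a \<Rightarrow> real) \<Rightarrow> real" where
  "sq u = (\<Sum>a\<in>I. (u a)\<^sup>2)"

text \<open>
  The mean factor by which one random step of length \<open>\<epsilon>\<close> changes the weight of \<open>x\<close>.
\<close>

definition step_factor :: "real \<Rightarrow> 'x \<Rightarrow> real" where
  "step_factor \<epsilon> x = (\<Sum>t\<in>T. exp (\<epsilon> * lin (s t) x)) / card T"

lemma cardT: "0 < real (card T)"
  using finT neT by (simp add: card_gt_0_iff)

lemma bound': "t \<in> T \<Longrightarrow> x \<in> X \<Longrightarrow> \<bar>lin (s t) x\<bar> \<le> R"
  using bound by (simp add: lin_def)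

lemma sq_nonneg: "0 \<le> sq u"
  by (simp add: sq_def sum_nonneg)

lemma lin_add: "lin (\<lambda>a. u a + c * v a) x = lin u x + c * lin v x"
  by (simp add: lin_def sum.distrib distrib_right sum_distrib_left mult.assoc)

lemma functional_lin: "(\<Sum>x\<in>X. m x * lin u x) = (\<Sum>a\<in>I. u a * (\<Sum>x\<in>X. m x * g a x))"
proof -
  have "(\<Sum>x\<in>X. m x * lin u x) = (\<Sum>x\<in>X. \<Sum>a\<in>I. u a * (m x * g a x))"
    by (simp add: lin_def sum_distrib_left mult.left_commute)
  also have "\<dots> = (\<Sum>a\<in>I. \<Sum>x\<in>X. u a * (m x * g a x))" by (rule sum.swap)
  finally show ?thesis by (simp add: sum_distrib_left)
qed

lemma sum_lin_zero: "(\<Sum>t\<in>T. lin (s t) x) = 0"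
proof -
  have "(\<Sum>t\<in>T. lin (s t) x) = (\<Sum>a\<in>I. \<Sum>t\<in>T. s t a * g a x)"
    unfolding lin_def by (rule sum.swap)
  also have "\<dots> = 0" using centred by (simp add: sum_distrib_right[symmetric])
  finally show ?thesis .
qed

text \<open>
  Isotropy of the steps: the mean square of a linear functional of the step is the squared
  norm of the functional.
\<close>

lemma isotropic_functional:
  "(\<Sum>t\<in>T. (\<Sum>x\<in>X. m x * lin (s t) x)\<^sup>2) = real (card T) * sq (\<lambda>a. \<Sum>x\<in>X. m x * g a x)"
proof -
  define v where "v a = (\<Sum>x\<in>X. m x * g a x)" for a
  have "(\<Sum>t\<in>T. (\<Sum>x\<in>X. m x * lin (s t) x)\<^sup>2) = (\<Sum>t\<in>T. \<Sum>a\<in>I. \<Sum>b\<in>I. v a * v b * (s t a * s t b))"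
    unfolding functional_lin v_def[symmetric] power2_eq_square sum_product
    by (intro sum.cong refl) (simp add: algebra_simps)
  also have "\<dots> = (\<Sum>a\<in>I. \<Sum>t\<in>T. \<Sum>b\<in>I. v a * v b * (s t a * s t b))" by (rule sum.swap)
  also have "\<dots> = (\<Sum>a\<in>I. \<Sum>b\<in>I. \<Sum>t\<in>T. v a * v b * (s t a * s t b))"
    by (intro sum.cong refl sum.swap)
  also have "\<dots> = (\<Sum>a\<in>I. \<Sum>b\<in>I. if a = b then v a * v b * real (card T) else 0)"
    by (intro sum.cong refl) (simp add: sum_distrib_left[symmetric] isotropic)
  also have "\<dots> = (\<Sum>a\<in>I. v a * v a * real (card T))"
    by (intro sum.cong refl) (use finI in \<open>simp add: sum.delta\<close>)
  also have "\<dots> = real (card T) * sq v"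
    by (simp add: sq_def power2_eq_square sum_distrib_left algebra_simps)
  finally show ?thesis by (simp add: v_def[abs_def])
qed

lemma exp_lin_bounds:
  assumes e: "0 < \<epsilon>" "\<epsilon> * R \<le> 1" and t: "t \<in> T" "x \<in> X"
  shows "\<bar>exp (\<epsilon> * lin (s t) x) - 1 - \<epsilon> * lin (s t) x\<bar> \<le> \<epsilon>\<^sup>2 * R\<^sup>2" "1 - \<epsilon> * R \<le> exp (\<epsilon> * lin (s t) x)"
    "\<bar>\<epsilon> * lin (s t) x\<bar> \<le> \<epsilon> * R"
proof -
  have b: "\<bar>\<epsilon> * lin (s t) x\<bar> \<le> \<epsilon> * R"
    using bound'[OF t] e by (simp add: abs_mult mult_left_mono)
  then show "\<bar>\<epsilon> * lin (s t) x\<bar> \<le> \<epsilon> * R" .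
  have "\<bar>exp (\<epsilon> * lin (s t) x) - 1 - \<epsilon> * lin (s t) x\<bar> \<le> (\<epsilon> * lin (s t) x)\<^sup>2"
    using b e by (intro abs_exp_minus_linear_le) linarith
  also have "\<dots> \<le> (\<epsilon> * R)\<^sup>2" using b by (metis abs_ge_zero power2_abs power_mono)
  finally show "\<bar>exp (\<epsilon> * lin (s t) x) - 1 - \<epsilon> * lin (s t) x\<bar> \<le> \<epsilon>\<^sup>2 * R\<^sup>2" by (simp add: power_mult_distrib)
  show "1 - \<epsilon> * R \<le> exp (\<epsilon> * lin (s t) x)"
    using exp_ge_add_one_self[of "\<epsilon> * lin (s t) x"] b by linarith
qed

text \<open>
  As the steps are centred, the first-order term averages out.
\<close>

lemma step_factor_bounds:
  assumes e: "0 < \<epsilon>" "\<epsilon> * R \<le> 1" and x: "x \<in> X"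
  shows "1 \<le> step_factor \<epsilon> x" "step_factor \<epsilon> x \<le> 1 + \<epsilon>\<^sup>2 * R\<^sup>2"
proof -
  have z: "(\<Sum>t\<in>T. 1 + \<epsilon> * lin (s t) x) = card T"
    by (simp add: sum.distrib sum_distrib_left[symmetric] sum_lin_zero)
  have "(\<Sum>t\<in>T. 1 + \<epsilon> * lin (s t) x) \<le> (\<Sum>t\<in>T. exp (\<epsilon> * lin (s t) x))"
    by (intro sum_mono exp_ge_add_one_self)
  then show "1 \<le> step_factor \<epsilon> x" unfolding z step_factor_def using cardT by (simp add: le_divide_eq)
  have "(\<Sum>t\<in>T. exp (\<epsilon> * lin (s t) x)) \<le> (\<Sum>t\<in>T. (1 + \<epsilon> * lin (s t) x) + \<epsilon>\<^sup>2 * R\<^sup>2)"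
  proof (rule sum_mono)
    fix t assume "t \<in> T"
    from exp_lin_bounds(1)[OF e this x] show "exp (\<epsilon> * lin (s t) x) \<le> (1 + \<epsilon> * lin (s t) x) + \<epsilon>\<^sup>2 * R\<^sup>2" by linarith
  qed
  also have "\<dots> = card T * (1 + \<epsilon>\<^sup>2 * R\<^sup>2)"
    unfolding sum.distrib[of "\<lambda>t. 1 + \<epsilon> * lin (s t) x"] z by (simp add: algebra_simps)
  finally show "step_factor \<epsilon> x \<le> 1 + \<epsilon>\<^sup>2 * R\<^sup>2" unfolding step_factor_def using cardT by (simp add: divide_le_eq mult.commute)
qed

text \<open>
  Let \<open>v\<close> be the change of the mean feature vector when the law is biased by \<open>F\<close>. The
  variance bound for all tilts makes \<open>\<langle>v, g\<rangle>\<close> sub-Gaussian with variance proxy \<open>c |v|\<^sup>2\<close>, and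
  \<open>gibbs_variational\<close> with the test function \<open>\<langle>v, g\<rangle> / c\<close> bounds \<open>|v|\<^sup>2\<close> by the relative
  entropy.
\<close>

lemma entropic_stability:
  assumes w: "\<And>x. x \<in> X \<Longrightarrow> 0 < w x" and F: "\<And>x. x \<in> X \<Longrightarrow> 0 \<le> F x" and c: "0 < c"
    and var: "\<And>u t. wvar X (\<lambda>x. w x * exp (t * lin u x)) (lin u) \<le> c * sq u"
    and U: "0 < (\<Sum>x\<in>X. w x * F x)"
  shows "sq (\<lambda>a. \<Sum>x\<in>X. (w x * F x / (\<Sum>x\<in>X. w x * F x) - w x / (\<Sum>x\<in>X. w x)) * g a x)
    \<le> 2 * c * (went X w F / (\<Sum>x\<in>X. w x * F x))"
proof -
  define U Z where "U = (\<Sum>x\<in>X. w x * F x)" and "Z = (\<Sum>x\<in>X. w x)"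
  define m where "m x = w x * F x / U - w x / Z" for x
  define v where "v a = (\<Sum>x\<in>X. m x * g a x)" for a
  have U0: "0 < U" using U by (simp add: U_def)
  have Z0: "0 < Z" unfolding Z_def using finX neX w by (intro sum_pos) auto
  have q: "(\<Sum>x\<in>X. m x * lin v x) = sq v"
    by (simp add: functional_lin v_def[symmetric] sq_def power2_eq_square)
  have L: "ln (\<Sum>x\<in>X. w x * exp (1 / c * lin v x)) \<le> ln Z + 1 / c * wmean X w (lin v) + c * sq v * (1 / c)\<^sup>2 / 2"
    unfolding Z_def using c var by (intro log_laplace_le_quadratic[OF finX neX w]) auto
  have "(\<Sum>x\<in>X. w x * F x * ln (exp (1 / c * lin v x))) \<le> went X w F + U * ln ((\<Sum>x\<in>X. w x * exp (1 / c * lin v x)) / Z)"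
    unfolding U_def Z_def by (rule gibbs_variational[OF finX w F]) auto
  also have "ln ((\<Sum>x\<in>X. w x * exp (1 / c * lin v x)) / Z) = ln (\<Sum>x\<in>X. w x * exp (1 / c * lin v x)) - ln Z"
    using Z0 w finX neX by (intro ln_divide_pos sum_pos) auto
  also have "went X w F + U * \<dots> \<le> went X w F + U * (1 / c * wmean X w (lin v) + c * sq v * (1 / c)\<^sup>2 / 2)"
    using L U0 by (intro add_left_mono mult_left_mono) auto
  finally have 1: "(\<Sum>x\<in>X. w x * F x * (1 / c * lin v x)) \<le> went X w F + U * (1 / c * wmean X w (lin v) + sq v / c / 2)"
    using c by (simp add: power2_eq_square)
  have "(\<Sum>x\<in>X. w x * F x * (1 / c * lin v x)) = U / c * (\<Sum>x\<in>X. w x * F x / U * lin v x)"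
    using U0 by (simp add: sum_distrib_left)
  moreover have "wmean X w (lin v) = (\<Sum>x\<in>X. w x / Z * lin v x)"
    by (simp add: wmean_def Z_def sum_divide_distrib)
  ultimately have "U / c * (\<Sum>x\<in>X. w x * F x / U * lin v x) - U / c * (\<Sum>x\<in>X. w x / Z * lin v x) \<le> went X w F + U / c * sq v / 2"
    using 1 by (simp add: algebra_simps)
  then have 2: "U / c * ((\<Sum>x\<in>X. w x * F x / U * lin v x) - (\<Sum>x\<in>X. w x / Z * lin v x)) \<le> went X w F + U / c * sq v / 2"
    unfolding right_diff_distrib .
  have 3: "(\<Sum>x\<in>X. w x * F x / U * lin v x) - (\<Sum>x\<in>X. w x / Z * lin v x) = sq v"
    unfolding q[symmetric] by (simp add: m_def sum_subtractf[symmetric] left_diff_distrib)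
  from 2 have "U / c * sq v \<le> went X w F + U / c * sq v / 2" unfolding 3 .
  then have "sq v * (U / (2 * c)) \<le> went X w F" by (simp add: field_simps)
  then have "sq v \<le> 2 * c * (went X w F / U)" using U0 c by (simp add: field_simps)
  then show ?thesis by (simp add: v_def[abs_def] m_def U_def Z_def)
qed

text \<open>
  The law of total variance for the mixture over the steps. The mean of the conditional
  variances is at most \<open>c |u|\<^sup>2\<close>. To leading order a step \<open>t\<close> shifts the mean of \<open>lin u\<close> by
  \<open>\<epsilon>\<close> times its covariance with \<open>lin (s t)\<close>; by isotropy the mean square of these
  covariances is the squared norm of the covariance of \<open>lin u\<close> with the features, which is
  at most \<open>c\<^sup>2 |u|\<^sup>2\<close> by the Cauchy-Schwarz inequality. So \<open>c\<close> becomes \<open>c + \<epsilon>\<^sup>2 c\<^sup>2\<close>, up to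
  errors of higher order.
\<close>

lemma variance_step:
  assumes w: "\<And>x. x \<in> X \<Longrightarrow> 0 < w x" and c: "0 < c"
    and var0: "\<And>u. wvar X w (lin u) \<le> c * sq u"
    and var: "\<And>t u. t \<in> T \<Longrightarrow> wvar X (\<lambda>x. w x * exp (\<epsilon> * lin (s t) x)) (lin u) \<le> c * sq u"
    and e: "0 < \<epsilon>" "\<epsilon> * R < 1"
  shows "wvar X (\<lambda>x. w x * step_factor \<epsilon> x) (lin u)
    \<le> (c + (1 + \<epsilon>) * \<epsilon>\<^sup>2 * (c\<^sup>2 + c * \<epsilon> * R ^ 4) / (1 - \<epsilon> * R)) * sq u"
proof -
  define \<phi> m where "\<phi> = lin u" and "m = wmean X w \<phi>"
  define wt where "wt t x = w x * exp (\<epsilon> * lin (s t) x)" for t x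
  define w' where "w' x = w x * step_factor \<epsilon> x" for x
  define Z Z' Zt where "Z = (\<Sum>x\<in>X. w x)" and "Z' = (\<Sum>x\<in>X. w' x)" and "Zt t = (\<Sum>x\<in>X. wt t x)" for t
  have e': "\<epsilon> * R \<le> 1" using e by simp
  have w'_eq: "w' x = (\<Sum>t\<in>T. wt t x) / card T" for x
    by (simp add: w'_def wt_def step_factor_def sum_distrib_left)
  have Z: "0 < Z" unfolding Z_def using finX neX w by (intro sum_pos) auto
  have ZZ': "Z \<le> Z'" unfolding Z_def Z'_def w'_def
  proof (rule sum_mono)
    fix x assume "x \<in> X"
    then show "w x \<le> w x * step_factor \<epsilon> x"
      using mult_left_mono[OF step_factor_bounds(1)[OF e(1) e', of x], of "w x"] w[of x] by simp
  qed
  have Zt: "(1 - \<epsilon> * R) * Z \<le> Zt t" if "t \<in> T" for t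
    unfolding Z_def Zt_def sum_distrib_left wt_def
  proof (rule sum_mono)
    fix x assume "x \<in> X"
    then show "(1 - \<epsilon> * R) * w x \<le> w x * exp (\<epsilon> * lin (s t) x)"
      using mult_left_mono[OF exp_lin_bounds(2)[OF e(1) e' that, of x], of "w x"] w[of x] by (simp add: mult.commute)
  qed
  have Ztpos: "0 < Zt t" for t unfolding Zt_def wt_def using finX neX w by (intro sum_pos) auto
  have Z'_eq: "Z' = (\<Sum>t\<in>T. Zt t) / card T"
    unfolding Z'_def w'_eq Zt_def sum_divide_distrib by (rule sum.swap)
  \<comment> \<open>\<open>N t / Zt t\<close> is the shift of the mean by step \<open>t\<close>; \<open>C t\<close> is its leading part, a
    covariance, and \<open>E t\<close> collects the error.\<close>
  define N where "N t = (\<Sum>x\<in>X. wt t x * (\<phi> x - m))" for t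
  define C where "C t = (\<Sum>x\<in>X. w x * (\<phi> x - m) / Z * lin (s t) x)" for t
  define E where "E t = (\<Sum>x\<in>X. w x * (\<phi> x - m) / Z * (exp (\<epsilon> * lin (s t) x) - 1 - \<epsilon> * lin (s t) x))" for t
  have m0: "(\<Sum>x\<in>X. w x * (\<phi> x - m)) = 0"
    using wmean_dev[of w X \<phi> m] Z by (simp add: m_def Z_def)
  have N: "N t / Z = \<epsilon> * C t + E t" for t
  proof -
    have "N t / Z = (\<Sum>x\<in>X. w x * (\<phi> x - m) / Z + \<epsilon> * (w x * (\<phi> x - m) / Z * lin (s t) x)
        + w x * (\<phi> x - m) / Z * (exp (\<epsilon> * lin (s t) x) - 1 - \<epsilon> * lin (s t) x))"
      unfolding N_def wt_def sum_divide_distrib using Z by (intro sum.cong refl) (simp add: field_simps)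
    also have "\<dots> = (\<Sum>x\<in>X. w x * (\<phi> x - m)) / Z + \<epsilon> * C t + E t"
      by (simp only: sum.distrib sum_distrib_left[symmetric] sum_divide_distrib[symmetric] C_def E_def)
    finally show ?thesis by (simp add: m0)
  qed
  have var\<phi>: "(\<Sum>x\<in>X. w x * (\<phi> x - m)\<^sup>2) = Z * wvar X w \<phi>"
    using wmean_square_dev[of w X \<phi> m] Z by (simp add: Z_def m_def)
  have var\<phi>_le: "wvar X w \<phi> \<le> c * sq u" unfolding \<phi>_def by (rule var0)
  have E: "(E t)\<^sup>2 \<le> c * sq u * (\<epsilon>\<^sup>2 * R\<^sup>2)\<^sup>2" if t: "t \<in> T" for t
  proof -
    define \<zeta> where "\<zeta> x = exp (\<epsilon> * lin (s t) x) - 1 - \<epsilon> * lin (s t) x" for x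
    have "(\<Sum>x\<in>X. w x * ((\<phi> x - m) * \<zeta> x))\<^sup>2 \<le> (\<Sum>x\<in>X. w x * (\<phi> x - m)\<^sup>2) * (\<Sum>x\<in>X. w x * (\<zeta> x)\<^sup>2)"
      using w by (intro weighted_Cauchy_Schwarz) (simp add: less_imp_le)
    also have "\<dots> \<le> (Z * (c * sq u)) * (\<Sum>x\<in>X. w x * (\<epsilon>\<^sup>2 * R\<^sup>2)\<^sup>2)"
    proof (rule mult_mono)
      show "(\<Sum>x\<in>X. w x * (\<phi> x - m)\<^sup>2) \<le> Z * (c * sq u)" unfolding var\<phi> using Z var\<phi>_le by simp
      show "(\<Sum>x\<in>X. w x * (\<zeta> x)\<^sup>2) \<le> (\<Sum>x\<in>X. w x * (\<epsilon>\<^sup>2 * R\<^sup>2)\<^sup>2)"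
      proof (intro sum_mono mult_left_mono)
        fix x assume x: "x \<in> X"
        show "(\<zeta> x)\<^sup>2 \<le> (\<epsilon>\<^sup>2 * R\<^sup>2)\<^sup>2"
          using exp_lin_bounds(1)[OF e(1) e' t x] unfolding \<zeta>_def
          by (metis abs_ge_zero power2_abs power_mono)
        show "0 \<le> w x" using w[OF x] by simp
      qed
      show "0 \<le> Z * (c * sq u)" using Z c sq_nonneg by simp
      show "0 \<le> (\<Sum>x\<in>X. w x * (\<zeta> x)\<^sup>2)" using w by (intro sum_nonneg) (simp add: less_imp_le)
    qed
    also have "\<dots> = Z\<^sup>2 * (c * sq u * (\<epsilon>\<^sup>2 * R\<^sup>2)\<^sup>2)"
      by (simp add: sum_distrib_right[symmetric] Z_def[symmetric] power2_eq_square)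
    finally have "(\<Sum>x\<in>X. w x * ((\<phi> x - m) * \<zeta> x))\<^sup>2 / Z\<^sup>2 \<le> c * sq u * (\<epsilon>\<^sup>2 * R\<^sup>2)\<^sup>2"
      using Z by (simp add: divide_le_eq mult.commute)
    moreover have "E t = (\<Sum>x\<in>X. w x * ((\<phi> x - m) * \<zeta> x)) / Z"
      by (simp add: E_def \<zeta>_def[symmetric] sum_divide_distrib mult.assoc)
    ultimately show ?thesis by (simp add: power_divide)
  qed
  have C: "(\<Sum>t\<in>T. (C t)\<^sup>2) \<le> card T * (c\<^sup>2 * sq u)"
  proof -
    define v where "v a = (\<Sum>x\<in>X. w x * (\<phi> x - m) / Z * g a x)" for a
    have eq: "(\<Sum>t\<in>T. (C t)\<^sup>2) = card T * sq v"
      unfolding C_def isotropic_functional v_def[abs_def] ..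
    define mv where "mv = wmean X w (lin v)"
    have "sq v = (\<Sum>x\<in>X. w x * (\<phi> x - m) / Z * lin v x)"
      unfolding functional_lin v_def[symmetric] by (simp add: sq_def power2_eq_square)
    also have "\<dots> = (\<Sum>x\<in>X. w x * ((\<phi> x - m) * (lin v x - mv)) / Z + w x * (\<phi> x - m) * (mv / Z))"
      using Z by (intro sum.cong refl) (simp add: field_simps)
    also have "\<dots> = (\<Sum>x\<in>X. w x * ((\<phi> x - m) * (lin v x - mv))) / Z"
      unfolding sum.distrib sum_distrib_right[symmetric] m0 by (simp add: sum_divide_distrib)
    finally have "(sq v)\<^sup>2 = (\<Sum>x\<in>X. w x * ((\<phi> x - m) * (lin v x - mv)))\<^sup>2 / Z\<^sup>2" by (simp add: power_divide)
    also have "\<dots> \<le> ((\<Sum>x\<in>X. w x * (\<phi> x - m)\<^sup>2) * (\<Sum>x\<in>X. w x * (lin v x - mv)\<^sup>2)) / Z\<^sup>2"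
      using w by (intro divide_right_mono weighted_Cauchy_Schwarz) (simp_all add: less_imp_le)
    also have "(\<Sum>x\<in>X. w x * (lin v x - mv)\<^sup>2) = Z * wvar X w (lin v)"
      using wmean_square_dev[of w X "lin v" mv] Z by (simp add: Z_def mv_def)
    also have "(\<Sum>x\<in>X. w x * (\<phi> x - m)\<^sup>2) * (Z * wvar X w (lin v)) / Z\<^sup>2 = wvar X w \<phi> * wvar X w (lin v)"
      unfolding var\<phi> using Z by (simp add: power2_eq_square)
    also have "\<dots> \<le> (c * sq u) * (c * sq v)"
    proof (rule mult_mono[OF var\<phi>_le var0])
      show "0 \<le> c * sq u" using c sq_nonneg by simp
      show "0 \<le> wvar X w (lin v)" unfolding wvar_def wmean_def
        using w by (intro divide_nonneg_nonneg sum_nonneg) (simp_all add: less_imp_le)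
    qed
    finally have "sq v * sq v \<le> (c\<^sup>2 * sq u) * sq v" by (simp add: power2_eq_square algebra_simps)
    then have "sq v \<le> c\<^sup>2 * sq u"
      using sq_nonneg[of v] sq_nonneg[of u] c by (cases "sq v = 0") (auto simp: mult_le_cancel_right)
    then show ?thesis unfolding eq using cardT by simp
  qed
  have aux: "n\<^sup>2 / (q * Z) = Z / q * (n / Z)\<^sup>2" for n q
    using Z by (cases "q = 0") (simp_all add: power2_eq_square)
  have NZ: "(N t)\<^sup>2 / Zt t \<le> Z / (1 - \<epsilon> * R) * ((1 + \<epsilon>) * \<epsilon>\<^sup>2 * (C t)\<^sup>2 + (1 + 1 / \<epsilon>) * (c * sq u * (\<epsilon>\<^sup>2 * R\<^sup>2)\<^sup>2))"
    if t: "t \<in> T" for t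
  proof -
    have "(N t)\<^sup>2 / Zt t \<le> (N t)\<^sup>2 / ((1 - \<epsilon> * R) * Z)"
      using Zt[OF t] Z e by (intro divide_left_mono) (auto intro!: mult_pos_pos Ztpos)
    also have "\<dots> = Z / (1 - \<epsilon> * R) * (\<epsilon> * C t + E t)\<^sup>2"
      unfolding N[symmetric] by (rule aux)
    also have "\<dots> \<le> Z / (1 - \<epsilon> * R) * ((1 + \<epsilon>) * \<epsilon>\<^sup>2 * (C t)\<^sup>2 + (1 + 1 / \<epsilon>) * (c * sq u * (\<epsilon>\<^sup>2 * R\<^sup>2)\<^sup>2))"
    proof (rule mult_left_mono)
      have "(\<epsilon> * C t + E t)\<^sup>2 \<le> (1 + \<epsilon>) * (\<epsilon> * C t)\<^sup>2 + (1 + 1 / \<epsilon>) * (E t)\<^sup>2"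
        by (rule square_sum_le[OF e(1)])
      also have "\<dots> \<le> (1 + \<epsilon>) * (\<epsilon> * C t)\<^sup>2 + (1 + 1 / \<epsilon>) * (c * sq u * (\<epsilon>\<^sup>2 * R\<^sup>2)\<^sup>2)"
        using E[OF t] e by (intro add_left_mono mult_left_mono) auto
      finally show "(\<epsilon> * C t + E t)\<^sup>2 \<le> (1 + \<epsilon>) * \<epsilon>\<^sup>2 * (C t)\<^sup>2 + (1 + 1 / \<epsilon>) * (c * sq u * (\<epsilon>\<^sup>2 * R\<^sup>2)\<^sup>2)"
        by (simp only: power_mult_distrib mult.assoc)
    qed (use Z e in simp)
    finally show ?thesis .
  qed
  have "Z' * wvar X w' \<phi> \<le> (\<Sum>x\<in>X. w' x * (\<phi> x - m)\<^sup>2)"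
    using wmean_square_dev[of w' X \<phi> m] Z ZZ' by (simp add: Z'_def[symmetric] algebra_simps)
  also have "\<dots> = (\<Sum>t\<in>T. \<Sum>x\<in>X. wt t x * (\<phi> x - m)\<^sup>2) / card T"
    unfolding w'_eq by (simp add: sum_divide_distrib[symmetric] sum_distrib_right sum.swap[of _ T X])
  also have "(\<Sum>t\<in>T. \<Sum>x\<in>X. wt t x * (\<phi> x - m)\<^sup>2) \<le> (\<Sum>t\<in>T. Zt t * (c * sq u) + (N t)\<^sup>2 / Zt t)"
  proof (rule sum_mono)
    fix t assume t: "t \<in> T"
    have mt: "wmean X (wt t) \<phi> - m = N t / Zt t"
      using wmean_dev[of "wt t" X \<phi> m] Ztpos[of t] by (simp add: N_def Zt_def)
    have "(\<Sum>x\<in>X. wt t x * (\<phi> x - m)\<^sup>2) = Zt t * (wvar X (wt t) \<phi> + (wmean X (wt t) \<phi> - m)\<^sup>2)"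
      unfolding Zt_def using Ztpos[of t] by (intro wmean_square_dev) (simp add: Zt_def)
    also have "\<dots> = Zt t * wvar X (wt t) \<phi> + (N t)\<^sup>2 / Zt t"
      unfolding mt using Ztpos[of t] by (simp add: power2_eq_square field_simps)
    also have "\<dots> \<le> Zt t * (c * sq u) + (N t)\<^sup>2 / Zt t"
      using var[OF t, of u] Ztpos[of t] by (simp add: wt_def[abs_def] \<phi>_def)
    finally show "(\<Sum>x\<in>X. wt t x * (\<phi> x - m)\<^sup>2) \<le> Zt t * (c * sq u) + (N t)\<^sup>2 / Zt t" .
  qed
  also have "\<dots> \<le> (\<Sum>t\<in>T. Zt t * (c * sq u) + Z / (1 - \<epsilon> * R) * ((1 + \<epsilon>) * \<epsilon>\<^sup>2 * (C t)\<^sup>2 + (1 + 1 / \<epsilon>) * (c * sq u * (\<epsilon>\<^sup>2 * R\<^sup>2)\<^sup>2)))"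
    using NZ by (intro sum_mono add_left_mono) auto
  also have "\<dots> = (\<Sum>t\<in>T. Zt t) * (c * sq u) + Z / (1 - \<epsilon> * R) * ((1 + \<epsilon>) * \<epsilon>\<^sup>2 * (\<Sum>t\<in>T. (C t)\<^sup>2)
      + card T * ((1 + 1 / \<epsilon>) * (c * sq u * (\<epsilon>\<^sup>2 * R\<^sup>2)\<^sup>2)))"
    unfolding sum.distrib sum_distrib_left[symmetric] sum_distrib_right[symmetric] sum_constant by (simp only: mult.left_commute)
  also have "\<dots> \<le> (\<Sum>t\<in>T. Zt t) * (c * sq u) + Z / (1 - \<epsilon> * R) * ((1 + \<epsilon>) * \<epsilon>\<^sup>2 * (card T * (c\<^sup>2 * sq u))
      + card T * ((1 + 1 / \<epsilon>) * (c * sq u * (\<epsilon>\<^sup>2 * R\<^sup>2)\<^sup>2)))"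
    using C Z e by (intro add_left_mono mult_left_mono add_right_mono) auto
  also have "\<dots> = card T * (Z' * (c * sq u) + Z / (1 - \<epsilon> * R) * ((1 + \<epsilon>) * \<epsilon>\<^sup>2 * (c\<^sup>2 + c * \<epsilon> * R ^ 4)) * sq u)"
  proof -
    have e1: "(1 + 1 / \<epsilon>) * (c * sq u * (\<epsilon>\<^sup>2 * R\<^sup>2)\<^sup>2) = (1 + \<epsilon>) * \<epsilon>\<^sup>2 * (c * \<epsilon> * R ^ 4) * sq u"
      using e by (simp add: field_simps power2_eq_square power4_eq_xxxx)
    have e2: "(\<Sum>t\<in>T. Zt t) = card T * Z'" using cardT by (simp add: Z'_eq)
    show ?thesis unfolding e1 e2 by (simp add: distrib_left distrib_right mult.assoc mult.left_commute)
  qed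
  finally have "Z' * wvar X w' \<phi> \<le> Z' * (c * sq u) + Z / (1 - \<epsilon> * R) * ((1 + \<epsilon>) * \<epsilon>\<^sup>2 * (c\<^sup>2 + c * \<epsilon> * R ^ 4)) * sq u"
    using cardT by (simp add: divide_right_mono)
  also have "\<dots> \<le> Z' * (c * sq u) + Z' / (1 - \<epsilon> * R) * ((1 + \<epsilon>) * \<epsilon>\<^sup>2 * (c\<^sup>2 + c * \<epsilon> * R ^ 4)) * sq u"
    using ZZ' e c R sq_nonneg by (intro add_left_mono mult_right_mono divide_right_mono) auto
  also have "\<dots> = Z' * ((c + (1 + \<epsilon>) * \<epsilon>\<^sup>2 * (c\<^sup>2 + c * \<epsilon> * R ^ 4) / (1 - \<epsilon> * R)) * sq u)"
    by (simp add: distrib_left distrib_right mult.assoc mult.left_commute add_divide_distrib)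
  finally have "wvar X w' \<phi> \<le> (c + (1 + \<epsilon>) * \<epsilon>\<^sup>2 * (c\<^sup>2 + c * \<epsilon> * R ^ 4) / (1 - \<epsilon> * R)) * sq u"
    using Z ZZ' by simp
  then show ?thesis by (simp add: w'_def[abs_def] \<phi>_def)
qed

text \<open>
  The entropy under the mixed weight is the mean of the entropies under the tilted weights
  plus the entropy of the conditional means \<open>u t / v t\<close>. The latter is at most a chi-square
  divergence, which to leading order is \<open>\<epsilon>\<^sup>2\<close> times the squared change of the mean feature
  vector caused by \<open>F\<close>. By \<open>entropic_stability\<close> this is at most the fraction \<open>2 c \<epsilon>\<^sup>2\<close> of the
  entropy.
\<close>

lemma entropy_step:
  assumes w: "\<And>x. x \<in> X \<Longrightarrow> 0 < w x" and F: "\<And>x. x \<in> X \<Longrightarrow> 0 \<le> F x" and c: "0 < c"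
    and var: "\<And>u t. wvar X (\<lambda>x. w x * step_factor \<epsilon> x * exp (t * lin u x)) (lin u) \<le> c * sq u"
    and e: "0 < \<epsilon>" "2 * \<epsilon> * R < 1"
  shows "went X (\<lambda>x. w x * step_factor \<epsilon> x) F * (1 - (1 + \<epsilon>) * \<epsilon>\<^sup>2 * (2 * c + 36 * \<epsilon> * R ^ 4) / (1 - 2 * \<epsilon> * R))
    \<le> (\<Sum>t\<in>T. went X (\<lambda>x. w x * exp (\<epsilon> * lin (s t) x)) F) / card T"
proof -
  define w' where "w' x = w x * step_factor \<epsilon> x" for x
  define wt where "wt t x = w x * exp (\<epsilon> * lin (s t) x)" for t x
  define a where "a t x = exp (\<epsilon> * lin (s t) x) / step_factor \<epsilon> x" for t x
  define U V where "U = (\<Sum>x\<in>X. w' x * F x)" and "V = (\<Sum>x\<in>X. w' x)"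
  define u v where "u t = (\<Sum>x\<in>X. wt t x * F x)" and "v t = (\<Sum>x\<in>X. wt t x)" for t
  define H where "H = went X w' F"
  have eR: "\<epsilon> * R < 1 / 2" using e by simp
  have e': "\<epsilon> * R \<le> 1" using eR by simp
  have eR0: "0 < \<epsilon> * R" using e R by simp
  have step_factor: "0 < step_factor \<epsilon> x" if "x \<in> X" for x using step_factor_bounds(1)[OF e(1) e' that] by simp
  have w': "0 < w' x" if "x \<in> X" for x using w[OF that] step_factor[OF that] by (simp add: w'_def)
  have wt: "0 < wt t x" if "x \<in> X" for t x using w[OF that] by (simp add: wt_def)
  have H0: "0 \<le> H" unfolding H_def using finX w' F by (intro went_nonneg) auto
  have w'_eq: "w' x = (\<Sum>t\<in>T. wt t x) / card T" for x
    by (simp add: w'_def wt_def step_factor_def sum_distrib_left)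
  have avg: "(\<Sum>x\<in>X. w' x * h x) = (\<Sum>t\<in>T. \<Sum>x\<in>X. wt t x * h x) / card T" for h
    unfolding w'_eq by (simp add: sum_divide_distrib[symmetric] sum_distrib_right sum.swap[of _ T X])
  have U_eq: "U = (\<Sum>t\<in>T. u t) / card T" unfolding U_def u_def by (rule avg)
  have V_eq: "V = (\<Sum>t\<in>T. v t) / card T" using avg[of "\<lambda>_. 1"] by (simp add: V_def v_def)
  have V: "0 < V" unfolding V_def using finX neX w' by (intro sum_pos) auto
  have v: "0 < v t" for t unfolding v_def using finX neX wt by (intro sum_pos) auto
  have u: "0 \<le> u t" for t unfolding u_def using wt F by (intro sum_nonneg mult_nonneg_nonneg) (auto simp: less_imp_le)
  have wt_a: "wt t x = w' x * a t x" if "x \<in> X" for t x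
    using step_factor[OF that] by (simp add: wt_def w'_def a_def)
  have gap: "H - (\<Sum>t\<in>T. went X (wt t) F) / card T = (\<Sum>t\<in>T. u t * ln (u t / v t)) / card T - U * ln (U / V)"
    unfolding H_def went_def avg[of "\<lambda>x. F x * ln (F x)"] U_def[symmetric] V_def[symmetric] u_def[symmetric] v_def[symmetric]
    by (simp add: sum_subtractf diff_divide_distrib)
  show ?thesis
  proof (cases "U = 0")
    case True
    then have "\<forall>t\<in>T. u t = 0" using U_eq u cardT finT neT by (auto simp: sum_nonneg_eq_0_iff)
    then have "H = (\<Sum>t\<in>T. went X (wt t) F) / card T" using gap True by simp
    moreover have "H * (1 - (1 + \<epsilon>) * \<epsilon>\<^sup>2 * (2 * c + 36 * \<epsilon> * R ^ 4) / (1 - 2 * \<epsilon> * R)) \<le> H * 1"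
      using e c R by (intro mult_left_mono H0) (simp add: divide_nonneg_nonneg)
    ultimately show ?thesis by (simp add: H_def w'_def[abs_def] wt_def[abs_def])
  next
    case False
    have "0 \<le> U" using u cardT unfolding U_eq by (intro divide_nonneg_nonneg sum_nonneg) auto
    then have U: "0 < U" using False by simp
    \<comment> \<open>\<open>m\<close> is the difference between the law biased by \<open>F\<close> and the law of weight \<open>w'\<close>. It
      has total mass zero, so the constant term of \<open>a t\<close> drops out of \<open>A t\<close> and
      \<open>\<epsilon> * D t\<close> is the leading part.\<close>
    define m where "m x = w' x * F x / U - w' x / V" for x
    define \<tau> where "\<tau> = (\<Sum>x\<in>X. \<bar>m x\<bar>)"
    define A where "A t = (\<Sum>x\<in>X. m x * a t x)" for t
    define D where "D t = (\<Sum>x\<in>X. m x * lin (s t) x)" for t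
    have m0: "(\<Sum>x\<in>X. m x) = 0"
      using U V by (simp add: m_def sum_subtractf sum_divide_distrib[symmetric] U_def[symmetric] V_def[symmetric])
    have A_eq: "A t = u t / U - v t / V" for t
    proof -
      have "A t = (\<Sum>x\<in>X. w' x * a t x * F x / U - w' x * a t x / V)"
        unfolding A_def m_def by (intro sum.cong refl) (simp add: algebra_simps)
      also have "\<dots> = (\<Sum>x\<in>X. wt t x * F x / U - wt t x / V)"
        using wt_a by (intro sum.cong refl) simp
      finally show ?thesis by (simp add: sum_subtractf sum_divide_distrib[symmetric] u_def v_def)
    qed
    have sums: "(\<Sum>t\<in>T. v t) = card T * V" "(\<Sum>t\<in>T. u t) = card T * U"
      using cardT by (simp_all add: V_eq U_eq)
    have sumA: "(\<Sum>t\<in>T. A t) = 0"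
      using U V unfolding A_eq by (simp add: sum_subtractf sum_divide_distrib[symmetric] sums)
    have vV: "(1 - 2 * \<epsilon> * R) \<le> v t / V" if t: "t \<in> T" for t
    proof -
      have "(1 - 2 * \<epsilon> * R) * V = (\<Sum>x\<in>X. w' x * (1 - 2 * \<epsilon> * R))"
        unfolding V_def sum_distrib_right[symmetric] by (rule mult.commute)
      also have "\<dots> \<le> (\<Sum>x\<in>X. w' x * a t x)"
      proof (intro sum_mono mult_left_mono)
        fix x assume x: "x \<in> X"
        have "step_factor \<epsilon> x \<le> 1 + (\<epsilon> * R)\<^sup>2" using step_factor_bounds(2)[OF e(1) e' x] by (simp add: power_mult_distrib)
        then have "(1 - 2 * \<epsilon> * R) * step_factor \<epsilon> x \<le> (1 - 2 * (\<epsilon> * R)) * (1 + (\<epsilon> * R)\<^sup>2)"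
          unfolding mult.assoc by (rule mult_left_mono) (use e in simp)
        also have "\<dots> \<le> 1 - \<epsilon> * R"
        proof -
          have "(\<epsilon> * R) * (\<epsilon> * R) \<le> 1 * (\<epsilon> * R)" using e' eR0 by (intro mult_right_mono) auto
          moreover have "0 \<le> (\<epsilon> * R) ^ 3" using eR0 by simp
          moreover have "(1 - 2 * (\<epsilon> * R)) * (1 + (\<epsilon> * R)\<^sup>2)
            = 1 - 2 * (\<epsilon> * R) + (\<epsilon> * R) * (\<epsilon> * R) - 2 * (\<epsilon> * R) ^ 3"
            by (simp add: power2_eq_square power3_eq_cube algebra_simps)
          ultimately show ?thesis by linarith
        qed
        also have "\<dots> \<le> exp (\<epsilon> * lin (s t) x)" by (rule exp_lin_bounds(2)[OF e(1) e' t x])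
        finally show "1 - 2 * \<epsilon> * R \<le> a t x" using step_factor[OF x] by (simp add: a_def le_divide_eq)
        show "0 \<le> w' x" using w'[OF x] by simp
      qed
      also have "\<dots> = v t" unfolding v_def using wt_a by (intro sum.cong refl) simp
      finally show ?thesis using V by (simp add: le_divide_eq)
    qed
    have A_bound: "(A t)\<^sup>2 \<le> (1 + \<epsilon>) * \<epsilon>\<^sup>2 * (D t)\<^sup>2 + (1 + 1 / \<epsilon>) * (9 * \<epsilon> ^ 4 * R ^ 4 * \<tau>\<^sup>2)" if t: "t \<in> T" for t
    proof -
      define \<zeta> where "\<zeta> x = a t x - 1 - \<epsilon> * lin (s t) x" for x
      have \<zeta>: "\<bar>\<zeta> x\<bar> \<le> 3 * (\<epsilon> * R)\<^sup>2" if x: "x \<in> X" for x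
      proof -
        define y k where "y = \<epsilon> * lin (s t) x" and "k = step_factor \<epsilon> x"
        have k: "1 \<le> k" "k \<le> 1 + (\<epsilon> * R)\<^sup>2"
          using step_factor_bounds[OF e(1) e' x] by (simp_all add: k_def power_mult_distrib)
        have y: "\<bar>exp y - 1 - y\<bar> \<le> (\<epsilon> * R)\<^sup>2" "\<bar>y\<bar> \<le> \<epsilon> * R"
          using exp_lin_bounds[OF e(1) e' t x] by (simp_all add: y_def power_mult_distrib)
        have "\<zeta> x * k = (exp y - 1 - y) + (1 + y) * (1 - k)"
          using k by (simp add: \<zeta>_def a_def y_def[symmetric] k_def[symmetric] algebra_simps)
        also have "\<bar>\<dots>\<bar> \<le> (\<epsilon> * R)\<^sup>2 + 2 * (\<epsilon> * R)\<^sup>2"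
        proof -
          have "\<bar>(1 + y) * (1 - k)\<bar> \<le> 2 * (\<epsilon> * R)\<^sup>2"
            unfolding abs_mult using y k e' by (intro mult_mono) auto
          then show ?thesis using y by linarith
        qed
        finally have "\<bar>\<zeta> x\<bar> * k \<le> 3 * (\<epsilon> * R)\<^sup>2" using k by (simp add: abs_mult)
        moreover have "\<bar>\<zeta> x\<bar> * 1 \<le> \<bar>\<zeta> x\<bar> * k" using k by (intro mult_left_mono) auto
        ultimately show ?thesis by simp
      qed
      have "A t = (\<Sum>x\<in>X. m x + \<epsilon> * (m x * lin (s t) x) + m x * \<zeta> x)"
        unfolding A_def \<zeta>_def by (intro sum.cong refl) (simp add: algebra_simps)
      also have "\<dots> = \<epsilon> * D t + (\<Sum>x\<in>X. m x * \<zeta> x)"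
        unfolding sum.distrib m0 sum_distrib_left[symmetric] D_def by simp
      finally have A: "A t = \<epsilon> * D t + (\<Sum>x\<in>X. m x * \<zeta> x)" .
      have "\<bar>\<Sum>x\<in>X. m x * \<zeta> x\<bar> \<le> (\<Sum>x\<in>X. \<bar>m x * \<zeta> x\<bar>)" by (rule sum_abs)
      also have "\<dots> \<le> (\<Sum>x\<in>X. \<bar>m x\<bar> * (3 * (\<epsilon> * R)\<^sup>2))"
        unfolding abs_mult using \<zeta> by (intro sum_mono mult_left_mono) auto
      also have "\<dots> = 3 * (\<epsilon> * R)\<^sup>2 * \<tau>"
        unfolding \<tau>_def sum_distrib_right[symmetric] by (rule mult.commute)
      finally have "(\<Sum>x\<in>X. m x * \<zeta> x)\<^sup>2 \<le> (3 * (\<epsilon> * R)\<^sup>2 * \<tau>)\<^sup>2"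
        by (metis abs_ge_zero power2_abs power_mono)
      also have "\<dots> = 9 * \<epsilon> ^ 4 * R ^ 4 * \<tau>\<^sup>2" by (simp add: power_mult_distrib)
      finally have Z: "(\<Sum>x\<in>X. m x * \<zeta> x)\<^sup>2 \<le> 9 * \<epsilon> ^ 4 * R ^ 4 * \<tau>\<^sup>2" .
      have "(A t)\<^sup>2 \<le> (1 + \<epsilon>) * (\<epsilon> * D t)\<^sup>2 + (1 + 1 / \<epsilon>) * (\<Sum>x\<in>X. m x * \<zeta> x)\<^sup>2"
        unfolding A by (rule square_sum_le[OF e(1)])
      also have "\<dots> \<le> (1 + \<epsilon>) * (\<epsilon> * D t)\<^sup>2 + (1 + 1 / \<epsilon>) * (9 * \<epsilon> ^ 4 * R ^ 4 * \<tau>\<^sup>2)"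
        using Z e by (intro add_left_mono mult_left_mono) auto
      finally show ?thesis by (simp only: power_mult_distrib mult.assoc)
    qed
    have \<tau>: "\<tau>\<^sup>2 \<le> 4 * H / U"
      unfolding \<tau>_def m_def U_def V_def H_def
      by (rule total_variation_entropy[OF finX w' F]) (use U in \<open>auto simp: U_def\<close>)
    have D: "(\<Sum>t\<in>T. (D t)\<^sup>2) \<le> card T * (2 * c * (H / U))"
    proof -
      have "sq (\<lambda>a. \<Sum>x\<in>X. m x * g a x) \<le> 2 * c * (H / U)"
        unfolding m_def U_def V_def H_def
        by (rule entropic_stability[OF w' F c]) (use var U in \<open>auto simp: w'_def U_def\<close>)
      then show ?thesis unfolding D_def isotropic_functional by (rule mult_left_mono) simp
    qed
    have q: "0 < 1 - 2 * \<epsilon> * R" using e by simp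
    have termwise: "u t * ln (u t / v t) - u t * ln (U / V) \<le> 2 * U * A t + U * (v t / V) - u t + U / (1 - 2 * \<epsilon> * R) * (A t)\<^sup>2"
      if t: "t \<in> T" for t
    proof -
      define p where "p = v t / V"
      have p: "0 < p" "1 - 2 * \<epsilon> * R \<le> p" using v[of t] V vV[OF t] by (simp_all add: p_def)
      have ut: "u t = U * (A t + p)" using U by (simp add: A_eq p_def)
      have "u t * ln (u t / v t) - u t * ln (U / V) \<le> u t * (u t / (U * p) - 1)"
      proof (cases "u t = 0")
        case False
        then have ut0: "0 < u t" using u[of t] by simp
        have "ln (u t / v t) - ln (U / V) = ln (u t / (U * p))"
          using ut0 v[of t] U V p by (simp add: p_def ln_div ln_mult)
        also have "\<dots> \<le> u t / (U * p) - 1" using ut0 U p by (intro ln_le_minus_one) simp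
        finally have "u t * (ln (u t / v t) - ln (U / V)) \<le> u t * (u t / (U * p) - 1)"
          using ut0 by (intro mult_left_mono) auto
        then show ?thesis unfolding right_diff_distrib[of "u t" "ln (u t / v t)"] .
      qed simp
      also have "\<dots> = 2 * U * A t + U * p - u t + U * ((A t)\<^sup>2 / p)"
        unfolding ut using U p by (simp add: field_simps power2_eq_square)
      also have "(A t)\<^sup>2 / p \<le> (A t)\<^sup>2 / (1 - 2 * \<epsilon> * R)"
        using p q by (intro divide_left_mono) auto
      finally show ?thesis using U by (simp add: p_def mult_left_mono)
    qed
    have "(\<Sum>t\<in>T. u t * ln (u t / v t)) - (\<Sum>t\<in>T. u t) * ln (U / V) \<le>
       (\<Sum>t\<in>T. 2 * U * A t + U * (v t / V) - u t + U / (1 - 2 * \<epsilon> * R) * (A t)\<^sup>2)"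
      unfolding sum_distrib_right sum_subtractf[symmetric] by (rule sum_mono[OF termwise])
    also have "\<dots> = 2 * U * (\<Sum>t\<in>T. A t) + U * ((\<Sum>t\<in>T. v t) / V) - (\<Sum>t\<in>T. u t) + U / (1 - 2 * \<epsilon> * R) * (\<Sum>t\<in>T. (A t)\<^sup>2)"
      by (simp only: sum.distrib sum_subtractf sum_distrib_left[symmetric] sum_divide_distrib[symmetric])
    also have "\<dots> = U / (1 - 2 * \<epsilon> * R) * (\<Sum>t\<in>T. (A t)\<^sup>2)"
      using V by (simp add: sumA sums)
    also have "\<dots> \<le> U / (1 - 2 * \<epsilon> * R) * (card T * ((1 + \<epsilon>) * \<epsilon>\<^sup>2 * (2 * c + 36 * \<epsilon> * R ^ 4) * (H / U)))"
    proof (rule mult_left_mono)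
      have "(\<Sum>t\<in>T. (A t)\<^sup>2) \<le> (\<Sum>t\<in>T. (1 + \<epsilon>) * \<epsilon>\<^sup>2 * (D t)\<^sup>2 + (1 + 1 / \<epsilon>) * (9 * \<epsilon> ^ 4 * R ^ 4 * \<tau>\<^sup>2))"
        by (rule sum_mono[OF A_bound])
      also have "\<dots> = (1 + \<epsilon>) * \<epsilon>\<^sup>2 * (\<Sum>t\<in>T. (D t)\<^sup>2) + card T * ((1 + 1 / \<epsilon>) * (9 * \<epsilon> ^ 4 * R ^ 4 * \<tau>\<^sup>2))"
        unfolding sum.distrib sum_distrib_left[symmetric] sum_constant by (simp only: mult.left_commute)
      also have "\<dots> \<le> (1 + \<epsilon>) * \<epsilon>\<^sup>2 * (card T * (2 * c * (H / U))) + card T * ((1 + 1 / \<epsilon>) * (9 * \<epsilon> ^ 4 * R ^ 4 * (4 * H / U)))"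
        using D \<tau> e R by (intro add_mono mult_left_mono) auto
      also have "\<dots> = card T * ((1 + \<epsilon>) * \<epsilon>\<^sup>2 * (2 * c + 36 * \<epsilon> * R ^ 4) * (H / U))"
      proof -
        have e1: "(1 + 1 / \<epsilon>) * (9 * \<epsilon> ^ 4 * R ^ 4 * (4 * H / U)) = (1 + \<epsilon>) * \<epsilon>\<^sup>2 * (36 * \<epsilon> * R ^ 4) * (H / U)"
          using e U by (simp add: field_simps power2_eq_square power4_eq_xxxx)
        show ?thesis unfolding e1 by (simp add: distrib_left distrib_right mult.assoc mult.left_commute add_divide_distrib)
      qed
      finally show "(\<Sum>t\<in>T. (A t)\<^sup>2) \<le> card T * ((1 + \<epsilon>) * \<epsilon>\<^sup>2 * (2 * c + 36 * \<epsilon> * R ^ 4) * (H / U))" .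
    qed (use U q in simp)
    also have "\<dots> = card T * (H * ((1 + \<epsilon>) * \<epsilon>\<^sup>2 * (2 * c + 36 * \<epsilon> * R ^ 4) / (1 - 2 * \<epsilon> * R)))"
      using U by simp
    finally have fin: "(\<Sum>t\<in>T. u t * ln (u t / v t)) - (\<Sum>t\<in>T. u t) * ln (U / V) \<le>
        card T * (H * ((1 + \<epsilon>) * \<epsilon>\<^sup>2 * (2 * c + 36 * \<epsilon> * R ^ 4) / (1 - 2 * \<epsilon> * R)))" .
    have "(\<Sum>t\<in>T. u t * ln (u t / v t)) / card T - U * ln (U / V)
      = ((\<Sum>t\<in>T. u t * ln (u t / v t)) - (\<Sum>t\<in>T. u t) * ln (U / V)) / card T"
      by (simp add: U_eq diff_divide_distrib)
    also have "\<dots> \<le> H * ((1 + \<epsilon>) * \<epsilon>\<^sup>2 * (2 * c + 36 * \<epsilon> * R ^ 4) / (1 - 2 * \<epsilon> * R))"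
      using fin cardT by (simp add: divide_le_eq mult.commute)
    finally have "H - (\<Sum>t\<in>T. went X (wt t) F) / card T \<le> H * ((1 + \<epsilon>) * \<epsilon>\<^sup>2 * (2 * c + 36 * \<epsilon> * R ^ 4) / (1 - 2 * \<epsilon> * R))"
      unfolding gap .
    then show ?thesis
      unfolding H_def w'_def[abs_def] wt_def[abs_def] right_diff_distrib by simp
  qed
qed

text \<open>
  The mean weight after \<open>k\<close> independent steps of length \<open>\<epsilon>\<close>, started at the field \<open>\<theta>\<close>.
\<close>

definition walk :: "('x \<Rightarrow> real) \<Rightarrow> real \<Rightarrow> nat \<Rightarrow> ('a \<Rightarrow> real) \<Rightarrow> 'x \<Rightarrow> real" where
  "walk b \<epsilon> k \<theta> x = b x * step_factor \<epsilon> x ^ k * exp (lin \<theta> x)"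

lemma walk_tilt: "walk b \<epsilon> k \<theta> x * exp (c * lin u x) = walk b \<epsilon> k (\<lambda>a. \<theta> a + c * u a) x"
  by (simp add: walk_def lin_add exp_add mult.assoc)

lemma walk_Suc: "walk b \<epsilon> k \<theta> x * step_factor \<epsilon> x = walk b \<epsilon> (Suc k) \<theta> x"
  by (simp add: walk_def mult.commute mult.left_commute)

text \<open>
  The number \<open>\<tau>\<close> is \<open>\<epsilon>\<^sup>2\<close> enlarged so that the errors of \<open>variance_step\<close> and \<open>entropy_step\<close>
  are absorbed; this is possible as all variance constants are at least \<open>c0\<close>. The sequence
  \<open>c k = 1 / (1 / c0 - k \<tau>)\<close> satisfies \<open>c k + \<tau> (c k)\<^sup>2 \<le> c (k + 1)\<close>, and the product of the
  factors \<open>1 - 2 \<tau> c (k + 1)\<close> that the entropy loses telescopes to the quotient in the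
  conclusion. On the right-hand side a step costs nothing, by \<open>went_superadditive\<close>.
\<close>

theorem random_walk_entropy:
  fixes Y :: "'j \<Rightarrow> 'x set"
  assumes b: "\<And>x. x \<in> X \<Longrightarrow> 0 < b x" and F: "\<And>x. x \<in> X \<Longrightarrow> 0 \<le> F x"
    and finJ: "finite J" and Y: "\<And>j. j \<in> J \<Longrightarrow> Y j \<subseteq> X" and c0: "0 < c0"
    and var0: "\<And>\<theta> u. wvar X (\<lambda>x. b x * exp (lin \<theta> x)) (lin u) \<le> c0 * sq u"
    and ent0: "\<And>\<theta>. went X (\<lambda>x. b x * exp (lin \<theta> x)) F \<le> (\<Sum>j\<in>J. went (Y j) (\<lambda>x. b x * exp (lin \<theta> x)) F)"
    and e: "0 < \<epsilon>" "2 * \<epsilon> * R < 1"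
  defines "\<tau> \<equiv> (1 + \<epsilon>) * \<epsilon>\<^sup>2 * (1 + 18 * \<epsilon> * R ^ 4 / c0) / (1 - 2 * \<epsilon> * R)"
  assumes m: "(real m + 2) * \<tau> < 1 / c0" and k: "k \<le> m"
  shows "wvar X (walk b \<epsilon> k \<theta>) (lin u) \<le> 1 / (1 / c0 - real k * \<tau>) * sq u"
    and "(1 / c0 - (real k + 1) * \<tau>) * (1 / c0 - (real k + 2) * \<tau>) / ((1 / c0 - \<tau>) * (1 / c0 - 2 * \<tau>)) * went X (walk b \<epsilon> k \<theta>) F
       \<le> (\<Sum>j\<in>J. went (Y j) (walk b \<epsilon> k \<theta>) F)"
proof -
  define A where "A = 1 / c0"
  define P where "P k = (A - (real k + 1) * \<tau>) * (A - (real k + 2) * \<tau>) / ((A - \<tau>) * (A - 2 * \<tau>))" for k :: nat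
  have \<tau>: "0 < \<tau>" unfolding \<tau>_def using e c0 R by (intro divide_pos_pos mult_pos_pos add_pos_nonneg) auto
  have A: "0 < A" using c0 by (simp add: A_def)
  have Ak: "0 < A - (real k + 2) * \<tau>" if "k \<le> m" for k
  proof -
    have "(real k + 2) * \<tau> \<le> (real m + 2) * \<tau>" using that \<tau> by (intro mult_right_mono) auto
    then show ?thesis using m by (simp add: A_def)
  qed
  have Ak0: "0 < A - real k * \<tau>" "0 < A - (real k + 1) * \<tau>" if "k \<le> m" for k
    using Ak[OF that] \<tau> by (simp_all add: algebra_simps)
  have wpos: "0 < walk b \<epsilon> k \<theta> x" if "x \<in> X" for k \<theta> x
    using b[OF that] step_factor_bounds(1)[OF e(1) _ that] e by (simp add: walk_def)
  have main: "(\<forall>\<theta> u. wvar X (walk b \<epsilon> k \<theta>) (lin u) \<le> 1 / (A - real k * \<tau>) * sq u) \<and>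
      (\<forall>\<theta>. P k * went X (walk b \<epsilon> k \<theta>) F \<le> (\<Sum>j\<in>J. went (Y j) (walk b \<epsilon> k \<theta>) F))" if "k \<le> m" for k
    using that
  proof (induction k)
    case 0
    have "P 0 = 1" using Ak[of 0] Ak0[of 0] by (simp add: P_def)
    then show ?case using var0 ent0 by (simp add: walk_def[abs_def] A_def)
  next
    case (Suc k)
    then have k: "k \<le> m" "Suc k \<le> m" by auto
    define c c' where "c = 1 / (A - real k * \<tau>)" and "c' = 1 / (A - (real k + 1) * \<tau>)"
    have IH1: "wvar X (walk b \<epsilon> k \<theta>) (lin u) \<le> c * sq u" for \<theta> u using Suc k by (simp add: c_def)
    have IH2: "P k * went X (walk b \<epsilon> k \<theta>) F \<le> (\<Sum>j\<in>J. went (Y j) (walk b \<epsilon> k \<theta>) F)" for \<theta> using Suc k by simp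
    have c: "0 < c" using Ak0[OF k(1)] by (simp add: c_def)
    have c': "0 < c'" using Ak0[OF k(1)] by (simp add: c'_def)
    have cc0: "c0 \<le> c"
    proof -
      have "c0 = 1 / A" by (simp add: A_def)
      also have "\<dots> \<le> c" unfolding c_def using Ak0[OF k(1)] \<tau> A by (intro frac_le) auto
      finally show ?thesis .
    qed
    have c'c: "c \<le> c'" unfolding c_def c'_def
      using Ak0[OF k(1)] \<tau> by (intro frac_le) (auto simp: distrib_right)
    have err: "\<epsilon> * R ^ 4 \<le> d * (\<epsilon> * R ^ 4 / c0)" if "c0 \<le> d" for d
    proof -
      have "c0 * (\<epsilon> * R ^ 4 / c0) \<le> d * (\<epsilon> * R ^ 4 / c0)"
        using that e R c0 by (intro mult_right_mono) auto
      then show ?thesis using c0 by simp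
    qed
    have q: "0 < 1 - 2 * \<epsilon> * R" "1 - 2 * \<epsilon> * R \<le> 1 - \<epsilon> * R" using e R by auto
    have V: "wvar X (walk b \<epsilon> (Suc k) \<theta>) (lin u) \<le> c' * sq u" for \<theta> u
    proof -
      have "wvar X (\<lambda>x. walk b \<epsilon> k \<theta> x * step_factor \<epsilon> x) (lin u)
        \<le> (c + (1 + \<epsilon>) * \<epsilon>\<^sup>2 * (c\<^sup>2 + c * \<epsilon> * R ^ 4) / (1 - \<epsilon> * R)) * sq u"
        using wpos c IH1 e R by (intro variance_step) (auto simp: walk_tilt)
      also have "\<dots> \<le> c' * sq u"
      proof (rule mult_right_mono[OF _ sq_nonneg])
        have "c * (\<epsilon> * R ^ 4) \<le> c * (c * (\<epsilon> * R ^ 4 / c0))"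
          using err[OF cc0] c by (intro mult_left_mono) auto
        also have "\<dots> \<le> c\<^sup>2 * (18 * \<epsilon> * R ^ 4 / c0)"
          using c e R c0 by (simp add: power2_eq_square field_simps)
        finally have 1: "c\<^sup>2 + c * \<epsilon> * R ^ 4 \<le> c\<^sup>2 * (1 + 18 * \<epsilon> * R ^ 4 / c0)" by (simp add: distrib_left mult.assoc)
        have "(1 + \<epsilon>) * \<epsilon>\<^sup>2 * (c\<^sup>2 + c * \<epsilon> * R ^ 4) / (1 - \<epsilon> * R) \<le> (1 + \<epsilon>) * \<epsilon>\<^sup>2 * (c\<^sup>2 * (1 + 18 * \<epsilon> * R ^ 4 / c0)) / (1 - 2 * \<epsilon> * R)"
          using 1 q e c R c0 by (intro frac_le mult_left_mono) auto
        also have "\<dots> = \<tau> * c\<^sup>2" by (simp add: \<tau>_def algebra_simps)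
        finally have 2: "c + (1 + \<epsilon>) * \<epsilon>\<^sup>2 * (c\<^sup>2 + c * \<epsilon> * R ^ 4) / (1 - \<epsilon> * R) \<le> c + \<tau> * c\<^sup>2" by simp
        define B where "B = A - real k * \<tau>"
        have B: "0 < B" "0 < B - \<tau>" using Ak0[OF k(1)] by (simp_all add: B_def algebra_simps)
        have "(c + \<tau> * c\<^sup>2) * (B - \<tau>) \<le> 1"
        proof -
          have cB: "c * B = 1" using B by (simp add: c_def B_def[symmetric])
          have "(c + \<tau> * c\<^sup>2) * (B - \<tau>) = c * B + \<tau> * c * (c * B) - \<tau> * c - (\<tau> * c)\<^sup>2"
            by (simp add: power2_eq_square algebra_simps)
          also have "\<dots> = 1 - (\<tau> * c)\<^sup>2" unfolding cB by simp
          finally show ?thesis by simp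
        qed
        then have "c + \<tau> * c\<^sup>2 \<le> c'" using B by (simp add: c'_def B_def le_divide_eq algebra_simps)
        with 2 show "c + (1 + \<epsilon>) * \<epsilon>\<^sup>2 * (c\<^sup>2 + c * \<epsilon> * R ^ 4) / (1 - \<epsilon> * R) \<le> c'" by linarith
      qed
      finally show ?thesis by (simp add: walk_Suc)
    qed
    have E: "P (Suc k) * went X (walk b \<epsilon> (Suc k) \<theta>) F \<le> (\<Sum>j\<in>J. went (Y j) (walk b \<epsilon> (Suc k) \<theta>) F)" for \<theta>
    proof -
      define H where "H = went X (walk b \<epsilon> (Suc k) \<theta>) F"
      have H0: "0 \<le> H" unfolding H_def using finX wpos F by (intro went_nonneg) auto
      have step: "H * (1 - (1 + \<epsilon>) * \<epsilon>\<^sup>2 * (2 * c' + 36 * \<epsilon> * R ^ 4) / (1 - 2 * \<epsilon> * R))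
        \<le> (\<Sum>t\<in>T. went X (walk b \<epsilon> k (\<lambda>a. \<theta> a + \<epsilon> * s t a)) F) / card T"
      proof -
        have "went X (\<lambda>x. walk b \<epsilon> k \<theta> x * step_factor \<epsilon> x) F * (1 - (1 + \<epsilon>) * \<epsilon>\<^sup>2 * (2 * c' + 36 * \<epsilon> * R ^ 4) / (1 - 2 * \<epsilon> * R))
          \<le> (\<Sum>t\<in>T. went X (\<lambda>x. walk b \<epsilon> k \<theta> x * exp (\<epsilon> * lin (s t) x)) F) / card T"
          by (rule entropy_step) (use wpos F c' V e in \<open>auto simp: walk_tilt walk_Suc\<close>)
        then show ?thesis by (simp only: walk_Suc walk_tilt H_def)
      qed
      have "1 - 2 * (\<tau> * c') \<le> 1 - (1 + \<epsilon>) * \<epsilon>\<^sup>2 * (2 * c' + 36 * \<epsilon> * R ^ 4) / (1 - 2 * \<epsilon> * R)"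
      proof -
        have "2 * c' + 36 * (\<epsilon> * R ^ 4) \<le> 2 * c' + 36 * (c' * (\<epsilon> * R ^ 4 / c0))"
          using err[of c'] cc0 c'c by simp
        also have "\<dots> = 2 * c' * (1 + 18 * \<epsilon> * R ^ 4 / c0)" by (simp add: algebra_simps)
        finally have "(1 + \<epsilon>) * \<epsilon>\<^sup>2 * (2 * c' + 36 * (\<epsilon> * R ^ 4)) / (1 - 2 * \<epsilon> * R) \<le> (1 + \<epsilon>) * \<epsilon>\<^sup>2 * (2 * c' * (1 + 18 * \<epsilon> * R ^ 4 / c0)) / (1 - 2 * \<epsilon> * R)"
          using q e by (intro divide_right_mono mult_left_mono) auto
        also have "\<dots> = 2 * (\<tau> * c')" by (simp add: \<tau>_def algebra_simps)
        finally show ?thesis by (simp add: mult.assoc)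
      qed
      then have "H * (1 - 2 * (\<tau> * c')) \<le> (\<Sum>t\<in>T. went X (walk b \<epsilon> k (\<lambda>a. \<theta> a + \<epsilon> * s t a)) F) / card T"
        using step H0 by (meson mult_left_mono order_trans)
      moreover have Pk: "0 \<le> P k" unfolding P_def using Ak[OF k(1)] Ak0[OF k(1)] Ak[of 0] Ak0[of 0]
        by (intro divide_nonneg_nonneg mult_nonneg_nonneg) auto
      ultimately have "P k * (H * (1 - 2 * (\<tau> * c'))) \<le> P k * ((\<Sum>t\<in>T. went X (walk b \<epsilon> k (\<lambda>a. \<theta> a + \<epsilon> * s t a)) F) / card T)"
        by (rule mult_left_mono)
      also have "\<dots> = (\<Sum>t\<in>T. P k * went X (walk b \<epsilon> k (\<lambda>a. \<theta> a + \<epsilon> * s t a)) F) / card T"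
        by (simp add: sum_distrib_left)
      also have "\<dots> \<le> (\<Sum>t\<in>T. \<Sum>j\<in>J. went (Y j) (walk b \<epsilon> k (\<lambda>a. \<theta> a + \<epsilon> * s t a)) F) / card T"
        by (intro divide_right_mono sum_mono IH2) simp
      also have "\<dots> = (\<Sum>j\<in>J. \<Sum>t\<in>T. went (Y j) (walk b \<epsilon> k (\<lambda>a. \<theta> a + \<epsilon> * s t a)) F) / card T"
        by (subst sum.swap) simp
      also have "\<dots> \<le> (\<Sum>j\<in>J. card T * went (Y j) (walk b \<epsilon> (Suc k) \<theta>) F) / card T"
      proof (intro divide_right_mono sum_mono)
        fix j assume j: "j \<in> J"
        have "(\<Sum>t\<in>T. went (Y j) (walk b \<epsilon> k (\<lambda>a. \<theta> a + \<epsilon> * s t a)) F)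
          \<le> went (Y j) (\<lambda>x. \<Sum>t\<in>T. walk b \<epsilon> k (\<lambda>a. \<theta> a + \<epsilon> * s t a) x) F"
          using finT finite_subset[OF Y[OF j] finX] wpos F Y[OF j] by (intro went_superadditive) auto
        also have "(\<lambda>x. \<Sum>t\<in>T. walk b \<epsilon> k (\<lambda>a. \<theta> a + \<epsilon> * s t a) x) = (\<lambda>x. card T * walk b \<epsilon> (Suc k) \<theta> x)"
          using cardT by (simp add: walk_tilt[symmetric] walk_Suc[symmetric] sum_distrib_left[symmetric] step_factor_def fun_eq_iff)
        finally show "(\<Sum>t\<in>T. went (Y j) (walk b \<epsilon> k (\<lambda>a. \<theta> a + \<epsilon> * s t a)) F) \<le> card T * went (Y j) (walk b \<epsilon> (Suc k) \<theta>) F"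
          unfolding went_scale[OF cardT] .
      qed simp
      also have "\<dots> = (\<Sum>j\<in>J. went (Y j) (walk b \<epsilon> (Suc k) \<theta>) F)"
        using cardT by (simp add: sum_distrib_left[symmetric])
      finally have fin: "P k * (H * (1 - 2 * (\<tau> * c'))) \<le> (\<Sum>j\<in>J. went (Y j) (walk b \<epsilon> (Suc k) \<theta>) F)" .
      have Peq: "P k * (1 - 2 * (\<tau> * c')) = P (Suc k)"
      proof -
        define B where "B = A - (real k + 1) * \<tau>"
        have B: "0 < B" using Ak0[OF k(1)] by (simp add: B_def)
        have B1: "A - (real k + 1) * \<tau> = B" "A - (real k + 2) * \<tau> = B - \<tau>"
          "A - (real (Suc k) + 1) * \<tau> = B - \<tau>" "A - (real (Suc k) + 2) * \<tau> = B - 2 * \<tau>"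
          by (simp_all add: B_def algebra_simps)
        have "1 - 2 * (\<tau> * c') = (B - 2 * \<tau>) / B"
          using B by (simp add: c'_def B1 diff_divide_distrib)
        then have "P k * (1 - 2 * (\<tau> * c')) = B * (B - \<tau>) / ((A - \<tau>) * (A - 2 * \<tau>)) * ((B - 2 * \<tau>) / B)"
          unfolding P_def B1 by simp
        also have "\<dots> = (B - \<tau>) * (B - 2 * \<tau>) / ((A - \<tau>) * (A - 2 * \<tau>))" using B by simp
        also have "\<dots> = P (Suc k)" unfolding P_def B1 ..
        finally show ?thesis .
      qed
      have PH: "P (Suc k) * H = P k * (H * (1 - 2 * (\<tau> * c')))"
        unfolding Peq[symmetric] by (simp only: mult.assoc mult.commute[of H])
      show ?thesis using fin unfolding H_def[symmetric] PH .
    qed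
    show ?case using V E by (simp add: c'_def add.commute)
  qed
  show "wvar X (walk b \<epsilon> k \<theta>) (lin u) \<le> 1 / (1 / c0 - real k * \<tau>) * sq u"
    using main[OF k] by (simp add: A_def)
  show "(1 / c0 - (real k + 1) * \<tau>) * (1 / c0 - (real k + 2) * \<tau>) / ((1 / c0 - \<tau>) * (1 / c0 - 2 * \<tau>)) * went X (walk b \<epsilon> k \<theta>) F
       \<le> (\<Sum>j\<in>J. went (Y j) (walk b \<epsilon> k \<theta>) F)"
    using main[OF k] by (simp add: A_def P_def)
qed

end

section \<open>Gaussian mixtures\<close>

lemma went_tendsto:
  assumes Y: "finite Y" and w: "\<And>x. x \<in> Y \<Longrightarrow> (\<lambda>n. w n x) \<longlonglongrightarrow> w' x" and pos: "\<And>x. x \<in> Y \<Longrightarrow> 0 < w' x"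
    and F: "\<And>x. x \<in> Y \<Longrightarrow> 0 \<le> F x"
  shows "(\<lambda>n. went Y (w n) F) \<longlonglongrightarrow> went Y w' F"
proof (cases "\<forall>x\<in>Y. F x = 0")
  case True
  then show ?thesis by (simp add: went_def)
next
  case False
  then obtain y where y: "y \<in> Y" "F y \<noteq> 0" by auto
  then have "0 < w' y * F y" using pos F by (simp add: less_le)
  also have "\<dots> \<le> (\<Sum>x\<in>Y. w' x * F x)"
    using y Y pos F by (intro member_le_sum) (auto simp: less_imp_le)
  finally have U: "0 < (\<Sum>x\<in>Y. w' x * F x)" .
  have Z: "0 < (\<Sum>x\<in>Y. w' x)" using y Y pos by (intro sum_pos) auto
  have "0 < (\<Sum>x\<in>Y. w' x * F x) / (\<Sum>x\<in>Y. w' x)" using U Z by simp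
  then show ?thesis unfolding went_def using Z
    by (intro tendsto_intros w) auto
qed

lemma tendsto_one_plus_power:
  fixes q :: "nat \<Rightarrow> real"
  assumes q: "\<And>n. 0 \<le> q n" and lim: "(\<lambda>n. real n * q n) \<longlonglongrightarrow> L"
  shows "(\<lambda>n. (1 + q n) ^ n) \<longlonglongrightarrow> exp L"
proof -
  have inv: "(\<lambda>n. 1 / real n) \<longlonglongrightarrow> 0" by (rule lim_1_over_n)
  have q0: "q \<longlonglongrightarrow> 0"
  proof -
    have "(\<lambda>n. real n * q n * (1 / real n)) \<longlonglongrightarrow> L * 0" by (intro tendsto_mult lim inv)
    moreover have "\<forall>\<^sub>F n in sequentially. real n * q n * (1 / real n) = q n"
      using eventually_gt_at_top[of 0] by eventually_elim simp
    ultimately show ?thesis by (auto intro: Lim_transform_eventually)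
  qed
  have "(\<lambda>n. real n * ln (1 + q n)) \<longlonglongrightarrow> L"
  proof (rule tendsto_sandwich)
    show "\<forall>\<^sub>F n in sequentially. real n * q n - real n * q n * q n \<le> real n * ln (1 + q n)"
    proof -
      have "\<forall>\<^sub>F n in sequentially. q n < 1" using q0 by (rule order_tendstoD) simp
      then show ?thesis
      proof eventually_elim
        case (elim n)
        have "q n - (q n)\<^sup>2 \<le> ln (1 + q n)" using q[of n] elim by (intro ln_one_plus_pos_lower_bound) auto
        then have "real n * (q n - (q n)\<^sup>2) \<le> real n * ln (1 + q n)" by (rule mult_left_mono) simp
        then show ?case by (simp add: right_diff_distrib power2_eq_square mult.assoc)
      qed
    qed
    show "\<forall>\<^sub>F n in sequentially. real n * ln (1 + q n) \<le> real n * q n"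
      using q by (intro always_eventually allI mult_left_mono ln_add_one_self_le_self) auto
    have "(\<lambda>n. real n * q n - real n * q n * q n) \<longlonglongrightarrow> L - L * 0" by (intro tendsto_intros lim q0)
    then show "(\<lambda>n. real n * q n - real n * q n * q n) \<longlonglongrightarrow> L" by simp
  qed (rule lim)
  then have "(\<lambda>n. exp (real n * ln (1 + q n))) \<longlonglongrightarrow> exp L" by (rule tendsto_exp)
  moreover have "exp (real n * ln (1 + q n)) = (1 + q n) ^ n" for n
  proof -
    have "0 < 1 + q n" using q[of n] by simp
    then show ?thesis by (simp add: exp_of_nat_mult)
  qed
  ultimately show ?thesis by simp
qed

text \<open>
  The weight \<open>exp (1/2 \<Sum>a. (g a x)\<^sup>2)\<close> is the mean of \<open>exp (\<Sum>a. \<theta> a * g a x)\<close> over a standard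
  Gaussian \<open>\<theta>\<close>. By the central limit theorem it is the limit of \<open>walk\<close> with \<open>m\<close> steps of
  length \<open>1 / sqrt m\<close>, which is checked directly on the explicit power \<open>(1 + q m) ^ m\<close>. In
  the limit \<open>m \<tau> \<rightarrow> 1\<close>, so the telescoped product of \<open>random_walk_entropy\<close> becomes
  \<open>(1 / c0 - 1)\<^sup>2 / (1 / c0)\<^sup>2\<close>.
\<close>

theorem gaussian_mixture_entropy:
  fixes g :: "'a \<Rightarrow> 'x \<Rightarrow> real" and Y :: "'j \<Rightarrow> 'x set"
  assumes X: "finite X" "X \<noteq> {}" and I: "finite I" "I \<noteq> {}"
    and b: "\<And>x. x \<in> X \<Longrightarrow> 0 < b x" and F: "\<And>x. x \<in> X \<Longrightarrow> 0 \<le> F x"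
    and J: "finite J" and Y: "\<And>j. j \<in> J \<Longrightarrow> Y j \<subseteq> X" and c0: "0 < c0" "c0 < 1"
    and var0: "\<And>\<theta> u. wvar X (\<lambda>x. b x * exp (\<Sum>a\<in>I. \<theta> a * g a x)) (\<lambda>x. \<Sum>a\<in>I. u a * g a x) \<le> c0 * (\<Sum>a\<in>I. (u a)\<^sup>2)"
    and ent0: "\<And>\<theta>. went X (\<lambda>x. b x * exp (\<Sum>a\<in>I. \<theta> a * g a x)) F
        \<le> (\<Sum>j\<in>J. went (Y j) (\<lambda>x. b x * exp (\<Sum>a\<in>I. \<theta> a * g a x)) F)"
  shows "(1 - c0)\<^sup>2 * went X (\<lambda>x. b x * exp (1 / 2 * (\<Sum>a\<in>I. (g a x)\<^sup>2))) F
    \<le> (\<Sum>j\<in>J. went (Y j) (\<lambda>x. b x * exp (1 / 2 * (\<Sum>a\<in>I. (g a x)\<^sup>2))) F)"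
proof -
  define d where "d = real (card I)"
  have d: "0 < d" using I by (simp add: d_def card_gt_0_iff)
  \<comment> \<open>The steps are the \<open>2 d\<close> vectors \<open>\<plusminus>sqrt d\<close> times a coordinate vector: their covariance
    is the identity.\<close>
  define T where "T = I \<times> {-1, 1::real}"
  define s where "s t b = (if b = fst t then snd t * sqrt d else 0)" for t :: "'a \<times> real" and b
  \<comment> \<open>The summand 1 ensures that \<open>R\<close> is positive even if all features vanish.\<close>
  define R where "R = 1 + sqrt d * (\<Sum>a\<in>I. \<Sum>x\<in>X. \<bar>g a x\<bar>)"
  have lin_s: "(\<Sum>a\<in>I. s t a * g a x) = snd t * sqrt d * g (fst t) x" if "t \<in> T" for t x
  proof -
    have "(\<Sum>a\<in>I. s t a * g a x) = (\<Sum>a\<in>I. if a = fst t then snd t * sqrt d * g a x else 0)"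
      by (intro sum.cong) (auto simp: s_def)
    then show ?thesis using that I by (auto simp: T_def sum.delta)
  qed
  have sumT: "(\<Sum>t\<in>T. h t) = (\<Sum>a\<in>I. h (a, -1) + h (a, 1))" for h :: "'a \<times> real \<Rightarrow> real"
    using sum.cartesian_product[of "\<lambda>a \<sigma>. h (a, \<sigma>)" "{-1, 1}" I] by (simp add: T_def)
  have card_T_eq: "real (card T) = 2 * d" by (simp add: T_def card_cartesian_product d_def)
  have Rpos: "0 < R" unfolding R_def using d by (intro add_pos_nonneg mult_nonneg_nonneg sum_nonneg) auto
  interpret tilted_family X I g T s R
  proof
    show "finite X" "X \<noteq> {}" "finite I" "finite T" "T \<noteq> {}" using X I by (auto simp: T_def)
    show "0 < R" by (rule Rpos)
    show "(\<Sum>t\<in>T. s t a) = 0" if "a \<in> I" for a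
      unfolding sumT by (intro sum.neutral) (simp add: s_def)
    show "(\<Sum>t\<in>T. s t a * s t b) = (if a = b then real (card T) else 0)" if "a \<in> I" "b \<in> I" for a b
    proof -
      have "(\<Sum>t\<in>T. s t a * s t b) = (\<Sum>c\<in>I. if c = a then (if a = b then 2 * d else 0) else 0)"
        unfolding sumT using d by (intro sum.cong refl) (auto simp: s_def)
      then show ?thesis using that I card_T_eq by (simp add: sum.delta)
    qed
    show "\<bar>\<Sum>a\<in>I. s t a * g a x\<bar> \<le> R" if t: "t \<in> T" and x: "x \<in> X" for t x
    proof -
      have "\<bar>\<Sum>a\<in>I. s t a * g a x\<bar> = sqrt d * \<bar>g (fst t) x\<bar>"
        unfolding lin_s[OF t] using t d by (auto simp: abs_mult T_def)
      also have "\<bar>g (fst t) x\<bar> \<le> (\<Sum>x\<in>X. \<bar>g (fst t) x\<bar>)" using x X by (intro member_le_sum) auto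
      also have "\<dots> \<le> (\<Sum>a\<in>I. \<Sum>x\<in>X. \<bar>g a x\<bar>)"
        using t I by (intro member_le_sum[of _ _ "\<lambda>a. \<Sum>x\<in>X. \<bar>g a x\<bar>"]) (auto simp: T_def intro: sum_nonneg)
      finally show ?thesis using d by (simp add: R_def mult_left_mono)
    qed
  qed
  have lin_eq: "lin u x = (\<Sum>a\<in>I. u a * g a x)" for u x by (simp add: lin_def)
  define \<epsilon> where "\<epsilon> m = 1 / sqrt (real m)" for m :: nat
  define \<tau> where "\<tau> m = (1 + \<epsilon> m) * (\<epsilon> m)\<^sup>2 * (1 + 18 * \<epsilon> m * R ^ 4 / c0) / (1 - 2 * \<epsilon> m * R)" for m
  define A where "A = 1 / c0"
  have A: "1 < A" using c0 by (simp add: A_def)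
  define G where "G x = 1 / 2 * (\<Sum>a\<in>I. (g a x)\<^sup>2)" for x
  have \<epsilon>0: "\<epsilon> \<longlonglongrightarrow> 0" unfolding \<epsilon>_def by real_asymp
  have m\<epsilon>: "(\<lambda>m. real m * (\<epsilon> m)\<^sup>2) \<longlonglongrightarrow> 1" unfolding \<epsilon>_def by real_asymp
  have \<tau>0: "\<tau> \<longlonglongrightarrow> (1 + 0) * 0\<^sup>2 * (1 + 18 * 0 * R ^ 4 / c0) / (1 - 2 * 0 * R)"
    unfolding \<tau>_def using c0 by (intro tendsto_intros \<epsilon>0) auto
  then have \<tau>0: "\<tau> \<longlonglongrightarrow> 0" by simp
  have "(\<lambda>m. (1 + \<epsilon> m) * (real m * (\<epsilon> m)\<^sup>2) * (1 + 18 * \<epsilon> m * R ^ 4 / c0) / (1 - 2 * \<epsilon> m * R)) \<longlonglongrightarrow>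
     (1 + 0) * 1 * (1 + 18 * 0 * R ^ 4 / c0) / (1 - 2 * 0 * R)"
    using c0 by (intro tendsto_intros \<epsilon>0 m\<epsilon>) auto
  then have m\<tau>: "(\<lambda>m. real m * \<tau> m) \<longlonglongrightarrow> 1" by (simp add: \<tau>_def mult_ac)
  define P where "P m = (A - (real m + 1) * \<tau> m) * (A - (real m + 2) * \<tau> m) / ((A - \<tau> m) * (A - 2 * \<tau> m))" for m :: nat
  have P: "P \<longlonglongrightarrow> (1 - c0)\<^sup>2"
  proof -
    have "(\<lambda>m. (A - (real m * \<tau> m + \<tau> m)) * (A - (real m * \<tau> m + 2 * \<tau> m)) / ((A - \<tau> m) * (A - 2 * \<tau> m)))
        \<longlonglongrightarrow> (A - (1 + 0)) * (A - (1 + 2 * 0)) / ((A - 0) * (A - 2 * 0))"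
      using A by (intro tendsto_intros m\<tau> \<tau>0) auto
    moreover have "(A - (1 + 0)) * (A - (1 + 2 * 0)) / ((A - 0) * (A - 2 * 0)) = (1 - c0)\<^sup>2"
      using c0 by (simp add: A_def field_simps power2_eq_square)
    ultimately show ?thesis by (simp add: P_def[abs_def] distrib_right)
  qed
  have walk_lim: "(\<lambda>m. walk b (\<epsilon> m) m (\<lambda>_. 0) x) \<longlonglongrightarrow> b x * exp (G x)" if x: "x \<in> X" for x
  proof -
    define q where "q m = (\<Sum>a\<in>I. (cosh (sqrt d * g a x / sqrt (real m)) - 1)) / d" for m :: nat
    have step_factor: "step_factor (\<epsilon> m) x = 1 + q m" for m
    proof -
      have "step_factor (\<epsilon> m) x = (\<Sum>t\<in>T. exp (\<epsilon> m * (snd t * sqrt d * g (fst t) x))) / (2 * d)"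
        unfolding step_factor_def card_T_eq lin_eq by (simp add: lin_s cong: sum.cong)
      also have "(\<Sum>t\<in>T. exp (\<epsilon> m * (snd t * sqrt d * g (fst t) x))) = (\<Sum>a\<in>I. 2 * (1 + (cosh (sqrt d * g a x / sqrt (real m)) - 1)))"
        unfolding sumT by (intro sum.cong refl) (simp add: cosh_field_def \<epsilon>_def)
      also have "\<dots> = 2 * (d + (\<Sum>a\<in>I. (cosh (sqrt d * g a x / sqrt (real m)) - 1)))"
        by (simp only: sum_distrib_left[symmetric] sum.distrib sum_constant d_def mult_1_right)
      finally show ?thesis using d by (simp add: q_def field_simps)
    qed
    have "(\<lambda>m. real m * (cosh (z / sqrt (real m)) - 1)) \<longlonglongrightarrow> z\<^sup>2 / 2" for z :: real
      unfolding power2_eq_square by real_asymp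
    then have "(\<lambda>m. (\<Sum>a\<in>I. real m * (cosh (sqrt d * g a x / sqrt (real m)) - 1)) / d) \<longlonglongrightarrow> (\<Sum>a\<in>I. (sqrt d * g a x)\<^sup>2 / 2) / d"
      using d by (intro tendsto_intros) auto
    also have "(\<lambda>m. (\<Sum>a\<in>I. real m * (cosh (sqrt d * g a x / sqrt (real m)) - 1)) / d) = (\<lambda>m. real m * q m)"
      by (simp add: q_def sum_distrib_left)
    also have "(\<Sum>a\<in>I. (sqrt d * g a x)\<^sup>2 / 2) / d = G x"
      using d by (simp add: G_def power_mult_distrib sum_divide_distrib sum_distrib_left)
    finally have "(\<lambda>m. (1 + q m) ^ m) \<longlonglongrightarrow> exp (G x)"
      using d by (intro tendsto_one_plus_power) (auto simp: q_def intro!: divide_nonneg_nonneg sum_nonneg cosh_real_ge_1)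
    then show ?thesis
      by (simp add: walk_def step_factor lin_eq tendsto_mult_left)
  qed
  have ineq: "\<forall>\<^sub>F m in sequentially. P m * went X (walk b (\<epsilon> m) m (\<lambda>_. 0)) F \<le> (\<Sum>j\<in>J. went (Y j) (walk b (\<epsilon> m) m (\<lambda>_. 0)) F)"
  proof -
    have "(\<lambda>m. 2 * \<epsilon> m * R) \<longlonglongrightarrow> 2 * 0 * R" by (intro tendsto_intros \<epsilon>0)
    then have 1: "\<forall>\<^sub>F m in sequentially. 2 * \<epsilon> m * R < 1" by (rule order_tendstoD) simp
    have "(\<lambda>m. real m * \<tau> m + 2 * \<tau> m) \<longlonglongrightarrow> 1 + 2 * 0" by (intro tendsto_intros m\<tau> \<tau>0)
    then have 2: "\<forall>\<^sub>F m in sequentially. real m * \<tau> m + 2 * \<tau> m < A" by (rule order_tendstoD) (use A in simp)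
    from 1 2 eventually_gt_at_top[of 0] show ?thesis
    proof eventually_elim
      case (elim m)
      have "0 < \<epsilon> m" using elim by (simp add: \<epsilon>_def)
      moreover have "(real m + 2) * \<tau> m < 1 / c0"
        using elim(2) by (simp add: A_def distrib_right)
      then have "(real m + 2) * ((1 + \<epsilon> m) * (\<epsilon> m)\<^sup>2 * (1 + 18 * \<epsilon> m * R ^ 4 / c0) / (1 - 2 * \<epsilon> m * R)) < 1 / c0"
        unfolding \<tau>_def .
      ultimately show ?case
        unfolding P_def \<tau>_def A_def using elim(1)
        by (intro random_walk_entropy(2)[OF b F J Y c0(1)]) (use var0 ent0 in \<open>auto simp: lin_eq[abs_def] sq_def\<close>)
    qed
  qed
  have "(\<lambda>m. P m * went X (walk b (\<epsilon> m) m (\<lambda>_. 0)) F) \<longlonglongrightarrow> (1 - c0)\<^sup>2 * went X (\<lambda>x. b x * exp (G x)) F"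
    using X b F walk_lim by (intro tendsto_mult P went_tendsto) auto
  moreover have "(\<lambda>m. \<Sum>j\<in>J. went (Y j) (walk b (\<epsilon> m) m (\<lambda>_. 0)) F) \<longlonglongrightarrow> (\<Sum>j\<in>J. went (Y j) (\<lambda>x. b x * exp (G x)) F)"
  proof (intro tendsto_sum went_tendsto)
    fix j assume j: "j \<in> J"
    show "finite (Y j)" using Y[OF j] X(1) by (rule finite_subset)
    fix x assume "x \<in> Y j"
    then have x: "x \<in> X" using Y[OF j] by auto
    show "(\<lambda>m. walk b (\<epsilon> m) m (\<lambda>_. 0) x) \<longlonglongrightarrow> b x * exp (G x)" by (rule walk_lim[OF x])
    show "0 < b x * exp (G x)" "0 \<le> F x" using b[OF x] F[OF x] by auto
  qed
  ultimately show ?thesis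
    using ineq unfolding G_def by (intro tendsto_le[OF _ _ _ ineq]) auto
qed

section \<open>Nonnegative definite matrices\<close>

text \<open>
  The quadratic form at \<open>v - t M v\<close> has constant term zero and is nonnegative, so its linear
  coefficient \<open>- 2 |M v|\<^sup>2\<close> vanishes.
\<close>

lemma psd_null_vector:
  fixes M :: "real^'n^'n"
  assumes sym: "transpose M = M" and psd: "\<And>x. 0 \<le> x \<bullet> (M *v x)" and v: "v \<bullet> (M *v v) = 0"
  shows "M *v v = 0"
proof -
  define y where "y = M *v v"
  have e: "(v - t *\<^sub>R y) \<bullet> (M *v (v - t *\<^sub>R y)) = - 2 * t * (y \<bullet> y) + t\<^sup>2 * (y \<bullet> (M *v y))" for t :: real
  proof -
    have "v \<bullet> (M *v y) = y \<bullet> y"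
      using sym dot_lmul_matrix[of v M y] by (simp add: y_def transpose_matrix_vector inner_commute flip: vector_transpose_matrix)
    then show ?thesis
      by (simp add: matrix_vector_mult_diff_distrib matrix_vector_mult_scaleR inner_diff_left inner_diff_right v[folded y_def]
        y_def[symmetric] power2_eq_square algebra_simps)
  qed
  define q where "q = y \<bullet> (M *v y)"
  have q: "0 \<le> q" unfolding q_def by (rule psd)
  have "0 \<le> - 2 * t * (y \<bullet> y) + t\<^sup>2 * q" for t
    using psd[of "v - t *\<^sub>R y"] unfolding e q_def .
  \<comment> \<open>The minimum over \<open>t\<close> is at \<open>(y \<bullet> y) / q\<close>; the denominator \<open>q + 1\<close> covers the case
    \<open>q = 0\<close>.\<close>
  from this[of "(y \<bullet> y) / (q + 1)"] have "0 \<le> - 2 * (y \<bullet> y)\<^sup>2 / (q + 1) + (y \<bullet> y)\<^sup>2 / (q + 1) * (q / (q + 1))"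
    by (simp add: power2_eq_square power_divide)
  also have "\<dots> \<le> - 2 * (y \<bullet> y)\<^sup>2 / (q + 1) + (y \<bullet> y)\<^sup>2 / (q + 1) * 1"
    using q by (intro add_left_mono mult_left_mono) auto
  also have "\<dots> = - ((y \<bullet> y)\<^sup>2 / (q + 1))" by simp
  finally have "(y \<bullet> y)\<^sup>2 / (q + 1) \<le> 0" by simp
  then have "(y \<bullet> y)\<^sup>2 \<le> 0" using q by (simp add: divide_le_0_iff)
  then show ?thesis by (simp add: y_def)
qed

text \<open>
  Eigenvectors for different eigenvalues are orthogonal. Finiteness is needed because \<open>Max\<close>
  of an infinite set carries no information.
\<close>

lemma finite_eigenvalues:
  fixes J :: "real^'n^'n"
  assumes sym: "transpose J = J"
  shows "finite {c. eigenvalue J c}"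
proof -
  have "\<forall>c\<in>{c. eigenvalue J c}. \<exists>v. v \<noteq> 0 \<and> J *v v = c *s v" by (auto simp: eigenvalue_def)
  from bchoice[OF this] obtain v where v: "\<And>c. eigenvalue J c \<Longrightarrow> v c \<noteq> 0 \<and> J *v v c = c *s v c" by auto
  let ?E = "{c. eigenvalue J c}"
  have orth: "v a \<bullet> v b = 0" if "a \<in> ?E" "b \<in> ?E" "a \<noteq> b" for a b
  proof -
    have "v a \<bullet> (J *v v b) = (J *v v a) \<bullet> v b"
      using sym dot_lmul_matrix[of "v a" J "v b"] by (metis transpose_matrix_vector)
    then have "b * (v a \<bullet> v b) = a * (v a \<bullet> v b)"
      using v[of a] v[of b] that by (simp add: scalar_mult_eq_scaleR)
    then show ?thesis using that(3) by simp
  qed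
  have "pairwise orthogonal (v ` ?E)"
    using orth unfolding pairwise_def orthogonal_def by blast
  moreover have "0 \<notin> v ` ?E" using v by auto
  ultimately have "independent (v ` ?E)" by (rule pairwise_orthogonal_independent)
  then have "finite (v ` ?E)" by (rule independent_imp_finite)
  moreover have "inj_on v ?E"
  proof (rule inj_onI, rule ccontr)
    fix a b assume ab: "a \<in> ?E" "b \<in> ?E" "v a = v b" "a \<noteq> b"
    then have "v a \<bullet> v a = 0" using orth[of a b] by simp
    then show False using v ab by auto
  qed
  ultimately show ?thesis by (rule finite_imageD)
qed

text \<open>
  If \<open>l\<close> is the maximum of the quadratic form on the unit sphere, attained at \<open>v\<close>, then
  \<open>l - J\<close> is nonnegative definite and vanishes at \<open>v\<close>, so \<open>v\<close> is an eigenvector by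
  \<open>psd_null_vector\<close>.
\<close>

lemma rayleigh_bound:
  fixes J :: "real^'n^'n"
  assumes J: "nonneg_definite J"
  shows "x \<bullet> (J *v x) \<le> largest_eigenvalue J * (x \<bullet> x)" "0 \<le> largest_eigenvalue J"
proof -
  have sym: "transpose J = J" and psd: "\<And>x. 0 \<le> x \<bullet> (J *v x)" using J by (auto simp: nonneg_definite_def)
  let ?S = "sphere (0::real^'n) 1"
  have "continuous_on ?S (\<lambda>x. x \<bullet> (J *v x))"
    by (intro continuous_intros linear_continuous_on matrix_vector_mul_bounded_linear)
  moreover have "?S \<noteq> {}" by simp
  ultimately obtain v where v: "v \<in> ?S" "\<And>y. y \<in> ?S \<Longrightarrow> y \<bullet> (J *v y) \<le> v \<bullet> (J *v v)"
    using continuous_attains_sup[of ?S "\<lambda>x. x \<bullet> (J *v x)"] compact_sphere by blast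
  define l where "l = v \<bullet> (J *v v)"
  have vv: "v \<bullet> v = 1" using v(1) by (simp add: dot_square_norm)
  have bound: "y \<bullet> (J *v y) \<le> l * (y \<bullet> y)" for y
  proof (cases "y = 0")
    case False
    define z where "z = (1 / norm y) *\<^sub>R y"
    have "z \<in> ?S" using False by (simp add: z_def)
    then have "z \<bullet> (J *v z) \<le> l" unfolding l_def by (rule v(2))
    then have "(y \<bullet> (J *v y)) / (norm y)\<^sup>2 \<le> l"
      by (simp add: z_def matrix_vector_mult_scaleR power2_eq_square)
    then show ?thesis using False by (simp add: divide_le_eq dot_square_norm)
  qed (simp add: matrix_vector_mult_0_right)
  define M where "M = l *\<^sub>R mat 1 - J"
  have Mx: "M *v y = l *\<^sub>R y - J *v y" for y
    by (simp add: M_def matrix_vector_mult_diff_rdistrib scaleR_matrix_vector_assoc[symmetric])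
  have "transpose M = M" using sym
    by (simp add: M_def transpose_def vec_eq_iff mat_def)
  moreover have "0 \<le> y \<bullet> (M *v y)" for y using bound[of y] by (simp add: Mx inner_diff_right)
  moreover have "v \<bullet> (M *v v) = 0" by (simp add: Mx inner_diff_right vv l_def)
  ultimately have "M *v v = 0" by (rule psd_null_vector)
  then have "J *v v = l *s v" by (simp add: Mx scalar_mult_eq_scaleR)
  moreover have "v \<noteq> 0" using vv by auto
  ultimately have "eigenvalue J l" by (auto simp: eigenvalue_def)
  then have "l \<le> largest_eigenvalue J"
    unfolding largest_eigenvalue_def using finite_eigenvalues[OF sym] by (intro Max_ge) auto
  moreover have "0 \<le> l" unfolding l_def by (rule psd)
  ultimately show "0 \<le> largest_eigenvalue J" "x \<bullet> (J *v x) \<le> largest_eigenvalue J * (x \<bullet> x)"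
    using bound[of x] mult_right_mono[of l "largest_eigenvalue J" "x \<bullet> x"] by auto
qed

text \<open>
  Cholesky factorization. If \<open>K l l > 0\<close>, subtracting the rank-one form \<open>u u\<^sup>T\<close> with
  \<open>u = K l / sqrt (K l l)\<close> clears row and column \<open>l\<close>, and what remains, the Schur
  complement, is nonnegative because it is a minimum of the form over the coordinate \<open>l\<close>. If
  \<open>K l l = 0\<close>, the row is already zero.
\<close>

lemma quadratic_form_factorization:
  fixes K :: "'n::finite \<Rightarrow> 'n \<Rightarrow> real"
  assumes sym: "\<And>i j. K i j = K j i" and psd: "\<And>x. 0 \<le> (\<Sum>i\<in>UNIV. \<Sum>j\<in>UNIV. K i j * x i * x j)"
    and supp: "\<And>i j. i \<notin> S \<Longrightarrow> K i j = 0"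
  shows "\<exists>w. \<forall>i j. K i j = (\<Sum>a\<in>S. w a i * w a j)"
  using finite[of S] sym psd supp
proof (induction S arbitrary: K rule: finite_induct)
  case empty
  then show ?case by auto
next
  case (insert l S)
  note sym = insert.prems(1) and psd = insert.prems(2) and supp = insert.prems(3)
  have expand: "(\<Sum>i\<in>UNIV. \<Sum>j\<in>UNIV. K i j * (x i + t * (if i = l then 1 else 0)) * (x j + t * (if j = l then 1 else 0)))
     = (\<Sum>i\<in>UNIV. \<Sum>j\<in>UNIV. K i j * x i * x j) + 2 * t * (\<Sum>j\<in>UNIV. K l j * x j) + t\<^sup>2 * K l l" for x t
  proof -
    have "(\<Sum>i\<in>UNIV. \<Sum>j\<in>UNIV. K i j * (x i + t * (if i = l then 1 else 0)) * (x j + t * (if j = l then 1 else 0)))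
      = (\<Sum>i\<in>UNIV. \<Sum>j\<in>UNIV. K i j * x i * x j + (if i = l then t * (K i j * x j) else 0)
          + (if j = l then t * (K i j * x i) else 0) + (if i = l then if j = l then t\<^sup>2 * K i j else 0 else 0))"
      by (intro sum.cong refl) (auto simp: algebra_simps power2_eq_square)
    also have "\<dots> = (\<Sum>i\<in>UNIV. \<Sum>j\<in>UNIV. K i j * x i * x j)
       + (\<Sum>i\<in>UNIV. \<Sum>j\<in>UNIV. if i = l then t * (K i j * x j) else 0)
       + (\<Sum>i\<in>UNIV. \<Sum>j\<in>UNIV. if j = l then t * (K i j * x i) else 0)
       + (\<Sum>i\<in>UNIV. \<Sum>j\<in>UNIV. if i = l then if j = l then t\<^sup>2 * K i j else 0 else 0)"
      by (simp only: sum.distrib)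
    also have "(\<Sum>i\<in>UNIV. \<Sum>j\<in>UNIV. if i = l then t * (K i j * x j) else 0) = t * (\<Sum>j\<in>UNIV. K l j * x j)"
      by (subst sum.swap) (simp add: sum_distrib_left)
    also have "(\<Sum>i\<in>UNIV. \<Sum>j\<in>UNIV. if j = l then t * (K i j * x i) else 0) = t * (\<Sum>j\<in>UNIV. K l j * x j)"
      using sym by (simp add: sum_distrib_left)
    also have "(\<Sum>i\<in>UNIV. \<Sum>j\<in>UNIV. if i = l then if j = l then t\<^sup>2 * K i j else 0 else 0) = t\<^sup>2 * K l l"
      by (subst sum.swap) simp
    finally show ?thesis by (simp add: algebra_simps)
  qed
  have nonneg: "0 \<le> (\<Sum>i\<in>UNIV. \<Sum>j\<in>UNIV. K i j * x i * x j) + 2 * t * (\<Sum>j\<in>UNIV. K l j * x j) + t\<^sup>2 * K l l" for x t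
    using psd[of "\<lambda>i. x i + t * (if i = l then 1 else 0)"] unfolding expand .
  show ?case
  proof (cases "K l l = 0")
    case True
    have "K l m = 0" for m
    proof (rule ccontr)
      assume "K l m \<noteq> 0"
      have s1: "(\<Sum>j\<in>UNIV. K l j * (if j = m then 1 else 0)) = K l m"
        by (simp add: if_distrib[of "(*) c" for c] cong: if_cong)
      have s2: "(\<Sum>i\<in>UNIV. \<Sum>j\<in>UNIV. K i j * (if i = m then 1 else 0) * (if j = m then 1 else 0)) = K m m"
        by (simp add: if_distrib[of "(*) c" for c] cong: if_cong)
      have "0 \<le> K m m + 2 * t * K l m" for t
        using nonneg[of "\<lambda>i. if i = m then 1 else 0" t] True unfolding s1 s2 by simp
      \<comment> \<open>An affine function of \<open>t\<close> with nonzero slope takes negative values.\<close>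
      from this[of "- (K m m + 1) / (2 * K l m)"] show False using \<open>K l m \<noteq> 0\<close> by (simp add: field_simps)
    qed
    then have "K i j = 0" if "i \<notin> S" for i j using supp[of i j] that by (cases "i = l") auto
    then obtain w where w: "\<forall>i j. K i j = (\<Sum>a\<in>S. w a i * w a j)"
      using insert.IH[of K] sym psd by blast
    define w' where "w' a = (if a = l then (\<lambda>_. 0) else w a)" for a
    have "K i j = (\<Sum>a\<in>insert l S. w' a i * w' a j)" for i j
      using w insert.hyps by (simp add: w'_def) (intro sum.cong, auto)
    then show ?thesis by blast
  next
    case False
    have pos: "0 < K l l"
      using nonneg[of "\<lambda>_. 0" 1] False by simp
    define u where "u i = K l i / sqrt (K l l)" for i
    define K' where "K' i j = K i j - u i * u j" for i j
    have uu: "u i * u j = K l i * K l j / K l l" for i j using pos by (simp add: u_def)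
    have "K' i j = K' j i" for i j using sym by (simp add: K'_def mult.commute)
    moreover have "0 \<le> (\<Sum>i\<in>UNIV. \<Sum>j\<in>UNIV. K' i j * x i * x j)" for x
    proof -
      define b where "b = (\<Sum>j\<in>UNIV. K l j * x j)"
      have "(\<Sum>i\<in>UNIV. \<Sum>j\<in>UNIV. K' i j * x i * x j) = (\<Sum>i\<in>UNIV. \<Sum>j\<in>UNIV. K i j * x i * x j - (K l i * x i) * (K l j * x j) / K l l)"
        unfolding K'_def uu by (intro sum.cong refl) (simp add: algebra_simps)
      also have "\<dots> = (\<Sum>i\<in>UNIV. \<Sum>j\<in>UNIV. K i j * x i * x j) - b * b / K l l"
        by (simp add: sum_subtractf b_def sum_product sum_divide_distrib)
      also have "\<dots> = (\<Sum>i\<in>UNIV. \<Sum>j\<in>UNIV. K i j * x i * x j) + 2 * (- b / K l l) * b + (- b / K l l)\<^sup>2 * K l l"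
        using pos by (simp add: power2_eq_square)
      also have "0 \<le> \<dots>" unfolding b_def by (rule nonneg)
      finally show ?thesis .
    qed
    moreover have "K' i j = 0" if "i \<notin> S" for i j
    proof (cases "i = l")
      case True
      then show ?thesis using pos uu[of i j] by (simp add: K'_def)
    next
      case False
      then have "K i j = 0" "K l i = 0" using supp[of i] that sym[of l i] by auto
      then show ?thesis using uu[of i j] by (simp add: K'_def)
    qed
    ultimately obtain w where w: "\<forall>i j. K' i j = (\<Sum>a\<in>S. w a i * w a j)"
      using insert.IH[of K'] by blast
    define w' where "w' a = (if a = l then u else w a)" for a
    have "K i j = (\<Sum>a\<in>insert l S. w' a i * w' a j)" for i j
    proof -
      have "(\<Sum>a\<in>S. w' a i * w' a j) = (\<Sum>a\<in>S. w a i * w a j)"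
        using insert.hyps by (intro sum.cong) (auto simp: w'_def)
      then show ?thesis using w[rule_format, of i j] insert.hyps by (simp add: w'_def K'_def)
    qed
    then show ?thesis by blast
  qed
qed

lemma quadratic_form_eq:
  fixes J :: "real^'n^'n"
  shows "x \<bullet> (J *v x) = (\<Sum>i\<in>UNIV. \<Sum>j\<in>UNIV. J $ i $ j * (x $ i) * (x $ j))"
proof -
  have "x \<bullet> (J *v x) = (\<Sum>i\<in>UNIV. \<Sum>j\<in>UNIV. x $ i * (J $ i $ j * x $ j))"
    by (simp add: inner_vec_def matrix_vector_mult_def sum_distrib_left)
  also have "\<dots> = (\<Sum>i\<in>UNIV. \<Sum>j\<in>UNIV. J $ i $ j * (x $ i) * (x $ j))"
    by (intro sum.cong refl) simp
  finally show ?thesis .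
qed

text \<open>
  The second property is the bound for \<open>w w\<^sup>T\<close> that corresponds to \<open>rayleigh_bound\<close> for
  \<open>J = w\<^sup>T w\<close>; both products have the same largest eigenvalue.
\<close>

theorem nonneg_definite_factorization:
  fixes J :: "real^'n^'n"
  assumes J: "nonneg_definite J"
  obtains w :: "'n \<Rightarrow> 'n \<Rightarrow> real" where
    "\<And>i j. J $ i $ j = (\<Sum>a\<in>UNIV. w a i * w a j)"
    "\<And>u :: 'n \<Rightarrow> real. (\<Sum>i\<in>UNIV. (\<Sum>a\<in>UNIV. u a * w a i)\<^sup>2) \<le> largest_eigenvalue J * (\<Sum>a\<in>UNIV. (u a)\<^sup>2)"
proof -
  have sym: "J $ i $ j = J $ j $ i" for i j
  proof -
    have "transpose J $ i $ j = J $ j $ i" by (simp add: transpose_def)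
    then show ?thesis using J by (simp add: nonneg_definite_def)
  qed
  have psd: "0 \<le> (\<Sum>i\<in>UNIV. \<Sum>j\<in>UNIV. J $ i $ j * x i * x j)" for x
  proof -
    have "0 \<le> (\<chi> i. x i) \<bullet> (J *v (\<chi> i. x i))" using J unfolding nonneg_definite_def by blast
    then show ?thesis by (simp add: quadratic_form_eq)
  qed
  have "\<exists>w. \<forall>i j. J $ i $ j = (\<Sum>a\<in>(UNIV :: 'n set). w a i * w a j)"
    by (rule quadratic_form_factorization) (fact sym psd | simp)+
  then obtain w where w: "\<And>i j. J $ i $ j = (\<Sum>a\<in>(UNIV :: 'n set). w a i * w a j)" by blast
  have "(\<Sum>i\<in>UNIV. (\<Sum>a\<in>UNIV. u a * w a i)\<^sup>2) \<le> largest_eigenvalue J * (\<Sum>a\<in>UNIV. (u a)\<^sup>2)" for u :: "'n \<Rightarrow> real"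
  proof -
    define l where "l = largest_eigenvalue J"
    define x where "x i = (\<Sum>a\<in>UNIV. u a * w a i)" for i
    define N where "N = (\<Sum>i\<in>UNIV. (x i)\<^sup>2)"
    have l: "0 \<le> l" unfolding l_def by (rule rayleigh_bound(2)[OF J])
    have quad: "(\<Sum>i\<in>UNIV. \<Sum>j\<in>UNIV. J $ i $ j * x i * x j) = (\<Sum>a\<in>UNIV. (\<Sum>i\<in>UNIV. w a i * x i)\<^sup>2)"
    proof -
      have "(\<Sum>i\<in>UNIV. \<Sum>j\<in>UNIV. J $ i $ j * x i * x j) = (\<Sum>i\<in>UNIV. \<Sum>j\<in>UNIV. \<Sum>a\<in>UNIV. (w a i * x i) * (w a j * x j))"
        by (intro sum.cong refl) (simp add: w sum_distrib_left sum_distrib_right algebra_simps)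
      also have "\<dots> = (\<Sum>i\<in>UNIV. \<Sum>a\<in>UNIV. \<Sum>j\<in>UNIV. (w a i * x i) * (w a j * x j))"
        by (intro sum.cong refl sum.swap)
      also have "\<dots> = (\<Sum>a\<in>UNIV. \<Sum>i\<in>UNIV. \<Sum>j\<in>UNIV. (w a i * x i) * (w a j * x j))" by (rule sum.swap)
      finally show ?thesis by (simp add: power2_eq_square sum_product)
    qed
    have wx: "(\<Sum>a\<in>UNIV. (\<Sum>i\<in>UNIV. w a i * x i)\<^sup>2) \<le> l * N"
    proof -
      have "(\<chi> i. x i) \<bullet> (J *v (\<chi> i. x i)) \<le> l * ((\<chi> i. x i) \<bullet> (\<chi> i. x i))"
        unfolding l_def by (rule rayleigh_bound(1)[OF J])
      then show ?thesis unfolding quadratic_form_eq quad[symmetric]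
        by (simp add: inner_vec_def N_def power2_eq_square)
    qed
    have "N = (\<Sum>a\<in>UNIV. u a * (\<Sum>i\<in>UNIV. w a i * x i))"
    proof -
      have "N = (\<Sum>i\<in>UNIV. \<Sum>a\<in>UNIV. u a * (w a i * x i))"
        unfolding N_def power2_eq_square by (subst (1) x_def) (simp add: sum_distrib_right mult.assoc)
      also have "\<dots> = (\<Sum>a\<in>UNIV. \<Sum>i\<in>UNIV. u a * (w a i * x i))" by (rule sum.swap)
      finally show ?thesis by (simp add: sum_distrib_left)
    qed
    then have "N\<^sup>2 \<le> (\<Sum>a\<in>UNIV. (u a)\<^sup>2) * (\<Sum>a\<in>UNIV. (\<Sum>i\<in>UNIV. w a i * x i)\<^sup>2)"
      using Cauchy_Schwarz_ineq_sum[of u "\<lambda>a. \<Sum>i\<in>UNIV. w a i * x i" UNIV] by simp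
    also have "\<dots> \<le> (\<Sum>a\<in>UNIV. (u a)\<^sup>2) * (l * N)"
      by (rule mult_left_mono) (simp_all add: wx sum_nonneg)
    finally have "N\<^sup>2 \<le> (\<Sum>a\<in>UNIV. (u a)\<^sup>2) * (l * N)" .
    then have "N * N \<le> (l * (\<Sum>a\<in>UNIV. (u a)\<^sup>2)) * N" by (simp add: power2_eq_square algebra_simps)
    moreover have "0 \<le> N" unfolding N_def by (simp add: sum_nonneg)
    moreover have "0 \<le> l * (\<Sum>a\<in>UNIV. (u a)\<^sup>2)" using l by (simp add: sum_nonneg)
    ultimately have "N \<le> l * (\<Sum>a\<in>UNIV. (u a)\<^sup>2)" by (cases "N = 0") (auto simp: mult_le_cancel_right)
    then show ?thesis by (simp add: N_def x_def l_def)
  qed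
  then show ?thesis using w that by blast
qed

section \<open>Quadratic interactions between spins with prescribed block counts\<close>

lemma wvar_scale:
  assumes "c \<noteq> 0"
  shows "wvar X (\<lambda>x. c * w x) f = wvar X w f"
proof -
  have "wmean X (\<lambda>x. c * w x) h = wmean X w h" for h
    using assms by (simp add: wmean_def mult.assoc sum_distrib_left[symmetric])
  then show ?thesis by (simp add: wvar_def)
qed

lemma wvar_shift:
  assumes "(\<Sum>x\<in>X. w x) \<noteq> 0"
  shows "wvar X w (\<lambda>x. c + f x) = wvar X w f"
proof -
  have "wmean X w (\<lambda>x. c + f x) = c + wmean X w f"
    using assms by (simp add: wmean_def distrib_left sum.distrib sum_distrib_right[symmetric] add_divide_distrib)
  then show ?thesis by (simp add: wvar_def)
qed

lemma wvar_cong: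
  assumes "\<And>x. x \<in> X \<Longrightarrow> w x = w' x" "\<And>x. x \<in> X \<Longrightarrow> f x = f' x"
  shows "wvar X w f = wvar X w' f'"
  unfolding wvar_def wmean_def by (simp add: assms cong: sum.cong)

text \<open>
  A spin \<open>\<plusminus>\<epsilon> x\<close> is \<open>2 \<epsilon> x\<close> times the indicator of \<open>x \<in> X\<close>, up to a constant. So for a given
  field the weight is a product weight up to a constant factor, and
  \<open>block_entropy_factorization\<close> and \<open>block_variance_bound\<close> provide the hypotheses of
  \<open>gaussian_mixture_entropy\<close>. The variance constant is \<open>2\<^sup>2 / 2 * \<Lambda> = 2 \<Lambda>\<close>; a larger \<open>c0\<close> is
  allowed in order to keep it positive when \<open>\<Lambda> = 0\<close>.
\<close>

theorem spin_block_entropy_factorization: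
  fixes \<beta> :: "'v \<Rightarrow> 'b" and c :: "'a \<Rightarrow> 'v \<Rightarrow> real" and \<epsilon> :: "'v \<Rightarrow> real"
  assumes V: "finite V" and I: "finite I" "I \<noteq> {}" and \<epsilon>: "\<And>x. x \<in> V \<Longrightarrow> (\<epsilon> x)\<^sup>2 = 1"
    and k: "\<And>X. X \<in> block_sets \<beta> V \<kappa> \<Longrightarrow> card X = k" and ne: "block_sets \<beta> V \<kappa> \<noteq> {}"
    and F: "\<And>X. X \<in> block_sets \<beta> V \<kappa> \<Longrightarrow> 0 \<le> F X"
    and c: "\<And>u. (\<Sum>x\<in>V. (\<Sum>a\<in>I. u a * c a x)\<^sup>2) \<le> \<Lambda> * (\<Sum>a\<in>I. (u a)\<^sup>2)"
    and c0: "2 * \<Lambda> \<le> c0" "0 < c0" "c0 < 1"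
  defines "g \<equiv> \<lambda>a X. \<Sum>x\<in>V. c a x * (if x \<in> X then \<epsilon> x else - \<epsilon> x)"
  shows "(1 - c0)\<^sup>2 * went (block_sets \<beta> V \<kappa>) (\<lambda>X. exp (1 / 2 * (\<Sum>a\<in>I. (g a X)\<^sup>2))) F
    \<le> (\<Sum>S\<in>{S. S \<subseteq> V \<and> card S + 1 = k}. went (above (block_sets \<beta> V \<kappa>) S) (\<lambda>X. exp (1 / 2 * (\<Sum>a\<in>I. (g a X)\<^sup>2))) F)"
proof -
  let ?B = "block_sets \<beta> V \<kappa>"
  define h where "h \<theta> x = (\<Sum>a\<in>I. \<theta> a * c a x)" for \<theta> x
  define C where "C \<theta> = - (\<Sum>x\<in>V. h \<theta> x * \<epsilon> x)" for \<theta>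
  have lin: "(\<Sum>a\<in>I. \<theta> a * g a X) = C \<theta> + (\<Sum>x\<in>X. 2 * (h \<theta> x * \<epsilon> x))" if X: "X \<subseteq> V" for \<theta> X
  proof -
    have "(\<Sum>a\<in>I. \<theta> a * g a X) = (\<Sum>a\<in>I. \<Sum>x\<in>V. \<theta> a * c a x * (if x \<in> X then \<epsilon> x else - \<epsilon> x))"
      by (simp only: g_def sum_distrib_left mult.assoc)
    also have "\<dots> = (\<Sum>x\<in>V. \<Sum>a\<in>I. \<theta> a * c a x * (if x \<in> X then \<epsilon> x else - \<epsilon> x))" by (rule sum.swap)
    also have "\<dots> = (\<Sum>x\<in>V. h \<theta> x * (if x \<in> X then \<epsilon> x else - \<epsilon> x))"
      by (simp only: h_def sum_distrib_right)
    also have "\<dots> = (\<Sum>x\<in>V. - (h \<theta> x * \<epsilon> x) + (if x \<in> X then 2 * (h \<theta> x * \<epsilon> x) else 0))"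
      by (intro sum.cong refl) auto
    also have "\<dots> = C \<theta> + (\<Sum>x\<in>V. if x \<in> X then 2 * (h \<theta> x * \<epsilon> x) else 0)"
      by (simp only: sum.distrib sum_negf C_def)
    also have "(\<Sum>x\<in>V. if x \<in> X then 2 * (h \<theta> x * \<epsilon> x) else 0) = (\<Sum>x\<in>X. 2 * (h \<theta> x * \<epsilon> x))"
      using V X by (intro sum.mono_neutral_cong_right) auto
    finally show ?thesis .
  qed
  have BV: "X \<subseteq> V" if "X \<in> ?B" for X using block_setsD[OF that] .
  define w where "w \<theta> x = exp (2 * (h \<theta> x * \<epsilon> x))" for \<theta> x
  have weight: "1 * exp (\<Sum>a\<in>I. \<theta> a * g a X) = exp (C \<theta>) * (\<Prod>x\<in>X. w \<theta> x)" if X: "X \<in> ?B" for \<theta> X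
    unfolding lin[OF BV[OF X]] w_def using finite_subset[OF BV[OF X] V] by (simp add: exp_add exp_sum)
  have AB: "X \<in> ?B" if "X \<in> above ?B S" for X S using that by (simp add: above_def)
  have wpos: "0 < (\<Prod>x\<in>X. w \<theta> x)" for X \<theta> by (intro prod_pos) (simp add: w_def)
  have fin: "finite ?B" by (rule finite_block_sets[OF V])
  have "(1 - c0)\<^sup>2 * went ?B (\<lambda>X. 1 * exp (1 / 2 * (\<Sum>a\<in>I. (g a X)\<^sup>2))) F
    \<le> (\<Sum>S\<in>{S. S \<subseteq> V \<and> card S + 1 = k}. went (above ?B S) (\<lambda>X. 1 * exp (1 / 2 * (\<Sum>a\<in>I. (g a X)\<^sup>2))) F)"
  proof (rule gaussian_mixture_entropy[OF fin ne I])
    show "finite {S. S \<subseteq> V \<and> card S + 1 = k}" by (rule finite_subset[of _ "Pow V"]) (auto simp: V)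
    show "above ?B S \<subseteq> ?B" for S by (auto simp: above_def)
    show "wvar ?B (\<lambda>X. 1 * exp (\<Sum>a\<in>I. \<theta> a * g a X)) (\<lambda>X. \<Sum>a\<in>I. u a * g a X) \<le> c0 * (\<Sum>a\<in>I. (u a)\<^sup>2)" for \<theta> u
    proof -
      have "wvar ?B (\<lambda>X. 1 * exp (\<Sum>a\<in>I. \<theta> a * g a X)) (\<lambda>X. \<Sum>a\<in>I. u a * g a X)
        = wvar ?B (\<lambda>X. exp (C \<theta>) * (\<Prod>x\<in>X. w \<theta> x)) (\<lambda>X. C u + (\<Sum>x\<in>X. 2 * (h u x * \<epsilon> x)))"
        by (intro wvar_cong weight lin BV)
      also have "\<dots> = wvar ?B (\<lambda>X. \<Prod>x\<in>X. w \<theta> x) (\<lambda>X. C u + (\<Sum>x\<in>X. 2 * (h u x * \<epsilon> x)))"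
        by (rule wvar_scale) simp
      also have "\<dots> = wvar ?B (\<lambda>X. \<Prod>x\<in>X. w \<theta> x) (\<lambda>X. \<Sum>x\<in>X. 2 * (h u x * \<epsilon> x))"
      proof (rule wvar_shift)
        have "0 < (\<Sum>X\<in>?B. \<Prod>x\<in>X. w \<theta> x)" by (rule sum_pos[OF fin ne wpos])
        then show "(\<Sum>X\<in>?B. \<Prod>x\<in>X. w \<theta> x) \<noteq> 0" by simp
      qed
      also have "\<dots> \<le> (\<Sum>x\<in>V. (2 * (h u x * \<epsilon> x))\<^sup>2) / 2"
        by (rule block_variance_bound[OF V _ k ne]) (simp_all add: w_def)
      also have "\<dots> = 2 * (\<Sum>x\<in>V. (h u x)\<^sup>2)"
        using \<epsilon> by (simp add: power_mult_distrib sum_distrib_left sum_divide_distrib)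
      also have "\<dots> \<le> 2 * (\<Lambda> * (\<Sum>a\<in>I. (u a)\<^sup>2))" unfolding h_def using c[of u] by simp
      also have "\<dots> \<le> c0 * (\<Sum>a\<in>I. (u a)\<^sup>2)"
        unfolding mult.assoc[symmetric] using c0(1) by (rule mult_right_mono) (simp add: sum_nonneg)
      finally show ?thesis .
    qed
    show "went ?B (\<lambda>X. 1 * exp (\<Sum>a\<in>I. \<theta> a * g a X)) F
        \<le> (\<Sum>S\<in>{S. S \<subseteq> V \<and> card S + 1 = k}. went (above ?B S) (\<lambda>X. 1 * exp (\<Sum>a\<in>I. \<theta> a * g a X)) F)" for \<theta>
    proof -
      have "went ?B (\<lambda>X. 1 * exp (\<Sum>a\<in>I. \<theta> a * g a X)) F = exp (C \<theta>) * went ?B (\<lambda>X. \<Prod>x\<in>X. w \<theta> x) F"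
        unfolding went_scale[of "exp (C \<theta>)", symmetric, OF exp_gt_zero] by (intro went_cong weight refl)
      also have "\<dots> \<le> exp (C \<theta>) * (\<Sum>S\<in>{S. S \<subseteq> V \<and> card S + 1 = k}. went (above ?B S) (\<lambda>X. \<Prod>x\<in>X. w \<theta> x) F)"
        using F by (intro mult_left_mono block_entropy_factorization[OF V _ k]) (auto simp: w_def)
      also have "\<dots> = (\<Sum>S\<in>{S. S \<subseteq> V \<and> card S + 1 = k}. went (above ?B S) (\<lambda>X. exp (C \<theta>) * (\<Prod>x\<in>X. w \<theta> x)) F)"
        unfolding sum_distrib_left by (intro sum.cong refl went_scale[symmetric] exp_gt_zero)
      also have "\<dots> = (\<Sum>S\<in>{S. S \<subseteq> V \<and> card S + 1 = k}. went (above ?B S) (\<lambda>X. 1 * exp (\<Sum>a\<in>I. \<theta> a * g a X)) F)"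
        by (intro sum.cong refl went_cong weight[symmetric] AB)
      finally show ?thesis .
    qed
  qed (use F c0 in auto)
  then show ?thesis by simp
qed

section \<open>Local entropies and exchanges\<close>

text \<open>
  By Jensen's inequality \<open>E[F] ln E[F] \<ge> E[F] E[ln F]\<close>, so the entropy is at most the
  covariance of \<open>F\<close> and \<open>ln F\<close>, here symmetrized over pairs.
\<close>

lemma went_le_covariance:
  assumes Q: "finite Q" "Q \<noteq> {}" and a: "\<And>x. x \<in> Q \<Longrightarrow> 0 < a x" and f: "\<And>x. x \<in> Q \<Longrightarrow> 0 < f x"
  shows "went Q a f \<le> (\<Sum>x\<in>Q. \<Sum>y\<in>Q. a x * a y * ((f x - f y) * (ln (f x) - ln (f y)))) / (2 * (\<Sum>x\<in>Q. a x))"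
proof -
  define Z U where "Z = (\<Sum>x\<in>Q. a x)" and "U = (\<Sum>x\<in>Q. a x * f x)"
  have Z: "0 < Z" unfolding Z_def using Q a by (intro sum_pos) auto
  have U: "0 < U" unfolding U_def using Q a f by (intro sum_pos) auto
  define E L where "E = (\<Sum>x\<in>Q. a x * (f x * ln (f x)))" and "L = (\<Sum>x\<in>Q. a x * ln (f x))"
  have "L - Z * ln (U / Z) \<le> 0"
  proof -
    have "L - Z * ln (U / Z) = (\<Sum>x\<in>Q. a x * (ln (f x) - ln (U / Z)))"
      by (simp add: L_def Z_def right_diff_distrib sum_subtractf sum_distrib_right)
    also have "\<dots> \<le> (\<Sum>x\<in>Q. a x * (f x / (U / Z) - 1))"
    proof (intro sum_mono mult_left_mono)
      fix x assume x: "x \<in> Q"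
      have "ln (f x / (U / Z)) \<le> f x / (U / Z) - 1" using f[OF x] U Z by (intro ln_le_minus_one) simp
      moreover have "ln (f x / (U / Z)) = ln (f x) - ln (U / Z)"
        using f[OF x] U Z by (intro ln_divide_pos) auto
      ultimately show "ln (f x) - ln (U / Z) \<le> f x / (U / Z) - 1" by simp
      show "0 \<le> a x" using a[OF x] by simp
    qed
    also have "\<dots> = (\<Sum>x\<in>Q. a x * f x * (Z / U) - a x)" using U Z by (intro sum.cong refl) (simp add: field_simps)
    also have "\<dots> = U * (Z / U) - Z" by (simp only: sum_subtractf sum_distrib_right[symmetric] U_def Z_def)
    also have "\<dots> = 0" using U by simp
    finally show ?thesis .
  qed
  then have "L / Z \<le> ln (U / Z)" using Z by (simp add: divide_le_eq mult.commute)
  then have "U * (L / Z) \<le> U * ln (U / Z)" using U by (intro mult_left_mono) auto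
  then have 1: "went Q a f \<le> E - U * L / Z" by (simp add: went_def E_def U_def Z_def)
  have eq: "(\<Sum>x\<in>Q. \<Sum>y\<in>Q. a x * a y * ((f x - f y) * (ln (f x) - ln (f y)))) = 2 * (Z * E - U * L)"
  proof -
    have "(\<Sum>x\<in>Q. \<Sum>y\<in>Q. a x * a y * ((f x - f y) * (ln (f x) - ln (f y)))) =
      (\<Sum>x\<in>Q. \<Sum>y\<in>Q. (a x * (f x * ln (f x))) * a y - (a x * f x) * (a y * ln (f y)) - (a x * ln (f x)) * (a y * f y) + a x * (a y * (f y * ln (f y))))"
      by (intro sum.cong refl) (simp add: algebra_simps)
    also have "\<dots> = E * Z - U * L - L * U + Z * E"
      unfolding E_def Z_def U_def L_def sum_product by (simp only: sum.distrib sum_subtractf)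
    finally show ?thesis by simp
  qed
  have "E - U * L / Z = (\<Sum>x\<in>Q. \<Sum>y\<in>Q. a x * a y * ((f x - f y) * (ln (f x) - ln (f y)))) / (2 * Z)"
    unfolding eq using Z by (simp add: field_simps)
  with 1 show ?thesis by (simp add: Z_def)
qed

lemma ln_difference_product_nonneg:
  fixes a b :: real
  assumes "0 \<le> a" "0 \<le> b" "a = 0 \<longleftrightarrow> b = 0"
  shows "0 \<le> (a - b) * (ln a - ln b)"
proof (cases "a = 0")
  case True
  then show ?thesis using assms by simp
next
  case False
  then have "0 < a" "0 < b" using assms by (auto simp: less_le)
  then show ?thesis by (cases "a \<le> b") (auto intro: mult_nonneg_nonneg mult_nonpos_nonpos)
qed

lemma block_swap_iff:
  assumes V: "finite V" and X: "X \<in> block_sets \<beta> V \<kappa>" and x: "x \<in> X" and y: "y \<in> V - X"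
  shows "insert y (X - {x}) \<in> block_sets \<beta> V \<kappa> \<longleftrightarrow> \<beta> y = \<beta> x"
proof -
  have XV: "X \<subseteq> V" by (rule block_setsD[OF X])
  have fin: "finite X" by (rule block_sets_finite_elem[OF V X])
  define c where "c b = card {z\<in>X - {x}. \<beta> z = b}" for b
  have cX: "\<kappa> b = (if \<beta> x = b then Suc (c b) else c b)" for b
  proof -
    have "card {z\<in>insert x (X - {x}). \<beta> z = b} = (if \<beta> x = b then Suc (c b) else c b)"
      unfolding c_def using fin by (intro card_block_insert) auto
    then show ?thesis using X x by (simp add: block_sets_def insert_absorb)
  qed
  have cY: "card {z\<in>insert y (X - {x}). \<beta> z = b} = (if \<beta> y = b then Suc (c b) else c b)" for b
    unfolding c_def using fin y by (intro card_block_insert) auto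
  have "(\<forall>b. (if \<beta> y = b then Suc (c b) else c b) = (if \<beta> x = b then Suc (c b) else c b)) \<longleftrightarrow> \<beta> y = \<beta> x"
    by (metis n_not_Suc_n)
  moreover have "insert y (X - {x}) \<subseteq> V" using XV y by auto
  ultimately show ?thesis unfolding block_sets_def mem_Collect_eq cY cX by blast
qed

text \<open>
  Both sides sum over the pairs of a member \<open>X\<close> of \<open>\<B>\<close> and an element \<open>x\<close> of \<open>X\<close>, with
  \<open>S = X - {x}\<close>.
\<close>

lemma sum_over_stars:
  fixes G :: "'v set \<Rightarrow> 'v \<Rightarrow> real"
  assumes V: "finite V" and k: "\<And>X. X \<in> \<B> \<Longrightarrow> card X = k" and BV: "\<And>X. X \<in> \<B> \<Longrightarrow> X \<subseteq> V"
  shows "(\<Sum>S\<in>{S. S \<subseteq> V \<and> card S + 1 = k}. \<Sum>x\<in>{x\<in>V - S. insert x S \<in> \<B>}. G (insert x S) x) = (\<Sum>X\<in>\<B>. \<Sum>x\<in>X. G X x)"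
proof -
  let ?\<S> = "{S. S \<subseteq> V \<and> card S + 1 = k}"
  have fin\<S>: "finite ?\<S>" by (rule finite_subset[of _ "Pow V"]) (auto simp: V)
  have fin\<B>: "finite \<B>" by (rule finite_subset[of _ "Pow V"]) (use BV V in auto)
  have finX: "finite X" if "X \<in> \<B>" for X using BV[OF that] V by (rule finite_subset)
  have "(\<Sum>S\<in>?\<S>. \<Sum>x\<in>{x\<in>V - S. insert x S \<in> \<B>}. G (insert x S) x)
     = (\<Sum>(S, x)\<in>Sigma ?\<S> (\<lambda>S. {x\<in>V - S. insert x S \<in> \<B>}). G (insert x S) x)"
    using fin\<S> V by (intro sum.Sigma) auto
  also have "\<dots> = (\<Sum>(X, x)\<in>Sigma \<B> (\<lambda>X. X). G X x)"
  proof (rule sum.reindex_bij_witness[where i="\<lambda>(X, x). (X - {x}, x)" and j="\<lambda>(S, x). (insert x S, x)"], goal_cases)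
    case (1 a)
    then show ?case by auto
  next
    case (2 a)
    then show ?case by auto
  next
    case (3 b)
    then show ?case by auto
  next
    case (4 b)
    then obtain X x where b: "b = (X, x)" "X \<in> \<B>" "x \<in> X" by auto
    have "card (X - {x}) + 1 = k" using k[OF b(2)] b(3) finX[OF b(2)]
      by (metis Suc_eq_plus1 card_Suc_Diff1)
    then show ?case using b BV[OF b(2)] by (auto simp: insert_absorb)
  next
    case (5 a)
    then show ?case by auto
  qed
  also have "\<dots> = (\<Sum>X\<in>\<B>. \<Sum>x\<in>X. G X x)"
    using fin\<B> finX by (intro sum.Sigma[symmetric]) auto
  finally show ?thesis .
qed

text \<open>
  The supersets of \<open>S\<close> are the sets \<open>insert x S\<close> with \<open>x\<close> in the free part \<open>Q S\<close> of one
  block, and any two of them differ by one exchange. In \<open>went_le_covariance\<close> a pair has the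
  coefficient \<open>a x a y\<close> over twice the total weight, and in the exchange form
  \<open>a x a y / (a x + a y)\<close> over the size of the block. The hypothesis \<open>ratio\<close> bounds
  \<open>card (Q S) * (a x + a y)\<close> by \<open>2 C\<close> times the total weight, and \<open>minority\<close> says that \<open>Q S\<close>
  contains at least half of the block.
\<close>

theorem star_entropy_le_exchange_form:
  fixes \<beta> :: "'v \<Rightarrow> 'b" and w F :: "'v set \<Rightarrow> real"
  assumes V: "finite V" and k: "\<And>X. X \<in> block_sets \<beta> V \<kappa> \<Longrightarrow> card X = k"
    and w: "\<And>X. X \<in> block_sets \<beta> V \<kappa> \<Longrightarrow> 0 < w X" and F: "\<And>X. X \<in> block_sets \<beta> V \<kappa> \<Longrightarrow> 0 \<le> F X"
    and C: "1 \<le> C"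
    and ratio: "\<And>X x y. X \<in> block_sets \<beta> V \<kappa> \<Longrightarrow> x \<in> X \<Longrightarrow> y \<in> V - X \<Longrightarrow> \<beta> y = \<beta> x \<Longrightarrow> w X \<le> C * w (insert y (X - {x}))"
    and zeros: "\<And>X x y. X \<in> block_sets \<beta> V \<kappa> \<Longrightarrow> x \<in> X \<Longrightarrow> y \<in> V - X \<Longrightarrow> \<beta> y = \<beta> x \<Longrightarrow>
        F X = 0 \<longleftrightarrow> F (insert y (X - {x})) = 0"
    and minority: "\<And>b. 2 * \<kappa> b \<le> card {x\<in>V. \<beta> x = b}"
  defines "h \<equiv> \<lambda>X Y. w X * w Y / (w X + w Y) * ((F X - F Y) * (ln (F X) - ln (F Y)))"
  shows "(\<Sum>S\<in>{S. S \<subseteq> V \<and> card S + 1 = k}. went (above (block_sets \<beta> V \<kappa>) S) w F)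
    \<le> 2 * C * (\<Sum>X\<in>block_sets \<beta> V \<kappa>. \<Sum>x\<in>X. \<Sum>y\<in>{y\<in>V - X. \<beta> y = \<beta> x}. h X (insert y (X - {x})) / card {z\<in>V. \<beta> z = \<beta> x})"
proof -
  let ?B = "block_sets \<beta> V \<kappa>"
  let ?\<S> = "{S. S \<subseteq> V \<and> card S + 1 = k}"
  define Q where "Q S = {x\<in>V - S. insert x S \<in> ?B}" for S
  define m where "m x = real (card {z\<in>V. \<beta> z = \<beta> x})" for x
  have BV: "X \<subseteq> V" if "X \<in> ?B" for X using block_setsD[OF that] .
  have swap: "(y \<in> Q S \<and> y \<noteq> x) \<longleftrightarrow> y \<in> V - insert x S \<and> \<beta> y = \<beta> x" if "x \<in> Q S" for x y S
  proof -
    have X: "insert x S \<in> ?B" "x \<notin> S" "x \<in> V" using that by (auto simp: Q_def)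
    have "insert x S - {x} = S" using X by auto
    then show ?thesis
      using block_swap_iff[OF V X(1), of x y] by (auto simp: Q_def)
  qed
  have hsym: "h X Y = h Y X" for X Y by (simp add: h_def algebra_simps)
  have local: "went (above ?B S) w F \<le> 2 * C * (\<Sum>x\<in>Q S. \<Sum>y\<in>{y\<in>V - insert x S. \<beta> y = \<beta> x}. h (insert x S) (insert y S) / m x)"
    if S: "S \<in> ?\<S>" for S
  proof -
    have finS: "finite S" using S V finite_subset by auto
    have inj: "inj_on (\<lambda>x. insert x S) (Q S)" by (rule inj_onI) (auto simp: Q_def)
    have im: "above ?B S = (\<lambda>x. insert x S) ` Q S"
    proof
      show "(\<lambda>x. insert x S) ` Q S \<subseteq> above ?B S" by (auto simp: Q_def above_def)
      show "above ?B S \<subseteq> (\<lambda>x. insert x S) ` Q S"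
      proof
        fix X assume "X \<in> above ?B S"
        then have X: "X \<in> ?B" "S \<subseteq> X" by (auto simp: above_def)
        have "card (X - S) = 1" using k[OF X(1)] S card_Diff_subset[OF finS X(2)] by auto
        then obtain x where x: "X - S = {x}" by (rule card_1_singletonE)
        then have "X = insert x S" using X(2) by auto
        moreover have "x \<in> Q S" using x X BV[OF X(1)] calculation by (auto simp: Q_def)
        ultimately show "X \<in> (\<lambda>x. insert x S) ` Q S" by auto
      qed
    qed
    define a f where "a x = w (insert x S)" and "f x = F (insert x S)" for x
    have went: "went (above ?B S) w F = went (Q S) a f"
      unfolding went_def im sum.reindex[OF inj] by (simp add: a_def f_def)
    have a: "0 < a x" and f: "0 \<le> f x" if "x \<in> Q S" for x using that w F by (auto simp: Q_def a_def f_def)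
    have finQ: "finite (Q S)" using V by (auto simp: Q_def)
    define H where "H x y = a x * a y / (a x + a y) * ((f x - f y) * (ln (f x) - ln (f y)))" for x y
    have hH: "h (insert x S) (insert y S) = H x y" for x y by (simp add: h_def H_def a_def f_def)
    have ratioQ: "a x \<le> C * a y" if "x \<in> Q S" "y \<in> Q S" for x y
    proof (cases "x = y")
      case True
      then show ?thesis using a[OF that(1)] C mult_right_mono[of 1 C "a x"] by simp
    next
      case False
      then have "y \<in> V - insert x S" "\<beta> y = \<beta> x" using swap[OF that(1), of y] that(2) by auto
      moreover have "insert x S - {x} = S" using that by (auto simp: Q_def)
      ultimately show ?thesis
        using ratio[of "insert x S" x y] that(1) by (simp add: Q_def a_def)
    qed
    have zeroQ: "f x = 0 \<longleftrightarrow> f y = 0" if "x \<in> Q S" "y \<in> Q S" for x y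
    proof (cases "x = y")
      case False
      then have "y \<in> V - insert x S" "\<beta> y = \<beta> x" using swap[OF that(1), of y] that(2) by auto
      moreover have "insert x S - {x} = S" using that by (auto simp: Q_def)
      ultimately show ?thesis
        using zeros[of "insert x S" x y] that(1) by (simp add: Q_def f_def)
    qed simp
    have H0: "0 \<le> H x y" if "x \<in> Q S" "y \<in> Q S" for x y
    proof -
      have "0 \<le> (f x - f y) * (ln (f x) - ln (f y))"
        by (rule ln_difference_product_nonneg[OF f[OF that(1)] f[OF that(2)] zeroQ[OF that]])
      moreover have "0 \<le> a x * a y / (a x + a y)" using a[OF that(1)] a[OF that(2)] by simp
      ultimately show ?thesis unfolding H_def by (rule mult_nonneg_nonneg[rotated])
    qed
    have rhs: "(\<Sum>x\<in>Q S. \<Sum>y\<in>{y\<in>V - insert x S. \<beta> y = \<beta> x}. h (insert x S) (insert y S) / m x) = (\<Sum>x\<in>Q S. \<Sum>y\<in>Q S. H x y / m x)"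
    proof (rule sum.cong[OF refl])
      fix x assume x: "x \<in> Q S"
      have "{y\<in>V - insert x S. \<beta> y = \<beta> x} = Q S - {x}" using swap[OF x] by blast
      then have "(\<Sum>y\<in>{y\<in>V - insert x S. \<beta> y = \<beta> x}. h (insert x S) (insert y S) / m x) = (\<Sum>y\<in>Q S - {x}. H x y / m x)"
        by (simp add: hH)
      also have "\<dots> = (\<Sum>y\<in>Q S. H x y / m x)"
        using finQ by (intro sum.mono_neutral_left) (auto simp: H_def)
      finally show "(\<Sum>y\<in>{y\<in>V - insert x S. \<beta> y = \<beta> x}. h (insert x S) (insert y S) / m x) = (\<Sum>y\<in>Q S. H x y / m x)" .
    qed
    have m0: "0 \<le> m x" for x by (simp add: m_def)
    show ?thesis
    proof (cases "\<forall>x\<in>Q S. f x = 0")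
      case True
      then have "went (Q S) a f = 0" by (simp add: went_def)
      then show ?thesis unfolding went rhs using H0 m0 C
        by (intro order_trans[OF _ mult_nonneg_nonneg]) (auto intro!: sum_nonneg divide_nonneg_nonneg)
    next
      case False
      then obtain x0 where x0: "x0 \<in> Q S" "f x0 \<noteq> 0" by auto
      have fpos: "0 < f x" if "x \<in> Q S" for x using zeroQ[OF that x0(1)] x0(2) f[OF that] by simp
      have ne: "Q S \<noteq> {}" using x0 by auto
      define A where "A = (\<Sum>x\<in>Q S. a x)"
      have A: "0 < A" unfolding A_def using finQ ne a by (intro sum_pos) auto
      have cardQ: "m x \<le> 2 * real (card (Q S))" if x: "x \<in> Q S" for x
      proof -
        have "Q S = insert x (Q S - {x})" using x by auto
        also have "Q S - {x} = {y\<in>V - insert x S. \<beta> y = \<beta> x}" using swap[OF x] by blast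
        finally have "Q S = insert x {y\<in>V - insert x S. \<beta> y = \<beta> x}" .
        then have "Q S = {z\<in>V. \<beta> z = \<beta> x} - {z\<in>S. \<beta> z = \<beta> x}" using x by (auto simp: Q_def)
        moreover have "card ({z\<in>V. \<beta> z = \<beta> x} - {z\<in>S. \<beta> z = \<beta> x}) = card {z\<in>V. \<beta> z = \<beta> x} - card {z\<in>S. \<beta> z = \<beta> x}"
          using finS S by (intro card_Diff_subset) auto
        moreover have "card {z\<in>S. \<beta> z = \<beta> x} \<le> \<kappa> (\<beta> x)"
        proof -
          have "card {z\<in>S. \<beta> z = \<beta> x} \<le> card {z\<in>insert x S. \<beta> z = \<beta> x}" using finS by (intro card_mono) auto
          also have "\<dots> = \<kappa> (\<beta> x)" using x by (simp add: Q_def block_sets_def)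
          finally show ?thesis .
        qed
        ultimately show ?thesis using minority[of "\<beta> x"] by (simp add: m_def)
      qed
      have mpos: "0 < m x" if "x \<in> Q S" for x
      proof -
        have "x \<in> {z\<in>V. \<beta> z = \<beta> x}" using that by (auto simp: Q_def)
        then show ?thesis unfolding m_def using V by (auto simp: card_gt_0_iff)
      qed
      have bnd: "a x * a y * ((f x - f y) * (ln (f x) - ln (f y))) / (2 * A) \<le> 2 * C * (H x y / m x)"
        if x: "x \<in> Q S" and y: "y \<in> Q S" for x y
      proof -
        have "real (card (Q S)) * a x \<le> (\<Sum>z\<in>Q S. C * a z)"
          using sum_mono[of "Q S" "\<lambda>_. a x" "\<lambda>z. C * a z"] ratioQ[OF x] by simp
        moreover have "real (card (Q S)) * a y \<le> (\<Sum>z\<in>Q S. C * a z)"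
          using sum_mono[of "Q S" "\<lambda>_. a y" "\<lambda>z. C * a z"] ratioQ[OF y] by simp
        ultimately have 1: "real (card (Q S)) * (a x + a y) \<le> 2 * C * A"
          by (simp add: A_def sum_distrib_left[symmetric] distrib_left)
        have axy: "0 < a x + a y" using a[OF x] a[OF y] by simp
        have "m x * (a x + a y) \<le> 2 * real (card (Q S)) * (a x + a y)"
          using cardQ[OF x] axy by (intro mult_right_mono) auto
        then have 2: "m x * (a x + a y) \<le> 2 * C * (2 * A)" using 1 by simp
        have "a x * a y * ((f x - f y) * (ln (f x) - ln (f y))) / (2 * A) = H x y * ((a x + a y) / (2 * A))"
          using axy by (simp add: H_def)
        also have "\<dots> \<le> H x y * (2 * C / m x)"
        proof (rule mult_left_mono[OF _ H0[OF x y]])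
          show "(a x + a y) / (2 * A) \<le> 2 * C / m x"
            using 2 A mpos[OF x] by (simp add: divide_le_eq le_divide_eq mult.commute)
        qed
        also have "\<dots> = 2 * C * (H x y / m x)" by simp
        finally show ?thesis .
      qed
      have "went (Q S) a f \<le> (\<Sum>x\<in>Q S. \<Sum>y\<in>Q S. a x * a y * ((f x - f y) * (ln (f x) - ln (f y)))) / (2 * A)"
        unfolding A_def by (rule went_le_covariance[OF finQ ne a fpos])
      also have "\<dots> = (\<Sum>x\<in>Q S. \<Sum>y\<in>Q S. a x * a y * ((f x - f y) * (ln (f x) - ln (f y))) / (2 * A))"
        by (simp only: sum_divide_distrib)
      also have "\<dots> \<le> (\<Sum>x\<in>Q S. \<Sum>y\<in>Q S. 2 * C * (H x y / m x))"
        by (intro sum_mono bnd)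
      also have "\<dots> = 2 * C * (\<Sum>x\<in>Q S. \<Sum>y\<in>Q S. H x y / m x)"
        by (simp only: sum_distrib_left)
      finally show ?thesis unfolding went rhs .
    qed
  qed
  have "(\<Sum>S\<in>?\<S>. went (above ?B S) w F) \<le> (\<Sum>S\<in>?\<S>. 2 * C * (\<Sum>x\<in>Q S. \<Sum>y\<in>{y\<in>V - insert x S. \<beta> y = \<beta> x}. h (insert x S) (insert y S) / m x))"
    by (rule sum_mono[OF local])
  also have "\<dots> = 2 * C * (\<Sum>S\<in>?\<S>. \<Sum>x\<in>Q S. \<Sum>y\<in>{y\<in>V - insert x S. \<beta> y = \<beta> x}. h (insert x S) (insert y (insert x S - {x})) / m x)"
    unfolding sum_distrib_left[symmetric]
    by (intro arg_cong2[where f="(*)"] refl sum.cong) (auto simp: Q_def)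
  also have "(\<Sum>S\<in>?\<S>. \<Sum>x\<in>Q S. \<Sum>y\<in>{y\<in>V - insert x S. \<beta> y = \<beta> x}. h (insert x S) (insert y (insert x S - {x})) / m x)
     = (\<Sum>X\<in>?B. \<Sum>x\<in>X. \<Sum>y\<in>{y\<in>V - X. \<beta> y = \<beta> x}. h X (insert y (X - {x})) / m x)"
    unfolding Q_def by (rule sum_over_stars[OF V k BV])
  finally show ?thesis by (simp add: m_def)
qed

section \<open>Replica configurations as sets of minority sites\<close>

lemma ising_weight_pos: "0 < ising_weight J \<eta>"
  by (simp add: ising_weight_def)

lemma row_sum_le: "(\<Sum>j\<in>UNIV. \<bar>J $ i $ j\<bar>) \<le> max_abs_row_sum J"
  unfolding max_abs_row_sum_def by (intro Max_ge) auto

lemma max_abs_row_sum_nonneg: "0 \<le> max_abs_row_sum J"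
proof -
  have "0 \<le> (\<Sum>j\<in>UNIV. \<bar>J $ undefined $ j\<bar>)" by (simp add: sum_nonneg)
  then show ?thesis using row_sum_le[of J undefined] by linarith
qed

lemma OmegaD: "\<eta> \<in> Omega \<Longrightarrow> \<eta> l = -1 \<or> \<eta> l = 1"
  by (auto simp: Omega_def)

lemma Omega_update: "\<eta> \<in> Omega \<Longrightarrow> a = -1 \<or> a = 1 \<Longrightarrow> \<eta>(l := a) \<in> Omega"
  by (auto simp: Omega_def Pi_iff)

text \<open>
  Only row and column \<open>l\<close> of the interaction are affected, and each product of two spins
  changes at most by 2. With the factor 1/2 in the exponent this gives \<open>(2 + 2) / 2 = 2\<close>
  times the row sum.
\<close>

lemma ising_weight_spin_change:
  fixes J :: "real^'n^'n"
  assumes J: "transpose J = J" and \<eta>: "\<eta> \<in> Omega" and a: "a = -1 \<or> a = 1"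
  shows "ising_weight J \<eta> \<le> exp (2 * max_abs_row_sum J) * ising_weight J (\<eta>(l := a))"
proof -
  define \<xi> where "\<xi> = \<eta>(l := a)"
  have \<xi>: "\<xi> \<in> Omega" unfolding \<xi>_def by (rule Omega_update[OF \<eta> a])
  have sym: "J $ i $ j = J $ j $ i" for i j
  proof -
    have "transpose J $ i $ j = J $ j $ i" by (simp add: transpose_def)
    then show ?thesis using J by simp
  qed
  have "(\<Sum>i\<in>UNIV. \<Sum>j\<in>UNIV. J $ i $ j * \<eta> i * \<eta> j) - (\<Sum>i\<in>UNIV. \<Sum>j\<in>UNIV. J $ i $ j * \<xi> i * \<xi> j)
     = (\<Sum>i\<in>UNIV. \<Sum>j\<in>UNIV. J $ i $ j * (\<eta> i * \<eta> j - \<xi> i * \<xi> j))"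
    by (simp add: sum_subtractf[symmetric] right_diff_distrib mult.assoc)
  also have "\<dots> \<le> (\<Sum>i\<in>UNIV. \<Sum>j\<in>UNIV. (if i = l then 2 * \<bar>J $ i $ j\<bar> else 0) + (if j = l then 2 * \<bar>J $ i $ j\<bar> else 0))"
  proof (intro sum_mono)
    fix i j
    have "\<bar>\<eta> i * \<eta> j - \<xi> i * \<xi> j\<bar> \<le> (if i = l then 2 else 0) + (if j = l then 2 else 0)"
      using OmegaD[OF \<eta>, of i] OmegaD[OF \<eta>, of j] OmegaD[OF \<xi>, of i] OmegaD[OF \<xi>, of j] by (auto simp: \<xi>_def)
    then have "\<bar>J $ i $ j\<bar> * \<bar>\<eta> i * \<eta> j - \<xi> i * \<xi> j\<bar> \<le> \<bar>J $ i $ j\<bar> * ((if i = l then 2 else 0) + (if j = l then 2 else 0))"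
      by (rule mult_left_mono) simp
    moreover have "J $ i $ j * (\<eta> i * \<eta> j - \<xi> i * \<xi> j) \<le> \<bar>J $ i $ j\<bar> * \<bar>\<eta> i * \<eta> j - \<xi> i * \<xi> j\<bar>"
      unfolding abs_mult[symmetric] by (rule abs_ge_self)
    ultimately show "J $ i $ j * (\<eta> i * \<eta> j - \<xi> i * \<xi> j)
       \<le> (if i = l then 2 * \<bar>J $ i $ j\<bar> else 0) + (if j = l then 2 * \<bar>J $ i $ j\<bar> else 0)"
      by (auto split: if_splits)
  qed
  also have "\<dots> = (\<Sum>i\<in>UNIV. \<Sum>j\<in>UNIV. if i = l then 2 * \<bar>J $ i $ j\<bar> else 0) + (\<Sum>i\<in>UNIV. \<Sum>j\<in>UNIV. if j = l then 2 * \<bar>J $ i $ j\<bar> else 0)"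
    by (simp only: sum.distrib)
  also have "(\<Sum>i\<in>UNIV. \<Sum>j\<in>UNIV. if i = l then 2 * \<bar>J $ i $ j\<bar> else 0) = 2 * (\<Sum>j\<in>UNIV. \<bar>J $ l $ j\<bar>)"
    by (subst sum.swap) (simp add: sum_distrib_left)
  also have "(\<Sum>i\<in>UNIV. \<Sum>j\<in>UNIV. if j = l then 2 * \<bar>J $ i $ j\<bar> else 0) = 2 * (\<Sum>j\<in>UNIV. \<bar>J $ l $ j\<bar>)"
    by (simp add: sum_distrib_left sym[of _ l])
  also have "2 * (\<Sum>j\<in>UNIV. \<bar>J $ l $ j\<bar>) + 2 * (\<Sum>j\<in>UNIV. \<bar>J $ l $ j\<bar>) \<le> 4 * max_abs_row_sum J"
    using row_sum_le[of J l] by simp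
  finally have "1/2 * (\<Sum>i\<in>UNIV. \<Sum>j\<in>UNIV. J $ i $ j * \<eta> i * \<eta> j)
      \<le> 2 * max_abs_row_sum J + 1/2 * (\<Sum>i\<in>UNIV. \<Sum>j\<in>UNIV. J $ i $ j * \<xi> i * \<xi> j)" by simp
  then show ?thesis
    unfolding ising_weight_def \<xi>_def[symmetric] by (simp add: exp_add[symmetric])
qed

locale replica_setting =
  fixes J :: "real^'n^'n" and \<A> :: "'n set set" and N :: nat and \<rho> :: "'n set \<Rightarrow> real"
  assumes partition: "partition_on UNIV \<A>" and N: "1 \<le> N" and \<rho>: "\<rho> \<in> density_profiles \<A> N"
    and sym: "transpose J = J"
begin

definition sites :: "(nat \<times> 'n) set" where "sites = {1..N} \<times> UNIV"

definition block_of :: "'n \<Rightarrow> 'n set" where "block_of l = (THE A. A \<in> \<A> \<and> l \<in> A)"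

definition label :: "nat \<times> 'n \<Rightarrow> 'n set" where "label x = block_of (snd x)"

text \<open>
  The number of spins +1 in block \<open>A\<close>, over all replicas. The membership condition for
  \<open>density_profiles\<close> makes the rounding exact.
\<close>

definition up_count :: "'n set \<Rightarrow> nat" where "up_count A = nat \<lfloor>real N * real (card A) * \<rho> A\<rfloor>"

text \<open>
  The spin value that at most half of the spins of block \<open>A\<close> have. The sites with this value
  are treated as particles, so that at least half of each block remains free.
\<close>

definition minority_sign :: "'n set \<Rightarrow> real" where "minority_sign A = (if 2 * up_count A \<le> N * card A then 1 else -1)"

text \<open>
  The number of particles in a block. Sets that are no blocks label no site, and the value 0
  makes the condition of \<open>block_sets\<close> at these labels trivial.
\<close>

definition \<kappa> :: "'n set \<Rightarrow> nat" where
  "\<kappa> A = (if A \<in> \<A> then if 2 * up_count A \<le> N * card A then up_count A else N * card A - up_count A else 0)"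

definition decode :: "(nat \<times> 'n) set \<Rightarrow> 'n replicas" where
  "decode X = (\<lambda>i\<in>{1..N}. \<lambda>l. if (i, l) \<in> X then minority_sign (block_of l) else - minority_sign (block_of l))"

definition encode :: "'n replicas \<Rightarrow> (nat \<times> 'n) set" where
  "encode \<sigma> = {x\<in>sites. \<sigma> (fst x) (snd x) = minority_sign (label x)}"

definition W :: "'n replicas \<Rightarrow> real" where
  "W \<sigma> = (\<Prod>i\<in>{1..N}. ising_weight J (\<sigma> i))"

abbreviation "\<B> \<equiv> block_sets label sites \<kappa>"
abbreviation "\<Omega> \<equiv> Omega_N \<A> N \<rho>"

lemma finite_sites: "finite sites" by (simp add: sites_def)

lemma W_pos: "0 < W \<sigma>" unfolding W_def by (intro prod_pos) (simp add: ising_weight_pos)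

lemma minority_sign_cases: "minority_sign A = -1 \<or> minority_sign A = 1" by (simp add: minority_sign_def)

lemma block_of_eqI: "A \<in> \<A> \<Longrightarrow> l \<in> A \<Longrightarrow> block_of l = A"
  unfolding block_of_def using partition
  by (intro the_equality) (auto simp: partition_on_def disjoint_def)

lemma block_of: "block_of l \<in> \<A>" "l \<in> block_of l"
proof -
  obtain A where "A \<in> \<A>" "l \<in> A" using partition by (auto simp: partition_on_def)
  then show "block_of l \<in> \<A>" "l \<in> block_of l" using block_of_eqI by auto
qed

lemma block_of_eq_iff: "A \<in> \<A> \<Longrightarrow> block_of l = A \<longleftrightarrow> l \<in> A"
  using block_of_eqI block_of by auto

lemma block_kernel_eq: "block_kernel \<A> l k = (if block_of k = block_of l then 1 / real (card (block_of l)) else 0)"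
proof -
  have "(\<exists>A\<in>\<A>. l \<in> A \<and> k \<in> A) \<longleftrightarrow> block_of k = block_of l" using block_of block_of_eqI by metis
  moreover have "(THE A. A \<in> \<A> \<and> l \<in> A \<and> k \<in> A) = block_of l" if "block_of k = block_of l"
  proof (rule the_equality)
    show "block_of l \<in> \<A> \<and> l \<in> block_of l \<and> k \<in> block_of l" using block_of(1)[of l] block_of(2)[of l] block_of(2)[of k] that by simp
    show "A = block_of l" if "A \<in> \<A> \<and> l \<in> A \<and> k \<in> A" for A using block_of_eqI[of A l] that by simp
  qed
  ultimately show ?thesis by (simp add: block_kernel_def)
qed

lemma card_label: "card {x\<in>sites. label x = b} = (if b \<in> \<A> then N * card b else 0)"
proof (cases "b \<in> \<A>")
  case True
  then have "{x\<in>sites. label x = b} = {1..N} \<times> b" by (auto simp: sites_def label_def block_of_eq_iff)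
  then show ?thesis using True by (simp add: card_cartesian_product)
next
  case False
  then have "{x\<in>sites. label x = b} = {}" using block_of(1) by (auto simp: label_def)
  then have "card {x\<in>sites. label x = b} = 0" by (simp only: card.empty)
  then show ?thesis using False by simp
qed

lemma up_count_density:
  assumes "A \<in> \<A>"
  shows "real (up_count A) = real N * real (card A) * \<rho> A" "up_count A \<le> N * card A"
proof -
  have r: "0 \<le> \<rho> A" "\<rho> A \<le> 1" "real N * real (card A) * \<rho> A \<in> \<nat>" using \<rho> assms by (auto simp: density_profiles_def)
  then obtain q where q: "real N * real (card A) * \<rho> A = real q" by (auto elim: Nats_cases)
  then show 1: "real (up_count A) = real N * real (card A) * \<rho> A" by (simp add: up_count_def)
  have "real N * real (card A) * \<rho> A \<le> real N * real (card A) * 1" using r by (intro mult_left_mono) auto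
  then have "real (up_count A) \<le> real (N * card A)" using 1 by simp
  then show "up_count A \<le> N * card A" by (simp only: of_nat_le_iff)
qed

lemma minority: "2 * \<kappa> b \<le> card {x\<in>sites. label x = b}"
  using up_count_density(2)[of b] by (auto simp: card_label \<kappa>_def)

lemma decode_encode:
  assumes "\<sigma> \<in> {1..N} \<rightarrow>\<^sub>E Omega"
  shows "decode (encode \<sigma>) = \<sigma>"
proof
  fix i
  show "decode (encode \<sigma>) i = \<sigma> i"
  proof (cases "i \<in> {1..N}")
    case True
    then have "\<sigma> i \<in> Omega" using assms by auto
    then have "\<sigma> i l = -1 \<or> \<sigma> i l = 1" for l by (rule OmegaD)
    then show ?thesis using True minority_sign_cases
      by (auto simp: decode_def encode_def sites_def label_def fun_eq_iff) (metis minus_minus)+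
  next
    case False
    then show ?thesis using assms by (auto simp: decode_def PiE_def extensional_def)
  qed
qed

lemma encode_decode:
  assumes "X \<subseteq> sites"
  shows "encode (decode X) = X"
proof -
  have "minority_sign A \<noteq> - minority_sign A" for A using minority_sign_cases[of A] by auto
  then show ?thesis using assms by (auto simp: decode_def encode_def sites_def label_def)
qed

lemma decode_PiE: "decode X \<in> {1..N} \<rightarrow>\<^sub>E Omega"
  using minority_sign_cases by (auto simp: decode_def Omega_def) (metis minus_minus)+

lemma decode_block_sum:
  assumes A: "A \<in> \<A>" and X: "X \<subseteq> sites"
  shows "(\<Sum>i\<in>{1..N}. \<Sum>l\<in>A. decode X i l) = minority_sign A * (2 * real (card {x\<in>X. label x = A}) - real (N * card A))"
proof -
  let ?S = "{x\<in>X. label x = A}"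
  have S: "?S \<subseteq> {1..N} \<times> A" using X A by (auto simp: sites_def label_def block_of_eq_iff)
  have "(\<Sum>i\<in>{1..N}. \<Sum>l\<in>A. decode X i l) = (\<Sum>i\<in>{1..N}. \<Sum>l\<in>A. minority_sign A * ((if (i, l) \<in> ?S then 2 else 0) - 1))"
    using A by (intro sum.cong refl) (auto simp: decode_def label_def block_of_eqI)
  also have "\<dots> = (\<Sum>x\<in>{1..N} \<times> A. minority_sign A * ((if x \<in> ?S then 2 else 0) - 1))"
    by (simp add: sum.cartesian_product case_prod_unfold)
  also have "\<dots> = minority_sign A * ((\<Sum>x\<in>{1..N} \<times> A. if x \<in> ?S then 2 else 0) - real (card ({1..N} \<times> A)))"
    by (simp only: sum_distrib_left[symmetric] sum_subtractf) simp
  also have "(\<Sum>x\<in>{1..N} \<times> A. if x \<in> ?S then 2 else 0) = (\<Sum>x\<in>?S. 2 :: real)"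
    using S by (intro sum.mono_neutral_cong_right) auto
  finally show ?thesis by (simp add: card_cartesian_product)
qed

lemma decode_Omega_iff:
  assumes X: "X \<subseteq> sites"
  shows "decode X \<in> \<Omega> \<longleftrightarrow> X \<in> \<B>"
proof -
  have A: "(\<Sum>i\<in>{1..N}. \<Sum>l\<in>A. decode X i l) = (2 * \<rho> A - 1) * real N * real (card A) \<longleftrightarrow> card {x\<in>X. label x = A} = \<kappa> A"
    if A: "A \<in> \<A>" for A
  proof -
    have r: "(2 * \<rho> A - 1) * real N * real (card A) = 2 * real (up_count A) - real (N * card A)"
      unfolding up_count_density(1)[OF A] by (simp add: algebra_simps)
    define c n u where "c = card {x\<in>X. label x = A}" and "n = N * card A" and "u = up_count A"
    have "u \<le> n" using up_count_density(2)[OF A] by (simp add: n_def u_def)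
    then have "- (2 * real c - real n) = 2 * real u - real n \<longleftrightarrow> c = n - u" by linarith
    moreover have "2 * real c - real n = 2 * real u - real n \<longleftrightarrow> c = u" by linarith
    ultimately show ?thesis
      unfolding decode_block_sum[OF A X] r c_def[symmetric] n_def[symmetric] u_def[symmetric]
      using A by (simp add: minority_sign_def \<kappa>_def n_def[symmetric] u_def[symmetric])
  qed
  have "card {x\<in>X. label x = A} = \<kappa> A" if "A \<notin> \<A>" for A
  proof -
    have "{x\<in>X. label x = A} = {}" using that block_of(1) by (auto simp: label_def)
    then have "card {x\<in>X. label x = A} = 0" by (simp only: card.empty)
    then show ?thesis using that by (simp add: \<kappa>_def)
  qed
  then have "(\<forall>A\<in>\<A>. card {x\<in>X. label x = A} = \<kappa> A) \<longleftrightarrow> (\<forall>A. card {x\<in>X. label x = A} = \<kappa> A)" by blast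
  then show ?thesis
    using A decode_PiE[of X] X by (simp add: Omega_N_def block_sets_def)
qed

lemma bij_decode: "bij_betw decode \<B> \<Omega>"
proof (rule bij_betw_byWitness[where f'=encode])
  have sub: "X \<subseteq> sites" if "X \<in> \<B>" for X by (rule block_setsD[OF that])
  show "\<forall>X\<in>\<B>. encode (decode X) = X" using encode_decode sub by blast
  have P: "\<sigma> \<in> {1..N} \<rightarrow>\<^sub>E Omega" if "\<sigma> \<in> \<Omega>" for \<sigma> using that by (simp add: Omega_N_def)
  show "\<forall>\<sigma>\<in>\<Omega>. decode (encode \<sigma>) = \<sigma>" using decode_encode P by blast
  show "decode ` \<B> \<subseteq> \<Omega>" using decode_Omega_iff sub by blast
  have "encode \<sigma> \<subseteq> sites" for \<sigma> by (auto simp: encode_def)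
  then show "encode ` \<Omega> \<subseteq> \<B>" using decode_Omega_iff decode_encode P by (metis image_subsetI)
qed

lemma block_sets_nonempty: "\<B> \<noteq> {}"
proof -
  have "\<forall>b. \<exists>T. T \<subseteq> {x\<in>sites. label x = b} \<and> card T = \<kappa> b"
  proof
    fix b
    have "\<kappa> b \<le> card {x\<in>sites. label x = b}" using minority[of b] by simp
    then obtain T where T: "T \<subseteq> {x\<in>sites. label x = b}" "card T = \<kappa> b"
      by (rule obtain_subset_with_card_n)
    show "\<exists>T. T \<subseteq> {x\<in>sites. label x = b} \<and> card T = \<kappa> b" by (intro exI[of _ T] conjI T)
  qed
  from choice[OF this] obtain T
    where T': "\<forall>b. T b \<subseteq> {x\<in>sites. label x = b} \<and> card (T b) = \<kappa> b" by (elim exE)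
  have T: "T b \<subseteq> {x\<in>sites. label x = b}" "card (T b) = \<kappa> b" for b using spec[OF T', of b] by simp_all
  have "{x\<in>(\<Union>b. T b). label x = b} = T b" for b
  proof
    show "{x\<in>(\<Union>b. T b). label x = b} \<subseteq> T b"
    proof
      fix x assume "x \<in> {x\<in>(\<Union>b. T b). label x = b}"
      then obtain b' where "x \<in> T b'" "label x = b" by auto
      then show "x \<in> T b" using T(1)[of b'] by auto
    qed
    show "T b \<subseteq> {x\<in>(\<Union>b. T b). label x = b}" using T(1)[of b] by auto
  qed
  moreover have "(\<Union>b. T b) \<subseteq> sites" using T(1) by blast
  ultimately have "(\<Union>b. T b) \<in> \<B>" using T(2) by (simp add: block_sets_def)
  then show ?thesis by (rule ex_in_conv[THEN iffD1, OF exI])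
qed

lemma Omega_nonempty: "\<Omega> \<noteq> {}"
  using bij_decode block_sets_nonempty by (auto simp: bij_betw_def)

lemma finite_\<Omega>: "finite \<Omega>"
  using bij_decode finite_block_sets[OF finite_sites] by (metis bij_betw_finite)

section \<open>The conditioned Ising measure and its exchange rates\<close>

lemma \<Omega>_PiE: "\<sigma> \<in> \<Omega> \<Longrightarrow> \<sigma> \<in> {1..N} \<rightarrow>\<^sub>E Omega"
  by (simp add: Omega_N_def)

definition Zising :: real where "Zising = (\<Sum>\<xi>\<in>(Omega :: 'n spins set). ising_weight J \<xi>)"

definition Z\<Omega> :: real where "Z\<Omega> = (\<Sum>\<sigma>\<in>\<Omega>. W \<sigma>)"

lemma Z\<Omega>_pos: "0 < Z\<Omega>"
  unfolding Z\<Omega>_def using finite_\<Omega> Omega_nonempty W_pos by (intro sum_pos) auto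

lemma Zising_pos: "0 < Zising"
proof -
  have "(\<lambda>_. 1) \<in> (Omega :: 'n spins set)" by (simp add: Omega_def)
  then show ?thesis unfolding Zising_def using finite_Omega by (intro sum_pos) (auto simp: ising_weight_pos)
qed

lemma pmf_mu_N: "pmf (mu_N J \<A> N \<rho>) \<sigma> = (if \<sigma> \<in> \<Omega> then W \<sigma> / Z\<Omega> else 0)"
proof -
  define P where "P = Pi_pmf {1..N} undefined (\<lambda>_. ising J)"
  have pP: "pmf P \<tau> = W \<tau> / Zising ^ N" if "\<tau> \<in> \<Omega>" for \<tau>
  proof -
    have \<tau>: "\<tau> \<in> {1..N} \<rightarrow>\<^sub>E Omega" by (rule \<Omega>_PiE[OF that])
    then have "\<tau> i = undefined" if "i \<notin> {1..N}" for i using that by (auto simp: PiE_def extensional_def)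
    then have "pmf P \<tau> = (\<Prod>i\<in>{1..N}. pmf (ising J) (\<tau> i))" unfolding P_def by (subst pmf_Pi) auto
    also have "\<dots> = (\<Prod>i\<in>{1..N}. ising_weight J (\<tau> i) / Zising)"
      using \<tau> by (intro prod.cong refl) (auto simp: pmf_ising Zising_def)
    finally show ?thesis by (simp add: W_def prod_dividef)
  qed
  have meas: "measure P \<Omega> = Z\<Omega> / Zising ^ N"
    using pP by (simp add: measure_measure_pmf_finite[OF finite_\<Omega>] Z\<Omega>_def sum_divide_distrib)
  have "set_pmf P \<inter> \<Omega> \<noteq> {}"
  proof -
    obtain \<tau> where \<tau>: "\<tau> \<in> \<Omega>" using Omega_nonempty by auto
    then have "\<tau> \<in> set_pmf P" using pP[OF \<tau>] W_pos[of \<tau>] Zising_pos by (simp add: set_pmf_iff)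
    then show ?thesis using \<tau> by auto
  qed
  then have "pmf (mu_N J \<A> N \<rho>) \<sigma> = (if \<sigma> \<in> \<Omega> then pmf P \<sigma> / measure P \<Omega> else 0)"
    unfolding mu_N_def P_def by (rule pmf_cond)
  then show ?thesis using pP[of \<sigma>] Zising_pos by (simp add: meas)
qed

lemma set_mu_N: "set_pmf (mu_N J \<A> N \<rho>) = \<Omega>"
  using W_pos Z\<Omega>_pos by (auto simp: set_pmf_iff pmf_mu_N) (metis less_irrefl)+

lemma expectation_mu_N: "measure_pmf.expectation (mu_N J \<A> N \<rho>) f = (\<Sum>\<sigma>\<in>\<Omega>. W \<sigma> * f \<sigma>) / Z\<Omega>" for f :: "'n replicas \<Rightarrow> real"
proof -
  have "measure_pmf.expectation (mu_N J \<A> N \<rho>) f = (\<Sum>\<sigma>\<in>\<Omega>. f \<sigma> * pmf (mu_N J \<A> N \<rho>) \<sigma>)"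
    using integral_measure_pmf_real[of \<Omega> "mu_N J \<A> N \<rho>" f] finite_\<Omega> by (simp add: set_mu_N)
  also have "\<dots> = (\<Sum>\<sigma>\<in>\<Omega>. W \<sigma> * f \<sigma> / Z\<Omega>)" by (intro sum.cong refl) (simp add: pmf_mu_N)
  finally show ?thesis by (simp add: sum_divide_distrib)
qed

lemma Ent_mu_N: "Ent (mu_N J \<A> N \<rho>) F = went \<Omega> W F / Z\<Omega>"
  unfolding Ent_def expectation_mu_N went_def Z\<Omega>_def[symmetric] by (simp add: diff_divide_distrib)

text \<open>
  For a factorization of \<open>J\<close> the weight of a replica configuration is the exponential of
  half a sum of squares of linear features, one for each replica and each row of \<open>w\<close>. This
  is the form of the weight in \<open>spin_block_entropy_factorization\<close>.
\<close>

lemma W_decode: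
  fixes w :: "'n \<Rightarrow> 'n \<Rightarrow> real"
  assumes w: "\<And>l m. J $ l $ m = (\<Sum>a\<in>UNIV. w a l * w a m)"
  shows "W (decode X) = exp (1 / 2 * (\<Sum>p\<in>{1..N} \<times> UNIV.
      (\<Sum>x\<in>sites. (if fst x = fst p then w (snd p) (snd x) else 0) * (if x \<in> X then minority_sign (label x) else - minority_sign (label x)))\<^sup>2))"
proof -
  define q where "q i a = (\<Sum>l\<in>UNIV. w a l * decode X i l)" for i a
  have 1: "(\<Sum>l\<in>UNIV. \<Sum>m\<in>UNIV. J $ l $ m * \<eta> l * \<eta> m) = (\<Sum>a\<in>UNIV. (\<Sum>l\<in>UNIV. w a l * \<eta> l)\<^sup>2)" for \<eta> :: "'n \<Rightarrow> real"
  proof -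
    have "(\<Sum>l\<in>UNIV. \<Sum>m\<in>UNIV. J $ l $ m * \<eta> l * \<eta> m) = (\<Sum>l\<in>UNIV. \<Sum>m\<in>UNIV. \<Sum>a\<in>UNIV. (w a l * \<eta> l) * (w a m * \<eta> m))"
      by (intro sum.cong refl) (simp add: w sum_distrib_left sum_distrib_right algebra_simps)
    also have "\<dots> = (\<Sum>l\<in>UNIV. \<Sum>a\<in>UNIV. \<Sum>m\<in>UNIV. (w a l * \<eta> l) * (w a m * \<eta> m))"
      by (intro sum.cong refl sum.swap)
    also have "\<dots> = (\<Sum>a\<in>UNIV. \<Sum>l\<in>UNIV. \<Sum>m\<in>UNIV. (w a l * \<eta> l) * (w a m * \<eta> m))" by (rule sum.swap)
    finally show ?thesis by (simp add: power2_eq_square sum_product)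
  qed
  have 2: "(\<Sum>x\<in>sites. (if fst x = i then w a (snd x) else 0) * (if x \<in> X then minority_sign (label x) else - minority_sign (label x))) = q i a"
    if i: "i \<in> {1..N}" for i a
  proof -
    have "(\<Sum>x\<in>sites. (if fst x = i then w a (snd x) else 0) * (if x \<in> X then minority_sign (label x) else - minority_sign (label x)))
      = (\<Sum>x\<in>{i} \<times> UNIV. w a (snd x) * (if x \<in> X then minority_sign (label x) else - minority_sign (label x)))"
      using i finite_sites by (intro sum.mono_neutral_cong_right) (auto simp: sites_def)
    also have "\<dots> = (\<Sum>l\<in>UNIV. w a l * (if (i, l) \<in> X then minority_sign (block_of l) else - minority_sign (block_of l)))"
      using sum.cartesian_product[of "\<lambda>j l. w a l * (if (j, l) \<in> X then minority_sign (block_of l) else - minority_sign (block_of l))" UNIV "{i}"]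
      unfolding label_def by (simp add: case_prod_unfold)
    finally show ?thesis using i by (simp add: q_def decode_def)
  qed
  have "W (decode X) = exp (\<Sum>i\<in>{1..N}. 1 / 2 * (\<Sum>a\<in>UNIV. (q i a)\<^sup>2))"
    unfolding W_def ising_weight_def 1 q_def[symmetric] by (simp add: exp_sum)
  also have "(\<Sum>i\<in>{1..N}. 1 / 2 * (\<Sum>a\<in>UNIV. (q i a)\<^sup>2)) = 1 / 2 * (\<Sum>p\<in>{1..N} \<times> UNIV. (q (fst p) (snd p))\<^sup>2)"
    unfolding sum_distrib_left[symmetric] by (simp add: sum.cartesian_product case_prod_unfold)
  also have "(\<Sum>p\<in>{1..N} \<times> UNIV. (q (fst p) (snd p))\<^sup>2) = (\<Sum>p\<in>{1..N} \<times> UNIV.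
      (\<Sum>x\<in>sites. (if fst x = fst p then w (snd p) (snd x) else 0) * (if x \<in> X then minority_sign (label x) else - minority_sign (label x)))\<^sup>2)"
    by (intro sum.cong refl arg_cong[where f="\<lambda>z. z\<^sup>2"] 2[symmetric]) auto
  finally show ?thesis .
qed

lemma localized_factorization:
  assumes J: "nonneg_definite J" and c0: "2 * largest_eigenvalue J \<le> c0" "0 < c0" "c0 < 1"
    and k: "\<And>X. X \<in> \<B> \<Longrightarrow> card X = k" and F: "\<And>X. X \<in> \<B> \<Longrightarrow> 0 \<le> F X"
  shows "(1 - c0)\<^sup>2 * went \<B> (\<lambda>X. W (decode X)) F
    \<le> (\<Sum>S\<in>{S. S \<subseteq> sites \<and> card S + 1 = k}. went (above \<B> S) (\<lambda>X. W (decode X)) F)"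
proof -
  obtain w :: "'n \<Rightarrow> 'n \<Rightarrow> real" where w: "\<And>i j. J $ i $ j = (\<Sum>a\<in>UNIV. w a i * w a j)"
    and wb: "\<And>u :: 'n \<Rightarrow> real. (\<Sum>i\<in>UNIV. (\<Sum>a\<in>UNIV. u a * w a i)\<^sup>2) \<le> largest_eigenvalue J * (\<Sum>a\<in>UNIV. (u a)\<^sup>2)"
    using nonneg_definite_factorization[OF J] by blast
  define c where "c p x = (if fst x = fst p then w (snd p) (snd x) else 0)" for p x :: "nat \<times> 'n"
  have cb: "(\<Sum>x\<in>sites. (\<Sum>p\<in>{1..N} \<times> UNIV. u p * c p x)\<^sup>2) \<le> largest_eigenvalue J * (\<Sum>p\<in>{1..N} \<times> UNIV. (u p)\<^sup>2)" for u
  proof -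
    have e: "(\<Sum>p\<in>{1..N} \<times> UNIV. u p * c p (j, l)) = (\<Sum>a\<in>UNIV. u (j, a) * w a l)" if "j \<in> {1..N}" for j l
    proof -
      have "(\<Sum>p\<in>{1..N} \<times> UNIV. u p * c p (j, l)) = (\<Sum>p\<in>{j} \<times> UNIV. u p * w (snd p) l)"
        using that by (intro sum.mono_neutral_cong_right) (auto simp: c_def)
      then show ?thesis
        using sum.cartesian_product[of "\<lambda>j a. u (j, a) * w a l" UNIV "{j}"] by (simp add: case_prod_unfold)
    qed
    have "(\<Sum>x\<in>sites. (\<Sum>p\<in>{1..N} \<times> UNIV. u p * c p x)\<^sup>2) = (\<Sum>j\<in>{1..N}. \<Sum>l\<in>UNIV. (\<Sum>p\<in>{1..N} \<times> UNIV. u p * c p (j, l))\<^sup>2)"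
      unfolding sites_def by (simp add: sum.cartesian_product case_prod_unfold)
    also have "\<dots> = (\<Sum>j\<in>{1..N}. \<Sum>l\<in>UNIV. (\<Sum>a\<in>UNIV. u (j, a) * w a l)\<^sup>2)"
      by (intro sum.cong refl) (simp only: e)
    also have "\<dots> \<le> (\<Sum>j\<in>{1..N}. largest_eigenvalue J * (\<Sum>a\<in>UNIV. (u (j, a))\<^sup>2))"
      by (intro sum_mono wb)
    also have "\<dots> = largest_eigenvalue J * (\<Sum>p\<in>{1..N} \<times> UNIV. (u p)\<^sup>2)"
      by (simp add: sum_distrib_left[symmetric] sum.cartesian_product case_prod_unfold)
    finally show ?thesis .
  qed
  have sg1: "(minority_sign (label x))\<^sup>2 = 1" for x using minority_sign_cases[of "label x"] by auto
  have ne: "{1..N} \<times> (UNIV :: 'n set) \<noteq> {}" using N by auto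
  show ?thesis
    unfolding W_decode[OF w]
    using spin_block_entropy_factorization[OF finite_sites _ ne sg1 k block_sets_nonempty F cb c0]
    unfolding c_def by simp
qed

text \<open>
  Within a block, exchanging equal spins has no effect and exchanging different ones moves a
  particle.
\<close>

lemma exchange_decode:
  assumes X: "X \<in> \<B>" and i: "i \<in> {1..N}" and j: "j \<in> {1..N}" and kl: "block_of k = block_of l"
  shows "exchange i l j k (decode X) =
    (if (i, l) \<in> X \<and> (j, k) \<notin> X then decode (insert (j, k) (X - {(i, l)}))
     else if (i, l) \<notin> X \<and> (j, k) \<in> X then decode (insert (i, l) (X - {(j, k)}))
     else decode X)"
    (is "_ = ?R")
proof (intro ext)
  fix i' l'
  have dec: "decode Y i' l' = (if (i', l') \<in> Y then minority_sign (block_of l') else - minority_sign (block_of l'))" if "i' \<in> {1..N}" for Y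
    using that by (simp add: decode_def)
  show "exchange i l j k (decode X) i' l' = ?R i' l'"
  proof (cases "i' \<in> {1..N}")
    case False
    then have "i' \<noteq> i" "i' \<noteq> j" using i j by auto
    then have "exchange i l j k (decode X) i' l' = decode X i' l'" unfolding exchange_def by simp
    moreover have "decode Y i' = undefined" for Y using False by (auto simp: decode_def)
    ultimately show ?thesis by simp
  next
    case True
    have i'': "decode X i l = (if (i, l) \<in> X then minority_sign (block_of l) else - minority_sign (block_of l))"
      "decode X j k = (if (j, k) \<in> X then minority_sign (block_of l) else - minority_sign (block_of l))"
      using i j kl by (simp_all add: decode_def)
    show ?thesis
    proof (cases "i' = i \<and> l' = l")
      case t: True
      have "exchange i l j k (decode X) i' l' = decode X j k" using t by (simp add: exchange_def)
      then show ?thesis using t dec[OF True] i'' by auto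
    next
      case ne: False
      show ?thesis
      proof (cases "i' = j \<and> l' = k")
        case t: True
        have "exchange i l j k (decode X) i' l' = decode X i l" using t ne by (simp add: exchange_def)
        then show ?thesis using t ne dec[OF True] i'' kl by auto
      next
        case ne': False
        have "exchange i l j k (decode X) i' l' = decode X i' l'" using ne ne' unfolding exchange_def by auto
        then show ?thesis using ne ne' dec[OF True] by auto
      qed
    qed
  qed
qed

lemma swap_in_block_sets:
  assumes X: "X \<in> \<B>" and x: "x \<in> X" and y: "y \<in> sites - X" and l: "label y = label x"
  shows "insert y (X - {x}) \<in> \<B>"
  using block_swap_iff[OF finite_sites X x y] l by simp

lemma exchange_in_Omega:
  assumes \<sigma>: "\<sigma> \<in> \<Omega>" and i: "i \<in> {1..N}" and j: "j \<in> {1..N}" and kl: "block_of k = block_of l"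
  shows "exchange i l j k \<sigma> \<in> \<Omega>"
proof -
  obtain X where X: "X \<in> \<B>" "\<sigma> = decode X" using bij_decode \<sigma> by (auto simp: bij_betw_def)
  have XV: "X \<subseteq> sites" by (rule block_setsD[OF X(1)])
  have dec: "Y \<in> \<B> \<Longrightarrow> decode Y \<in> \<Omega>" for Y using bij_decode by (auto simp: bij_betw_def)
  have s: "(i, l) \<in> sites" "(j, k) \<in> sites" using i j by (auto simp: sites_def)
  have lab: "label (j, k) = label (i, l)" using kl by (simp add: label_def)
  show ?thesis
    unfolding X(2) exchange_decode[OF X(1) i j kl]
    using swap_in_block_sets[OF X(1), of "(i, l)" "(j, k)"] swap_in_block_sets[OF X(1), of "(j, k)" "(i, l)"] X(1) s lab
    by (auto intro!: dec)
qed

text \<open>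
  An exchange changes two spins, and each change costs a factor
  \<open>exp (2 * max_abs_row_sum J)\<close>.
\<close>

lemma W_exchange_le:
  assumes \<sigma>: "\<sigma> \<in> {1..N} \<rightarrow>\<^sub>E Omega" and i: "i \<in> {1..N}" and j: "j \<in> {1..N}"
  shows "W \<sigma> \<le> exp (4 * max_abs_row_sum J) * W (exchange i l j k \<sigma>)"
proof -
  define C where "C = exp (2 * max_abs_row_sum J)"
  have flip: "W \<tau> \<le> C * W (\<tau>(m := (\<tau> m)(s := a)))" if \<tau>: "\<And>m. m \<in> {1..N} \<Longrightarrow> \<tau> m \<in> Omega" and m: "m \<in> {1..N}" and a: "a = -1 \<or> a = 1"
    for \<tau> :: "'n replicas" and m s a
  proof -
    define R where "R = (\<Prod>i\<in>{1..N} - {m}. ising_weight J (\<tau> i))"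
    have R: "0 \<le> R" unfolding R_def by (intro prod_nonneg) (simp add: ising_weight_pos less_imp_le)
    have "W \<tau> = ising_weight J (\<tau> m) * R" unfolding W_def R_def using m by (intro prod.remove) auto
    also have "\<dots> \<le> (C * ising_weight J ((\<tau> m)(s := a))) * R"
      unfolding C_def using R by (intro mult_right_mono ising_weight_spin_change[OF sym \<tau>[OF m] a])
    also have "ising_weight J ((\<tau> m)(s := a)) * R = W (\<tau>(m := (\<tau> m)(s := a)))"
    proof -
      have "W (\<tau>(m := (\<tau> m)(s := a))) = ising_weight J ((\<tau>(m := (\<tau> m)(s := a))) m) * (\<Prod>i\<in>{1..N} - {m}. ising_weight J ((\<tau>(m := (\<tau> m)(s := a))) i))"
        unfolding W_def using m by (intro prod.remove) auto
      also have "(\<Prod>i\<in>{1..N} - {m}. ising_weight J ((\<tau>(m := (\<tau> m)(s := a))) i)) = R"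
        unfolding R_def by (intro prod.cong) auto
      finally show ?thesis unfolding fun_upd_same by (rule HOL.sym)
    qed
    then have "(C * ising_weight J ((\<tau> m)(s := a))) * R = C * W (\<tau>(m := (\<tau> m)(s := a)))" by simp
    finally show ?thesis .
  qed
  have \<sigma>O: "\<sigma> m \<in> Omega" if "m \<in> {1..N}" for m using \<sigma> that by auto
  define \<sigma>1 where "\<sigma>1 = \<sigma>(i := (\<sigma> i)(l := \<sigma> j k))"
  define \<sigma>2 where "\<sigma>2 = \<sigma>1(j := (\<sigma>1 j)(k := \<sigma> i l))"
  have a: "\<sigma> j k = -1 \<or> \<sigma> j k = 1" "\<sigma> i l = -1 \<or> \<sigma> i l = 1"
    using OmegaD[OF \<sigma>O[OF j]] OmegaD[OF \<sigma>O[OF i]] by auto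
  have \<sigma>1O: "\<sigma>1 m \<in> Omega" if "m \<in> {1..N}" for m
    using \<sigma>O[OF that] Omega_update[OF \<sigma>O[OF i] a(1)] by (simp add: \<sigma>1_def)
  have "W \<sigma> \<le> C * W \<sigma>1" unfolding \<sigma>1_def by (rule flip[OF \<sigma>O i a(1)])
  also have "\<dots> \<le> C * (C * W \<sigma>2)" unfolding \<sigma>2_def
    by (intro mult_left_mono flip[OF \<sigma>1O j a(2)]) (simp_all add: C_def)
  also have "\<sigma>2 = exchange i l j k \<sigma>"
    by (intro ext) (simp add: \<sigma>2_def \<sigma>1_def exchange_def)
  also have "C * (C * W (exchange i l j k \<sigma>)) = exp (4 * max_abs_row_sum J) * W (exchange i l j k \<sigma>)"
    by (simp add: C_def exp_add[symmetric] mult.assoc[symmetric])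
  finally show ?thesis .
qed

text \<open>
  The replicas that do not take part in the exchange contribute the same factor to both
  weights, so the jump probability is that of a heat bath on two replica configurations.
\<close>

lemma exchange_prob_eq:
  assumes \<sigma>: "\<sigma> \<in> {1..N} \<rightarrow>\<^sub>E Omega" and i: "i \<in> {1..N}" and j: "j \<in> {1..N}"
  shows "exchange_prob J i l j k \<sigma> = W (exchange i l j k \<sigma>) / (W \<sigma> + W (exchange i l j k \<sigma>))"
proof -
  let ?\<tau> = "exchange i l j k \<sigma>"
  have \<sigma>O: "\<sigma> m \<in> Omega" if "m \<in> {1..N}" for m using \<sigma> that by auto
  have a: "\<sigma> j k = -1 \<or> \<sigma> j k = 1" "\<sigma> i l = -1 \<or> \<sigma> i l = 1" "\<sigma> i k = -1 \<or> \<sigma> i k = 1"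
    using OmegaD[OF \<sigma>O[OF j]] OmegaD[OF \<sigma>O[OF i]] by auto
  have p: "pmf (ising J) \<eta> = ising_weight J \<eta> / Zising" if "\<eta> \<in> Omega" for \<eta>
    using that by (simp add: pmf_ising Zising_def)
  have cancel: "(x * r) / (y * r + x * r) = x / (y + x)" if "0 < r" for x y r :: real
    using that by (simp add: distrib_right[symmetric])
  show ?thesis
  proof (cases "i = j")
    case True
    define R where "R = (\<Prod>m\<in>{1..N} - {i}. ising_weight J (\<sigma> m))"
    have R: "0 < R" unfolding R_def by (intro prod_pos) (simp add: ising_weight_pos)
    have \<tau>i: "?\<tau> i = swap_sites l k (\<sigma> i)" using True by (auto simp: exchange_def swap_sites_def fun_eq_iff)
    have W1: "W \<sigma> = ising_weight J (\<sigma> i) * R" unfolding W_def R_def using i by (intro prod.remove) auto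
    have "W ?\<tau> = ising_weight J (?\<tau> i) * (\<Prod>m\<in>{1..N} - {i}. ising_weight J (?\<tau> m))"
      unfolding W_def using i by (intro prod.remove) auto
    also have "(\<Prod>m\<in>{1..N} - {i}. ising_weight J (?\<tau> m)) = R"
      unfolding R_def using True by (intro prod.cong refl arg_cong[where f="ising_weight J"]) (auto simp: exchange_def)
    finally have W2: "W ?\<tau> = ising_weight J (swap_sites l k (\<sigma> i)) * R" by (simp add: \<tau>i)
    have sO: "swap_sites l k (\<sigma> i) \<in> Omega"
      unfolding swap_sites_def by (intro Omega_update \<sigma>O i a(3) a(2))
    have "exchange_prob J i l j k \<sigma> = (ising_weight J (swap_sites l k (\<sigma> i)) / Zising) /
       (ising_weight J (\<sigma> i) / Zising + ising_weight J (swap_sites l k (\<sigma> i)) / Zising)"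
      using True p[OF sO] p[OF \<sigma>O[OF i]] by (simp add: exchange_prob_def)
    also have "\<dots> = ising_weight J (swap_sites l k (\<sigma> i)) / (ising_weight J (\<sigma> i) + ising_weight J (swap_sites l k (\<sigma> i)))"
      using Zising_pos by (simp add: add_divide_distrib[symmetric])
    finally show ?thesis unfolding W1 W2 cancel[OF R] .
  next
    case False
    define R where "R = (\<Prod>m\<in>{1..N} - {i} - {j}. ising_weight J (\<sigma> m))"
    have R: "0 < R" unfolding R_def by (intro prod_pos) (simp add: ising_weight_pos)
    have split: "W \<tau> = (ising_weight J (\<tau> i) * ising_weight J (\<tau> j)) * (\<Prod>m\<in>{1..N} - {i} - {j}. ising_weight J (\<tau> m))" for \<tau>
    proof -
      have "W \<tau> = ising_weight J (\<tau> i) * (\<Prod>m\<in>{1..N} - {i}. ising_weight J (\<tau> m))"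
        unfolding W_def using i by (intro prod.remove) auto
      also have "(\<Prod>m\<in>{1..N} - {i}. ising_weight J (\<tau> m)) = ising_weight J (\<tau> j) * (\<Prod>m\<in>{1..N} - {i} - {j}. ising_weight J (\<tau> m))"
        using j False by (intro prod.remove) auto
      finally show ?thesis by simp
    qed
    have \<tau>ij: "?\<tau> i = set_spin l (\<sigma> i) (\<sigma> j k)" "?\<tau> j = set_spin k (\<sigma> j) (\<sigma> i l)"
      using False by (auto simp: exchange_def set_spin_def fun_eq_iff)
    have rest: "(\<Prod>m\<in>{1..N} - {i} - {j}. ising_weight J (?\<tau> m)) = R"
      unfolding R_def by (intro prod.cong refl arg_cong[where f="ising_weight J"]) (auto simp: exchange_def)
    define A B where "A = ising_weight J (\<sigma> i) * ising_weight J (\<sigma> j)"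
      and "B = ising_weight J (set_spin l (\<sigma> i) (\<sigma> j k)) * ising_weight J (set_spin k (\<sigma> j) (\<sigma> i l))"
    have W1: "W \<sigma> = A * R" unfolding split[of \<sigma>] by (simp add: A_def R_def)
    have W2: "W ?\<tau> = B * R" unfolding split[of ?\<tau>] rest by (simp add: B_def \<tau>ij)
    have O: "set_spin l (\<sigma> i) (\<sigma> j k) \<in> Omega" "set_spin k (\<sigma> j) (\<sigma> i l) \<in> Omega"
      unfolding set_spin_def by (intro Omega_update \<sigma>O i j a(1) a(2))+
    have "exchange_prob J i l j k \<sigma> = (B * (1 / Zising\<^sup>2)) / (A * (1 / Zising\<^sup>2) + B * (1 / Zising\<^sup>2))"
      using False p[OF O(1)] p[OF O(2)] p[OF \<sigma>O[OF i]] p[OF \<sigma>O[OF j]]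
      by (simp add: exchange_prob_def A_def B_def power2_eq_square)
    also have "\<dots> = B / (A + B)" using Zising_pos by (intro cancel) simp
    finally show ?thesis unfolding W1 W2 cancel[OF R] .
  qed
qed

section \<open>The Dirichlet form\<close>

text \<open>
  The summand of the Dirichlet form for \<open>F\<close> and \<open>ln F\<close> that belongs to a pair of
  configurations, up to the normalization of the weight.
\<close>

definition exchange_form :: "('n replicas \<Rightarrow> real) \<Rightarrow> 'n replicas \<Rightarrow> 'n replicas \<Rightarrow> real" where
  "exchange_form F \<sigma> \<tau> = W \<sigma> * W \<tau> / (W \<sigma> + W \<tau>) * ((F \<sigma> - F \<tau>) * (ln (F \<sigma>) - ln (F \<tau>)))"

text \<open>
  The nonnegative functions for which the Dirichlet form of \<open>F\<close> and \<open>ln F\<close> is finite.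
\<close>

definition compatible :: "('n replicas \<Rightarrow> real) \<Rightarrow> bool" where
  "compatible F \<longleftrightarrow> (\<forall>\<sigma>\<in>\<Omega>. \<forall>i\<in>{1..N}. \<forall>j\<in>{1..N}. \<forall>l k. block_of k = block_of l \<longrightarrow>
     (F \<sigma> = 0 \<longleftrightarrow> F (exchange i l j k \<sigma>) = 0))"

lemma ext_expectation_mu_N:
  "ext_expectation (mu_N J \<A> N \<rho>) f = (\<Sum>\<sigma>\<in>\<Omega>. ereal (W \<sigma> / Z\<Omega>) * f \<sigma>)"
  unfolding ext_expectation_def set_mu_N by (intro sum.cong refl) (simp add: pmf_mu_N)

lemma dirichlet_summand:
  assumes F: "\<And>\<sigma>. \<sigma> \<in> \<Omega> \<Longrightarrow> 0 \<le> F \<sigma>" and \<sigma>: "\<sigma> \<in> \<Omega>" and ij: "i \<in> {1..N}" "j \<in> {1..N}" and kl: "block_of k = block_of l"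
  shows "ereal (W \<sigma> / Z\<Omega>) * (ereal (exchange_prob J i l j k \<sigma>) *
      (exchange_gradient i l j k (\<lambda>\<sigma>. ereal (F \<sigma>)) \<sigma> * exchange_gradient i l j k (\<lambda>\<sigma>. ext_ln (F \<sigma>)) \<sigma>))
    = (if F \<sigma> = 0 \<longleftrightarrow> F (exchange i l j k \<sigma>) = 0 then ereal (exchange_form F \<sigma> (exchange i l j k \<sigma>) / Z\<Omega>) else \<infinity>)"
proof -
  define \<tau> where "\<tau> = exchange i l j k \<sigma>"
  have \<tau>: "\<tau> \<in> \<Omega>" unfolding \<tau>_def by (rule exchange_in_Omega[OF \<sigma> ij kl])
  have p: "exchange_prob J i l j k \<sigma> = W \<tau> / (W \<sigma> + W \<tau>)"
    unfolding \<tau>_def by (rule exchange_prob_eq[OF \<Omega>_PiE[OF \<sigma>] ij])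
  have pos: "0 < W \<tau> / (W \<sigma> + W \<tau>)" "0 < W \<sigma> / Z\<Omega>" using W_pos[of \<tau>] W_pos[of \<sigma>] Z\<Omega>_pos by auto
  have infinite: "ereal a * (ereal b * \<infinity>) = \<infinity>" if "0 < a" "0 < b" for a b :: real using that by simp
  have prod: "(ereal (F \<tau>) - ereal (F \<sigma>)) * (ext_ln (F \<tau>) - ext_ln (F \<sigma>)) =
    (if F \<tau> = 0 \<and> F \<sigma> = 0 then 0 else if F \<tau> = 0 \<or> F \<sigma> = 0 then \<infinity> else ereal ((F \<tau> - F \<sigma>) * (ln (F \<tau>) - ln (F \<sigma>))))"
    by (rule ext_ln_product[OF F[OF \<tau>] F[OF \<sigma>]])
  have form: "W \<sigma> / Z\<Omega> * (W \<tau> / (W \<sigma> + W \<tau>) * ((F \<tau> - F \<sigma>) * (ln (F \<tau>) - ln (F \<sigma>)))) = exchange_form F \<sigma> \<tau> / Z\<Omega>"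
  proof -
    have "(F \<tau> - F \<sigma>) * (ln (F \<tau>) - ln (F \<sigma>)) = (F \<sigma> - F \<tau>) * (ln (F \<sigma>) - ln (F \<tau>))" by (simp add: algebra_simps)
    then show ?thesis by (simp add: exchange_form_def mult.assoc mult.commute[of "Z\<Omega>"])
  qed
  show ?thesis
    unfolding exchange_gradient_def \<tau>_def[symmetric] p prod
  proof (cases "F \<sigma> = 0 \<longleftrightarrow> F \<tau> = 0")
    case True
    show "ereal (W \<sigma> / Z\<Omega>) * (ereal (W \<tau> / (W \<sigma> + W \<tau>)) *
        (if F \<tau> = 0 \<and> F \<sigma> = 0 then 0 else if F \<tau> = 0 \<or> F \<sigma> = 0 then \<infinity> else ereal ((F \<tau> - F \<sigma>) * (ln (F \<tau>) - ln (F \<sigma>)))))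
      = (if (F \<sigma> = 0) = (F \<tau> = 0) then ereal (exchange_form F \<sigma> \<tau> / Z\<Omega>) else \<infinity>)"
    proof (cases "F \<sigma> = 0")
      case z: True
      then show ?thesis using True by (simp add: exchange_form_def zero_ereal_def)
    next
      case z: False
      then have "F \<tau> \<noteq> 0" using True by simp
      then show ?thesis using z by (simp only: if_False if_True simp_thms times_ereal.simps form)
    qed
  next
    case False
    then have "\<not> (F \<tau> = 0 \<and> F \<sigma> = 0)" "F \<tau> = 0 \<or> F \<sigma> = 0" by auto
    moreover have "ereal (W \<sigma> / Z\<Omega>) * (ereal (W \<tau> / (W \<sigma> + W \<tau>)) * \<infinity>) = \<infinity>"
      using pos by (intro infinite)
    ultimately show "ereal (W \<sigma> / Z\<Omega>) * (ereal (W \<tau> / (W \<sigma> + W \<tau>)) *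
        (if F \<tau> = 0 \<and> F \<sigma> = 0 then 0 else if F \<tau> = 0 \<or> F \<sigma> = 0 then \<infinity> else ereal ((F \<tau> - F \<sigma>) * (ln (F \<tau>) - ln (F \<sigma>)))))
      = (if (F \<sigma> = 0) = (F \<tau> = 0) then ereal (exchange_form F \<sigma> \<tau> / Z\<Omega>) else \<infinity>)"
      using False by (simp only: if_False if_True)
  qed
qed

lemma dirichlet_infinite:
  assumes F: "\<And>\<sigma>. \<sigma> \<in> \<Omega> \<Longrightarrow> 0 \<le> F \<sigma>" and "\<not> compatible F"
  shows "dirichlet_form J (block_kernel \<A>) \<A> N \<rho> (\<lambda>\<sigma>. ereal (F \<sigma>)) (\<lambda>\<sigma>. ext_ln (F \<sigma>)) = \<infinity>"
proof -
  obtain \<sigma> i j l k where *: "\<sigma> \<in> \<Omega>" "i \<in> {1..N}" "j \<in> {1..N}" "block_of k = block_of l"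
     "\<not> (F \<sigma> = 0 \<longleftrightarrow> F (exchange i l j k \<sigma>) = 0)"
    using assms(2) unfolding compatible_def by blast
  define E where "E i j l k = ext_expectation (mu_N J \<A> N \<rho>) (\<lambda>\<sigma>. ereal (exchange_prob J i l j k \<sigma>) *
      (exchange_gradient i l j k (\<lambda>\<sigma>. ereal (F \<sigma>)) \<sigma> * exchange_gradient i l j k (\<lambda>\<sigma>. ext_ln (F \<sigma>)) \<sigma>))" for i j l k
  have "E i j l k = \<infinity>"
    unfolding E_def ext_expectation_mu_N sum_Pinfty
    using finite_\<Omega> *(1) dirichlet_summand[of F, OF F *(1-4)] *(5) by (intro conjI bexI[of _ \<sigma>]) auto
  moreover have K: "0 < block_kernel \<A> l k"
    using *(4) block_of(2)[of l] by (auto simp: block_kernel_eq card_gt_0_iff)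
  ultimately have "ereal (block_kernel \<A> l k) * E i j l k = \<infinity>" by simp
  then have "(\<Sum>k\<in>UNIV. ereal (block_kernel \<A> l k) * E i j l k) = \<infinity>" unfolding sum_Pinfty by auto
  then have "(\<Sum>l\<in>UNIV. \<Sum>k\<in>UNIV. ereal (block_kernel \<A> l k) * E i j l k) = \<infinity>" unfolding sum_Pinfty by auto
  then have "(\<Sum>j\<in>{1..N}. \<Sum>l\<in>UNIV. \<Sum>k\<in>UNIV. ereal (block_kernel \<A> l k) * E i j l k) = \<infinity>"
    unfolding sum_Pinfty[of _ "{1..N}"] using *(3) by blast
  then have "(\<Sum>i\<in>{1..N}. \<Sum>j\<in>{1..N}. \<Sum>l\<in>UNIV. \<Sum>k\<in>UNIV. ereal (block_kernel \<A> l k) * E i j l k) = \<infinity>"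
    unfolding sum_Pinfty[of "\<lambda>i. \<Sum>j\<in>{1..N}. \<Sum>l\<in>UNIV. \<Sum>k\<in>UNIV. ereal (block_kernel \<A> l k) * E i j l k" "{1..N}"] using *(2) by blast
  moreover have "0 < N" using N by simp
  ultimately show ?thesis unfolding dirichlet_form_def E_def by simp
qed

lemma dirichlet_finite:
  assumes F: "\<And>\<sigma>. \<sigma> \<in> \<Omega> \<Longrightarrow> 0 \<le> F \<sigma>" and c: "compatible F"
  shows "dirichlet_form J (block_kernel \<A>) \<A> N \<rho> (\<lambda>\<sigma>. ereal (F \<sigma>)) (\<lambda>\<sigma>. ext_ln (F \<sigma>)) =
    ereal (1 / (2 * real N * real CARD('n)) * (\<Sum>i\<in>{1..N}. \<Sum>j\<in>{1..N}. \<Sum>l\<in>UNIV. \<Sum>k\<in>UNIV.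
       block_kernel \<A> l k * (\<Sum>\<sigma>\<in>\<Omega>. exchange_form F \<sigma> (exchange i l j k \<sigma>) / Z\<Omega>)))"
proof -
  have "ereal (block_kernel \<A> l k) * ext_expectation (mu_N J \<A> N \<rho>) (\<lambda>\<sigma>. ereal (exchange_prob J i l j k \<sigma>) *
      (exchange_gradient i l j k (\<lambda>\<sigma>. ereal (F \<sigma>)) \<sigma> * exchange_gradient i l j k (\<lambda>\<sigma>. ext_ln (F \<sigma>)) \<sigma>))
    = ereal (block_kernel \<A> l k * (\<Sum>\<sigma>\<in>\<Omega>. exchange_form F \<sigma> (exchange i l j k \<sigma>) / Z\<Omega>))"
    if ij: "i \<in> {1..N}" "j \<in> {1..N}" for i j l k
  proof (cases "block_of k = block_of l")
    case True
    have "ext_expectation (mu_N J \<A> N \<rho>) (\<lambda>\<sigma>. ereal (exchange_prob J i l j k \<sigma>) *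
      (exchange_gradient i l j k (\<lambda>\<sigma>. ereal (F \<sigma>)) \<sigma> * exchange_gradient i l j k (\<lambda>\<sigma>. ext_ln (F \<sigma>)) \<sigma>))
      = (\<Sum>\<sigma>\<in>\<Omega>. ereal (exchange_form F \<sigma> (exchange i l j k \<sigma>) / Z\<Omega>))"
      unfolding ext_expectation_mu_N
    proof (rule sum.cong[OF refl])
      fix \<sigma> assume \<sigma>: "\<sigma> \<in> \<Omega>"
      have "F \<sigma> = 0 \<longleftrightarrow> F (exchange i l j k \<sigma>) = 0" using c \<sigma> ij True unfolding compatible_def by blast
      then show "ereal (W \<sigma> / Z\<Omega>) * (ereal (exchange_prob J i l j k \<sigma>) *
          (exchange_gradient i l j k (\<lambda>\<sigma>. ereal (F \<sigma>)) \<sigma> * exchange_gradient i l j k (\<lambda>\<sigma>. ext_ln (F \<sigma>)) \<sigma>))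
        = ereal (exchange_form F \<sigma> (exchange i l j k \<sigma>) / Z\<Omega>)"
        using dirichlet_summand[of F \<sigma> i j k l] F \<sigma> ij True by simp
    qed
    then show ?thesis by simp
  next
    case False
    then have "block_kernel \<A> l k = 0" by (simp add: block_kernel_eq)
    then show ?thesis by (simp add: zero_ereal_def[symmetric])
  qed
  then have "(\<Sum>i\<in>{1..N}. \<Sum>j\<in>{1..N}. \<Sum>l\<in>UNIV. \<Sum>k\<in>UNIV. ereal (block_kernel \<A> l k) *
     ext_expectation (mu_N J \<A> N \<rho>) (\<lambda>\<sigma>. ereal (exchange_prob J i l j k \<sigma>) *
      (exchange_gradient i l j k (\<lambda>\<sigma>. ereal (F \<sigma>)) \<sigma> * exchange_gradient i l j k (\<lambda>\<sigma>. ext_ln (F \<sigma>)) \<sigma>)))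
    = (\<Sum>i\<in>{1..N}. \<Sum>j\<in>{1..N}. \<Sum>l\<in>UNIV. \<Sum>k\<in>UNIV. ereal (block_kernel \<A> l k * (\<Sum>\<sigma>\<in>\<Omega>. exchange_form F \<sigma> (exchange i l j k \<sigma>) / Z\<Omega>)))"
    by (intro sum.cong refl) blast
  then show ?thesis unfolding dirichlet_form_def by simp
qed

lemma exchange_form_nonneg:
  assumes "0 \<le> F \<sigma>" "0 \<le> F \<tau>" "F \<sigma> = 0 \<longleftrightarrow> F \<tau> = 0"
  shows "0 \<le> exchange_form F \<sigma> \<tau>"
  unfolding exchange_form_def using W_pos[of \<sigma>] W_pos[of \<tau>]
  by (intro mult_nonneg_nonneg[OF _ ln_difference_product_nonneg[OF assms]]) simp

lemma exchange_commute: "exchange i l j k \<sigma> = exchange j k i l \<sigma>"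
  by (intro ext) (auto simp: exchange_def)

text \<open>
  The exchange of a particle at \<open>x\<close> with a hole at \<open>y\<close> occurs in the Dirichlet form twice,
  for \<open>(x, y)\<close> and for \<open>(y, x)\<close>; all other summands are nonnegative. The factor \<open>N\<close> comes
  from \<open>block_kernel\<close>, which divides by the size of the block in \<open>'n\<close> and not by its number
  of sites in all replicas.
\<close>

lemma exchange_sum_lower_bound:
  assumes F: "\<And>\<sigma>. \<sigma> \<in> \<Omega> \<Longrightarrow> 0 \<le> F \<sigma>" and c: "compatible F"
  shows "2 * real N * (\<Sum>X\<in>\<B>. \<Sum>x\<in>X. \<Sum>y\<in>{y\<in>sites - X. label y = label x}.
        exchange_form F (decode X) (decode (insert y (X - {x}))) / card {z\<in>sites. label z = label x})
    \<le> (\<Sum>i\<in>{1..N}. \<Sum>j\<in>{1..N}. \<Sum>l\<in>UNIV. \<Sum>k\<in>UNIV.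
       block_kernel \<A> l k * (\<Sum>\<sigma>\<in>\<Omega>. exchange_form F \<sigma> (exchange i l j k \<sigma>)))"
proof -
  define ex where "ex x y \<sigma> = exchange (fst x) (snd x) (fst y) (snd y) \<sigma>" for x y :: "nat \<times> 'n" and \<sigma> :: "'n replicas"
  define q where "q X x y = block_kernel \<A> (snd x) (snd y) * exchange_form F (decode X) (ex x y (decode X))" for X x y
  have dec: "decode X \<in> \<Omega>" if "X \<in> \<B>" for X using bij_decode that by (auto simp: bij_betw_def)
  have q0: "0 \<le> q X x y" if X: "X \<in> \<B>" and xy: "x \<in> sites" "y \<in> sites" for X x y
  proof (cases "block_of (snd y) = block_of (snd x)")
    case True
    have ij: "fst x \<in> {1..N}" "fst y \<in> {1..N}" using xy by (auto simp: sites_def)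
    have "F (decode X) = 0 \<longleftrightarrow> F (ex x y (decode X)) = 0"
      using c dec[OF X] ij True unfolding compatible_def ex_def by blast
    then have "0 \<le> exchange_form F (decode X) (ex x y (decode X))"
      using dec[OF X] exchange_in_Omega[OF dec[OF X] ij True] by (intro exchange_form_nonneg F) (auto simp: ex_def)
    then show ?thesis by (simp add: q_def block_kernel_eq)
  qed (simp add: q_def block_kernel_eq)
  have qsym: "q X x y = q X y x" for X x y
    by (simp add: q_def block_kernel_eq ex_def exchange_commute[of "fst x" "snd x"])
  have rearrange: "(\<Sum>i\<in>{1..N}. \<Sum>j\<in>{1..N}. \<Sum>l\<in>UNIV. \<Sum>k\<in>UNIV. block_kernel \<A> l k * (\<Sum>\<sigma>\<in>\<Omega>. exchange_form F \<sigma> (exchange i l j k \<sigma>)))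
    = (\<Sum>X\<in>\<B>. \<Sum>x\<in>sites. \<Sum>y\<in>sites. q X x y)"
  proof -
    define t where "t x y \<sigma> = block_kernel \<A> (snd x) (snd y) * exchange_form F \<sigma> (ex x y \<sigma>)" for x y \<sigma>
    have "(\<Sum>i\<in>{1..N}. \<Sum>j\<in>{1..N}. \<Sum>l\<in>UNIV. \<Sum>k\<in>UNIV. block_kernel \<A> l k * (\<Sum>\<sigma>\<in>\<Omega>. exchange_form F \<sigma> (exchange i l j k \<sigma>)))
      = (\<Sum>i\<in>{1..N}. \<Sum>j\<in>{1..N}. \<Sum>l\<in>UNIV. \<Sum>k\<in>UNIV. \<Sum>\<sigma>\<in>\<Omega>. t (i, l) (j, k) \<sigma>)"
      by (simp only: t_def ex_def fst_conv snd_conv sum_distrib_left)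
    also have "\<dots> = (\<Sum>i\<in>{1..N}. \<Sum>l\<in>UNIV. \<Sum>j\<in>{1..N}. \<Sum>k\<in>UNIV. \<Sum>\<sigma>\<in>\<Omega>. t (i, l) (j, k) \<sigma>)"
      by (intro sum.cong[OF refl] sum.swap)
    also have "\<dots> = (\<Sum>i\<in>{1..N}. \<Sum>l\<in>UNIV. \<Sum>y\<in>sites. \<Sum>\<sigma>\<in>\<Omega>. t (i, l) y \<sigma>)"
    proof (intro sum.cong[OF refl])
      fix i l
      show "(\<Sum>j\<in>{1..N}. \<Sum>k\<in>UNIV. \<Sum>\<sigma>\<in>\<Omega>. t (i, l) (j, k) \<sigma>) = (\<Sum>y\<in>sites. \<Sum>\<sigma>\<in>\<Omega>. t (i, l) y \<sigma>)"
        using sum.cartesian_product[of "\<lambda>j k. \<Sum>\<sigma>\<in>\<Omega>. t (i, l) (j, k) \<sigma>" UNIV "{1..N}"]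
        unfolding sites_def by (simp only: case_prod_unfold prod.collapse)
    qed
    also have "\<dots> = (\<Sum>x\<in>sites. \<Sum>y\<in>sites. \<Sum>\<sigma>\<in>\<Omega>. t x y \<sigma>)"
      using sum.cartesian_product[of "\<lambda>i l. \<Sum>y\<in>sites. \<Sum>\<sigma>\<in>\<Omega>. t (i, l) y \<sigma>" UNIV "{1..N}"]
      unfolding sites_def by (simp add: case_prod_unfold)
    also have "\<dots> = (\<Sum>x\<in>sites. \<Sum>\<sigma>\<in>\<Omega>. \<Sum>y\<in>sites. t x y \<sigma>)" by (intro sum.cong[OF refl] sum.swap)
    also have "\<dots> = (\<Sum>\<sigma>\<in>\<Omega>. \<Sum>x\<in>sites. \<Sum>y\<in>sites. t x y \<sigma>)" by (rule sum.swap)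
    also have "\<dots> = (\<Sum>X\<in>\<B>. \<Sum>x\<in>sites. \<Sum>y\<in>sites. t x y (decode X))"
      by (rule sum.reindex_bij_betw[OF bij_decode, symmetric])
    finally show ?thesis by (simp only: t_def q_def)
  qed
  have main: "2 * (\<Sum>x\<in>X. \<Sum>y\<in>sites - X. q X x y) \<le> (\<Sum>x\<in>sites. \<Sum>y\<in>sites. q X x y)" if X: "X \<in> \<B>" for X
  proof -
    have XV: "X \<subseteq> sites" by (rule block_setsD[OF X])
    have fin: "finite X" "finite (sites - X)" using finite_subset[OF XV finite_sites] finite_sites by auto
    have "(\<Sum>x\<in>X. \<Sum>y\<in>sites - X. q X x y) \<le> (\<Sum>x\<in>X. \<Sum>y\<in>sites. q X x y)"
      using q0[OF X] XV finite_sites by (intro sum_mono sum_mono2) auto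
    moreover have "(\<Sum>x\<in>X. \<Sum>y\<in>sites - X. q X x y) \<le> (\<Sum>x\<in>sites - X. \<Sum>y\<in>sites. q X x y)"
    proof -
      have "(\<Sum>x\<in>X. \<Sum>y\<in>sites - X. q X x y) = (\<Sum>y\<in>sites - X. \<Sum>x\<in>X. q X x y)" by (rule sum.swap)
      also have "\<dots> = (\<Sum>x\<in>sites - X. \<Sum>y\<in>X. q X x y)" by (intro sum.cong refl qsym)
      also have "\<dots> \<le> (\<Sum>x\<in>sites - X. \<Sum>y\<in>sites. q X x y)"
        using q0[OF X] XV finite_sites by (intro sum_mono sum_mono2) auto
      finally show ?thesis .
    qed
    moreover have "(\<Sum>x\<in>sites. \<Sum>y\<in>sites. q X x y) = (\<Sum>x\<in>sites - X. \<Sum>y\<in>sites. q X x y) + (\<Sum>x\<in>X. \<Sum>y\<in>sites. q X x y)"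
      by (rule sum.subset_diff[OF XV finite_sites])
    ultimately show ?thesis by simp
  qed
  have inner: "(\<Sum>y\<in>sites - X. q X x y) = real N * (\<Sum>y\<in>{y\<in>sites - X. label y = label x}.
        exchange_form F (decode X) (decode (insert y (X - {x}))) / card {z\<in>sites. label z = label x})"
    if X: "X \<in> \<B>" and x: "x \<in> X" for X x
  proof -
    have xs: "x \<in> sites" using block_setsD[OF X] x by auto
    have cardb: "real (card {z\<in>sites. label z = label x}) = real N * real (card (block_of (snd x)))"
      using card_label[of "block_of (snd x)"] by (simp add: label_def block_of(1))
    have "(\<Sum>y\<in>sites - X. q X x y) = (\<Sum>y\<in>{y\<in>sites - X. label y = label x}. q X x y)"
      using finite_sites by (intro sum.mono_neutral_right) (auto simp: q_def block_kernel_eq label_def)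
    also have "\<dots> = (\<Sum>y\<in>{y\<in>sites - X. label y = label x}. real N *
        (exchange_form F (decode X) (decode (insert y (X - {x}))) / card {z\<in>sites. label z = label x}))"
    proof (rule sum.cong[OF refl])
      fix y assume y: "y \<in> {y\<in>sites - X. label y = label x}"
      then have kl: "block_of (snd y) = block_of (snd x)" by (simp add: label_def)
      have ij: "fst x \<in> {1..N}" "fst y \<in> {1..N}" using xs y by (auto simp: sites_def)
      have "ex x y (decode X) = decode (insert y (X - {x}))"
        unfolding ex_def exchange_decode[OF X ij kl] using x y by simp
      then show "q X x y = real N * (exchange_form F (decode X) (decode (insert y (X - {x}))) / card {z\<in>sites. label z = label x})"
        unfolding q_def cardb using N kl by (simp add: block_kernel_eq)
    qed
    finally show ?thesis by (simp only: sum_distrib_left)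
  qed
  define G where "G X x = (\<Sum>y\<in>{y\<in>sites - X. label y = label x}.
        exchange_form F (decode X) (decode (insert y (X - {x}))) / card {z\<in>sites. label z = label x})" for X x
  have "2 * real N * (\<Sum>X\<in>\<B>. \<Sum>x\<in>X. G X x) = (\<Sum>X\<in>\<B>. 2 * (\<Sum>x\<in>X. real N * G X x))"
    by (simp only: sum_distrib_left mult.assoc)
  also have "\<dots> = (\<Sum>X\<in>\<B>. 2 * (\<Sum>x\<in>X. \<Sum>y\<in>sites - X. q X x y))"
    using inner unfolding G_def by (intro sum.cong refl arg_cong[where f="(*) 2"]) simp
  also have "\<dots> \<le> (\<Sum>X\<in>\<B>. \<Sum>x\<in>sites. \<Sum>y\<in>sites. q X x y)" by (rule sum_mono[OF main])
  finally show ?thesis unfolding rearrange G_def .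
qed

theorem entropy_le_dirichlet:
  assumes J: "nonneg_definite J" and c0: "2 * largest_eigenvalue J \<le> c0" "0 < c0" "c0 < 1"
    and F: "\<And>\<sigma>. \<sigma> \<in> \<Omega> \<Longrightarrow> 0 \<le> F \<sigma>"
  shows "ereal ((1 - c0)\<^sup>2 * exp (- 4 * max_abs_row_sum J) / (2 * real CARD('n)) * Ent (mu_N J \<A> N \<rho>) F)
    \<le> dirichlet_form J (block_kernel \<A>) \<A> N \<rho> (\<lambda>\<sigma>. ereal (F \<sigma>)) (\<lambda>\<sigma>. ext_ln (F \<sigma>))"
proof (cases "compatible F")
  case False
  then show ?thesis using dirichlet_infinite[of F] F by simp
next
  case c: True
  define w f where "w X = W (decode X)" and "f X = F (decode X)" for X
  define C where "C = exp (4 * max_abs_row_sum J)"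
  define Q where "Q = (\<Sum>X\<in>\<B>. \<Sum>x\<in>X. \<Sum>y\<in>{y\<in>sites - X. label y = label x}.
        exchange_form F (decode X) (decode (insert y (X - {x}))) / card {z\<in>sites. label z = label x})"
  define k where "k = (\<Sum>b\<in>label ` sites. \<kappa> b)"
  have k: "card X = k" if "X \<in> \<B>" for X unfolding k_def by (rule card_block_sets[OF finite_sites that])
  have dec: "decode X \<in> \<Omega>" if "X \<in> \<B>" for X using bij_decode that by (auto simp: bij_betw_def)
  have f0: "0 \<le> f X" if "X \<in> \<B>" for X unfolding f_def by (rule F[OF dec[OF that]])
  have ex: "decode (insert y (X - {x})) = exchange (fst x) (snd x) (fst y) (snd y) (decode X)"
    "fst x \<in> {1..N}" "fst y \<in> {1..N}" "block_of (snd y) = block_of (snd x)"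
    if X: "X \<in> \<B>" and x: "x \<in> X" and y: "y \<in> sites - X" "label y = label x" for X x y
  proof -
    have xs: "x \<in> sites" using block_setsD[OF X] x by auto
    show kl: "block_of (snd y) = block_of (snd x)" using y by (simp add: label_def)
    show ij: "fst x \<in> {1..N}" "fst y \<in> {1..N}" using xs y by (auto simp: sites_def)
    show "decode (insert y (X - {x})) = exchange (fst x) (snd x) (fst y) (snd y) (decode X)"
      unfolding exchange_decode[OF X ij kl] using x y by simp
  qed
  have went: "went \<Omega> W F = went \<B> w f"
    unfolding went_def w_def f_def by (simp add: sum.reindex_bij_betw[OF bij_decode, symmetric])
  have "(1 - c0)\<^sup>2 * went \<B> w f \<le> (\<Sum>S\<in>{S. S \<subseteq> sites \<and> card S + 1 = k}. went (above \<B> S) w f)"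
    unfolding w_def by (rule localized_factorization[OF J c0 k f0])
  also have "\<dots> \<le> 2 * C * (\<Sum>X\<in>\<B>. \<Sum>x\<in>X. \<Sum>y\<in>{y\<in>sites - X. label y = label x}.
       (w X * w (insert y (X - {x})) / (w X + w (insert y (X - {x}))) *
         ((f X - f (insert y (X - {x}))) * (ln (f X) - ln (f (insert y (X - {x})))))) / card {z\<in>sites. label z = label x})"
  proof (rule star_entropy_le_exchange_form[OF finite_sites k])
    show "0 < w X" for X by (simp add: w_def W_pos)
    show "0 \<le> f X" if "X \<in> \<B>" for X by (rule f0[OF that])
    show "1 \<le> C" unfolding C_def using max_abs_row_sum_nonneg[of J] by simp
    show "2 * \<kappa> b \<le> card {x\<in>sites. label x = b}" for b by (rule minority)
    fix X x y assume a: "X \<in> \<B>" "x \<in> X" "y \<in> sites - X" "label y = label x"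
    show "w X \<le> C * w (insert y (X - {x}))"
      unfolding w_def C_def ex(1)[OF a] by (rule W_exchange_le[OF decode_PiE ex(2,3)[OF a]])
    show "f X = 0 \<longleftrightarrow> f (insert y (X - {x})) = 0"
      unfolding f_def ex(1)[OF a] using c dec[OF a(1)] ex(2-4)[OF a] unfolding compatible_def by blast
  qed
  also have "\<dots> = 2 * C * Q" by (simp only: Q_def exchange_form_def w_def f_def)
  finally have 1: "(1 - c0)\<^sup>2 * went \<Omega> W F \<le> 2 * C * Q" unfolding went .
  define E where "E = (\<Sum>i\<in>{1..N}. \<Sum>j\<in>{1..N}. \<Sum>l\<in>UNIV. \<Sum>k\<in>UNIV.
       block_kernel \<A> l k * (\<Sum>\<sigma>\<in>\<Omega>. exchange_form F \<sigma> (exchange i l j k \<sigma>)))"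
  have 2: "2 * real N * Q \<le> E" unfolding Q_def E_def by (rule exchange_sum_lower_bound[OF F c])
  have finite: "dirichlet_form J (block_kernel \<A>) \<A> N \<rho> (\<lambda>\<sigma>. ereal (F \<sigma>)) (\<lambda>\<sigma>. ext_ln (F \<sigma>)) =
    ereal (1 / (2 * real N * real CARD('n)) * (\<Sum>i\<in>{1..N}. \<Sum>j\<in>{1..N}. \<Sum>l\<in>UNIV. \<Sum>k\<in>UNIV.
       block_kernel \<A> l k * (\<Sum>\<sigma>\<in>\<Omega>. exchange_form F \<sigma> (exchange i l j k \<sigma>) / Z\<Omega>)))"
    by (rule dirichlet_finite[OF F c])
  have "dirichlet_form J (block_kernel \<A>) \<A> N \<rho> (\<lambda>\<sigma>. ereal (F \<sigma>)) (\<lambda>\<sigma>. ext_ln (F \<sigma>))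
    = ereal (1 / (2 * real N * real CARD('n)) * (E / Z\<Omega>))"
    unfolding finite E_def by (simp only: sum_divide_distrib[symmetric] times_divide_eq_right)
  moreover have "(1 - c0)\<^sup>2 * exp (- 4 * max_abs_row_sum J) / (2 * real CARD('n)) * Ent (mu_N J \<A> N \<rho>) F
    \<le> 1 / (2 * real N * real CARD('n)) * (E / Z\<Omega>)"
  proof -
    have C: "0 < C" "exp (- 4 * max_abs_row_sum J) = 1 / C" by (simp_all add: C_def exp_minus field_simps)
    have N0: "0 < real N" using N by simp
    have n0: "0 < real CARD('n)" by simp
    have "(1 - c0)\<^sup>2 * went \<Omega> W F / (2 * C) \<le> Q" using 1 C by (simp add: divide_le_eq mult.commute)
    also have "Q \<le> E / (2 * real N)" using 2 N0 by (simp add: le_divide_eq mult.commute)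
    finally have "(1 - c0)\<^sup>2 * went \<Omega> W F / (2 * C) / (real CARD('n) * Z\<Omega>) \<le> E / (2 * real N) / (real CARD('n) * Z\<Omega>)"
      using n0 Z\<Omega>_pos by (intro divide_right_mono) auto
    then show ?thesis unfolding C Ent_mu_N by (simp add: field_simps)
  qed
  ultimately show ?thesis by simp
qed

end

theorem theorem1p10:
  fixes J :: "real^'n^'n"
    and \<A> :: "'n set set"
    and N :: nat
    and \<rho> :: "'n set \<Rightarrow> real"
  assumes "nonneg_definite J"
    and "largest_eigenvalue J < 1/2"
    and "partition_on UNIV \<A>"
    and "N \<ge> 2"
    and "\<rho> \<in> density_profiles \<A> N"
  shows "\<exists>\<alpha> \<ge> 1 / (4 * real CARD('n)) * (1 - 2 * largest_eigenvalue J)^2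
                  * exp (- 16 * max_abs_row_sum J).
    \<forall>F :: 'n replicas \<Rightarrow> real. (\<forall>\<sigma> \<in> Omega_N \<A> N \<rho>. F \<sigma> \<ge> 0) \<longrightarrow>
      dirichlet_form J (block_kernel \<A>) \<A> N \<rho> (\<lambda>\<sigma>. ereal (F \<sigma>)) (\<lambda>\<sigma>. ext_ln (F \<sigma>))
        \<ge> ereal (\<alpha> * Ent (mu_N J \<A> N \<rho>) F)"
proof -
  interpret replica_setting J \<A> N \<rho>
    using assms by unfold_locales (auto simp: nonneg_definite_def)
  define l where "l = largest_eigenvalue J"
  have l: "0 \<le> l" "l < 1 / 2" unfolding l_def using rayleigh_bound(2)[OF assms(1)] assms(2) by auto
  \<comment> \<open>The initial variance constant must be positive. If \<open>2 l < 1/4\<close>, replacing it by \<open>1/4\<close>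
    costs at most the factor 2, since \<open>2 (3/4)\<^sup>2 \<ge> 1\<close>; the constant \<open>1 / (2 n)\<close> in
    \<open>entropy_le_dirichlet\<close> against \<open>1 / (4 n)\<close> provides this factor.\<close>
  define c0 where "c0 = max (2 * l) (1 / 4)"
  have c0: "2 * l \<le> c0" "0 < c0" "c0 < 1" using l by (auto simp: c0_def)
  define \<alpha> where "\<alpha> = (1 - c0)\<^sup>2 * exp (- 4 * max_abs_row_sum J) / (2 * real CARD('n))"
  have sq: "(1 - 2 * l)\<^sup>2 \<le> 2 * (1 - c0)\<^sup>2"
  proof (cases "1 / 4 \<le> 2 * l")
    case True
    then have "c0 = 2 * l" by (simp add: c0_def)
    then show ?thesis by simp
  next
    case False
    then have "c0 = 1 / 4" by (simp add: c0_def)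
    then have "2 * (1 - c0)\<^sup>2 = 9 / 8" by (simp only:) (simp add: power2_eq_square)
    moreover have "(1 - 2 * l)\<^sup>2 \<le> 1" using l by (intro power_le_one) auto
    ultimately show ?thesis by linarith
  qed
  have "1 / (4 * real CARD('n)) * (1 - 2 * l)\<^sup>2 * exp (- 16 * max_abs_row_sum J)
     \<le> 1 / (4 * real CARD('n)) * (2 * (1 - c0)\<^sup>2) * exp (- 4 * max_abs_row_sum J)"
    using sq max_abs_row_sum_nonneg[of J] by (intro mult_mono mult_left_mono) auto
  also have "\<dots> = \<alpha>" by (simp add: \<alpha>_def)
  finally have "\<alpha> \<ge> 1 / (4 * real CARD('n)) * (1 - 2 * l)\<^sup>2 * exp (- 16 * max_abs_row_sum J)" .
  moreover have "ereal (\<alpha> * Ent (mu_N J \<A> N \<rho>) F)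
      \<le> dirichlet_form J (block_kernel \<A>) \<A> N \<rho> (\<lambda>\<sigma>. ereal (F \<sigma>)) (\<lambda>\<sigma>. ext_ln (F \<sigma>))"
    if "\<forall>\<sigma>\<in>Omega_N \<A> N \<rho>. F \<sigma> \<ge> 0" for F
    unfolding \<alpha>_def using that c0 by (intro entropy_le_dirichlet assms(1)) (auto simp: l_def)
  ultimately show ?thesis unfolding l_def by blast
qed

end
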